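(* Let $n\ge2$, $t\in(0,1)$, and let $A_1,\dots,A_n$ be positive invertible operators on a Hilbert space $\mathcal{H}$ with $mI\le A_i\le MI$ for all $i$ and some scalars $0<m<M$. Then for $p\ge2$, \[ A[n,t](A_1,\dots,A_n)^p\le \frac{(m+M)^{2p}}{16m^pM^p}G[n,t](A_1,\dots,A_n)^p. \]
   Context: For positive invertible $A,B$ and $t\in(0,1)$, $A\sharp_tB:=A^{1/2}(A^{-1/2}BA^{-1/2})^tA^{1/2}$. Lawson–Lim weighted geometric mean: $G[2,t](A_1,A_2)=A_1\sharp_tA_2$; for $n\ge3$, put $A_i^{(0)}=A_i$ and $A_i^{(r)}=G[n-1,t]\big(A_1^{(r-1)},\dots,A_{i-1}^{(r-1)},A_{i+1}^{(r-1)},\dots,A_n^{(r-1)}\big)$; the sequences $(A_i^{(r)})_r$ converge (in the Thompson metric) to a common limit, defined to be $G[n,t](A_1,\dots,A_n)$. The weighted arithmetic mean $A[n,t]$ is defined by the same recursion starting from $A[2,t](A_1,A_2)=(1-t)A_1+tA_2$; it has the form $A[n,t](A_1,\dots,A_n)=\sum_{i=1}^n t[n]_iA_i$ with coefficients $t[n]_i\ge0$, $\sum_it[n]_i=1$, depending only on $n$ and $t$. *)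

theory Defs
  imports "HOL-Analysis.Analysis" "HOL-Computational_Algebra.Polynomial"
begin

type_synonym 'a op = "'a \<Rightarrow>\<^sub>L 'a"

definition self_adjoint :: "'a::{real_inner,complete_space} op \<Rightarrow> bool" where
  "self_adjoint T \<longleftrightarrow> (\<forall>x y. inner (T x) y = inner x (T y))"

definition positive_op :: "'a::{real_inner,complete_space} op \<Rightarrow> bool" where
  "positive_op T \<longleftrightarrow> self_adjoint T \<and> (\<forall>x. 0 \<le> inner (T x) x)"

definition loewner :: "'a::{real_inner,complete_space} op \<Rightarrow> 'a op \<Rightarrow> bool" where
  "loewner A B \<longleftrightarrow> positive_op (B - A)"

definition invertible_op :: "'a::{real_inner,complete_space} op \<Rightarrow> bool" where
  "invertible_op A \<longleftrightarrow> (\<exists>B. A o\<^sub>L B = id_blinfun \<and> B o\<^sub>L A = id_blinfun)"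

definition posinv :: "'a::{real_inner,complete_space} op \<Rightarrow> bool" where
  "posinv A \<longleftrightarrow> positive_op A \<and> invertible_op A"

definition op_power :: "'a::{real_inner,complete_space} op \<Rightarrow> nat \<Rightarrow> 'a op" where
  "op_power X k = ((\<lambda>Y. X o\<^sub>L Y) ^^ k) id_blinfun"

definition polyop :: "real poly \<Rightarrow> 'a::{real_inner,complete_space} op \<Rightarrow> 'a op" where
  "polyop q X = (\<Sum>i\<le>degree q. coeff q i *\<^sub>R op_power X i)"

text \<open>Continuous functional calculus for self-adjoint operators: f(X) is the norm
  limit of q_k(X) for any sequence of polynomials q_k converging uniformly to f on an
  interval [a,b] with a I \<le> X \<le> b I.\<close>
definition cfun :: "(real \<Rightarrow> real) \<Rightarrow> 'a::{real_inner,complete_space} op \<Rightarrow> 'a op" where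
  "cfun f X = (THE Y. \<forall>a b (q :: nat \<Rightarrow> real poly).
      loewner (a *\<^sub>R id_blinfun) X \<and> loewner X (b *\<^sub>R id_blinfun) \<and>
      uniform_limit {a..b} (\<lambda>k x. poly (q k) x) f sequentially
      \<longrightarrow> ((\<lambda>k. polyop (q k) X) \<longlonglongrightarrow> Y))"

definition opow :: "'a::{real_inner,complete_space} op \<Rightarrow> real \<Rightarrow> 'a op" where
  "opow X r = cfun (\<lambda>x. x powr r) X"

definition sharp :: "real \<Rightarrow> 'a::{real_inner,complete_space} op \<Rightarrow> 'a op \<Rightarrow> 'a op" where
  "sharp t A B = opow A (1/2) o\<^sub>L
      opow (opow A (-1/2) o\<^sub>L B o\<^sub>L opow A (-1/2)) t o\<^sub>L opow A (1/2)"

definition wam2 :: "real \<Rightarrow> 'a::{real_inner,complete_space} op \<Rightarrow> 'a op \<Rightarrow> 'a op" where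
  "wam2 t A B = (1 - t) *\<^sub>R A + t *\<^sub>R B"

definition Mop :: "'a::{real_inner,complete_space} op \<Rightarrow> 'a op \<Rightarrow> real" where
  "Mop A B = Inf {c. 0 < c \<and> loewner A (c *\<^sub>R B)}"

definition thompson :: "'a::{real_inner,complete_space} op \<Rightarrow> 'a op \<Rightarrow> real" where
  "thompson A B = max (ln (Mop A B)) (ln (Mop B A))"

definition drop_nth :: "nat \<Rightarrow> 'b list \<Rightarrow> 'b list" where
  "drop_nth i xs = take i xs @ drop (Suc i) xs"

text \<open>Lawson--Lim recursion. llrec base t k is the mean of (k+2) operators
  (given as a list of length k+2), built from the two-variable mean base t.\<close>
primrec llrec :: "(real \<Rightarrow> 'a::{real_inner,complete_space} op \<Rightarrow> 'a op \<Rightarrow> 'a op)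
    \<Rightarrow> real \<Rightarrow> nat \<Rightarrow> 'a op list \<Rightarrow> 'a op" where
  "llrec base t 0 = (\<lambda>As. base t (As ! 0) (As ! 1))"
| "llrec base t (Suc k) = (\<lambda>As.
     let step = (\<lambda>Bs. map (\<lambda>i. llrec base t k (drop_nth i Bs)) [0..<length Bs])
     in THE L. posinv L \<and>
        (\<forall>i<length As. ((\<lambda>r. thompson (((step ^^ r) As) ! i) L) \<longlonglongrightarrow> 0)))"

definition GM :: "real \<Rightarrow> 'a::{real_inner,complete_space} op list \<Rightarrow> 'a op" where
  "GM t As = llrec sharp t (length As - 2) As"

definition AM :: "real \<Rightarrow> 'a::{real_inner,complete_space} op list \<Rightarrow> 'a op" where
  "AM t As = llrec wam2 t (length As - 2) As"

end

theory Submission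
  imports Defs "HOL-Computational_Algebra.Fundamental_Theorem_Algebra"
begin

text \<open>
  Write \<open>X = A[n,t](A\<^sub>1,\<dots>,A\<^sub>n)\<close> and \<open>G = G[n,t](A\<^sub>1,\<dots>,A\<^sub>n)\<close>. The inequality
  \<open>X + mM G\<^sup>-\<^sup>1 \<le> m + M\<close> holds for a single operator (\<open>X = G = A\<^sub>i\<close>) since
  \<open>(x - m)(x - M) \<le> 0\<close> on \<open>[m,M]\<close>, is inherited by the two-variable means because
  \<open>(A \<sharp>\<^sub>t B)\<^sup>-\<^sup>1 \<le> (1-t) A\<^sup>-\<^sup>1 + t B\<^sup>-\<^sup>1\<close>, and survives the limits of the recursion. With \<open>s = p/2 \<ge> 1\<close>
  it gives \<open>X\<^sup>s + (mM)\<^sup>s G\<^sup>-\<^sup>s \<le> (m + M)\<^sup>s\<close>, as \<open>x\<^sup>s \<le> (m+M)\<^sup>s\<^sup>-\<^sup>1 x\<close> on \<open>[0,m+M]\<close>, and the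
  Bhatia--Kittaneh inequality \<open>\<parallel>PQ\<parallel> \<le> \<parallel>P + Q\<parallel>\<^sup>2 / 4\<close> for positive \<open>P, Q\<close> then bounds
  \<open>\<parallel>X\<^sup>s G\<^sup>-\<^sup>s\<parallel>\<close>, which is the claim.

  The recursions converge because both means are convex for a metric (the norm, respectively the
  Thompson metric, by Loewner--Heinz): changing a single argument contracts distances by
  \<open>max t (1-t)\<close>, and consecutive entries of the next iterate are means of lists that differ in
  one place.
\<close>

subsection \<open>Operators and the Loewner order\<close>

unbundle inner_syntax


text \<open>The obstacle is that \<open>cfun\<close> and \<open>llrec\<close> are definite
  descriptions: nothing can be said about powers or means before existence and uniqueness of the
  described operator are known. For \<open>cfun\<close> this rests on one fact, that a polynomial
  nonnegative on [a,b] gives a positive operator, obtained over the reals by splitting off linear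
  and quadratic factors. For \<open>llrec\<close> the description ranges over all positive
  invertible L and speaks of the Thompson metric even in the arithmetic recursion, so the Thompson
  metric has to be compared with the norm on the operators between m and M. Since x^s is not
  operator monotone for s > 1, the passage to s-th powers compares each of the two summands with a
  multiple of itself; this works because both X and mM G^(-1) lie between m and M. The constant is
  the square of (m + M)^p / (4 (mM)^(p/2)): the 16 is the square of the 4 in the Bhatia--Kittaneh
  inequality.\<close>

lemma blinfun_Cauchy_convergent:
  fixes X :: "nat \<Rightarrow> 'b::real_normed_vector \<Rightarrow>\<^sub>L 'c::{real_normed_vector,complete_space}"
  assumes "Cauchy X"
  shows "convergent X"
proof -
  have Cx: "Cauchy (\<lambda>n. X n x)" for x
  proof (rule bounded_linear.Cauchy[OF _ assms])
    show "bounded_linear (\<lambda>T. blinfun_apply T x)" by (rule blinfun.bounded_linear_left)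
  qed
  then have "\<exists>l. (\<lambda>n. X n x) \<longlonglongrightarrow> l" for x
    using Cauchy_convergent[OF Cx[of x]] by (simp add: convergent_def)
  then obtain v where v: "\<And>x. (\<lambda>n. X n x) \<longlonglongrightarrow> v x" by metis
  obtain K where K: "\<And>n. norm (X n) \<le> K"
    using Cauchy_Bseq[OF assms] unfolding Bseq_def by blast
  have bv: "bounded_linear v"
  proof (rule bounded_linear_intro)
    show "v (x + y) = v x + v y" for x y
      using tendsto_add[OF v[of x] v[of y]] v[of "x + y"]
      by (simp add: blinfun.add_right LIMSEQ_unique)
    show "v (r *\<^sub>R x) = r *\<^sub>R v x" for r x
      using tendsto_scaleR[OF tendsto_const[of r] v[of x]] v[of "r *\<^sub>R x"]
      by (simp add: blinfun.scaleR_right LIMSEQ_unique)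
    show "norm (v x) \<le> norm x * K" for x
    proof (rule tendsto_upperbound[OF tendsto_norm[OF v]])
      show "\<forall>\<^sub>F n in sequentially. norm (X n x) \<le> norm x * K"
      proof (rule always_eventually, rule allI)
        show "norm (X n x) \<le> norm x * K" for n
          using norm_blinfun[of "X n" x] mult_right_mono[OF K[of n] norm_ge_zero[of x]]
          by (simp add: mult.commute)
      qed
    qed simp
  qed
  have "X \<longlonglongrightarrow> Blinfun v"
  proof (rule LIMSEQ_I)
    fix r :: real assume "r > 0"
    then obtain N where N: "\<And>m n. m \<ge> N \<Longrightarrow> n \<ge> N \<Longrightarrow> norm (X m - X n) < r / 2"
      using CauchyD[OF assms, of "r / 2"] by auto
    have "norm (X n - Blinfun v) \<le> r / 2" if n: "n \<ge> N" for n
    proof (rule norm_blinfun_bound)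
      fix x
      \<comment> \<open>The Cauchy bound at a fixed vector survives letting the second index tend to
        infinity; as it is uniform in x, the pointwise limit is a limit in norm.\<close>
      have "(\<lambda>m. norm (X n x - X m x)) \<longlonglongrightarrow> norm (X n x - v x)"
        by (intro tendsto_intros v)
      moreover have "\<forall>\<^sub>F m in sequentially. norm (X n x - X m x) \<le> r / 2 * norm x"
        using eventually_ge_at_top[of N]
      proof eventually_elim
        case (elim m)
        have "norm (X n x - X m x) \<le> norm (X n - X m) * norm x"
          using norm_blinfun[of "X n - X m" x] by (simp add: blinfun.diff_left)
        also have "\<dots> \<le> r / 2 * norm x"
          using N[OF n elim] by (intro mult_right_mono) auto
        finally show ?case .
      qed
      ultimately have "norm (X n x - v x) \<le> r / 2 * norm x"
        by (rule tendsto_upperbound) simp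
      then show "norm ((X n - Blinfun v) x) \<le> r / 2 * norm x"
        by (simp add: blinfun.diff_left bounded_linear_Blinfun_apply[OF bv])
    qed (use \<open>r > 0\<close> in simp)
    moreover have "r / 2 < r" using \<open>r > 0\<close> by simp
    ultimately show "\<exists>no. \<forall>n\<ge>no. norm (X n - Blinfun v) < r" using le_less_trans by blast
  qed
  then show ?thesis by (rule convergentI)
qed

lemma blinfun_compose_assoc: "(A o\<^sub>L B) o\<^sub>L C = A o\<^sub>L (B o\<^sub>L C)"
  by (rule blinfun_eqI) simp

lemma blinfun_compose_id [simp]: "A o\<^sub>L id_blinfun = A" "id_blinfun o\<^sub>L A = A"
  by (auto intro: blinfun_eqI)

lemmas compose_bilinear_simps =
  bounded_bilinear.add_left[OF bounded_bilinear_blinfun_compose]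
  bounded_bilinear.add_right[OF bounded_bilinear_blinfun_compose]
  bounded_bilinear.diff_left[OF bounded_bilinear_blinfun_compose]
  bounded_bilinear.diff_right[OF bounded_bilinear_blinfun_compose]
  bounded_bilinear.scaleR_left[OF bounded_bilinear_blinfun_compose]
  bounded_bilinear.scaleR_right[OF bounded_bilinear_blinfun_compose]

lemmas tendsto_blinfun_compose =
  bounded_bilinear.tendsto[OF bounded_bilinear_blinfun_compose]

lemma self_adjointD: "self_adjoint T \<Longrightarrow> T x \<bullet> y = x \<bullet> T y"
  by (simp add: self_adjoint_def)

lemma self_adjoint_simps [simp]:
  "self_adjoint 0" "self_adjoint id_blinfun"
  "self_adjoint A \<Longrightarrow> self_adjoint (c *\<^sub>R A)"
  "self_adjoint A \<Longrightarrow> self_adjoint B \<Longrightarrow> self_adjoint (A + B)"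
  "self_adjoint A \<Longrightarrow> self_adjoint B \<Longrightarrow> self_adjoint (A - B)"
  by (auto simp: self_adjoint_def blinfun.bilinear_simps inner_simps)

lemma self_adjoint_compose:
  "self_adjoint A \<Longrightarrow> self_adjoint B \<Longrightarrow> A o\<^sub>L B = B o\<^sub>L A \<Longrightarrow> self_adjoint (A o\<^sub>L B)"
  unfolding self_adjoint_def by (metis blinfun_apply_blinfun_compose)

lemma self_adjoint_sandwich:
  "self_adjoint A \<Longrightarrow> self_adjoint B \<Longrightarrow> self_adjoint (A o\<^sub>L B o\<^sub>L A)"
  unfolding self_adjoint_def by simp

lemma self_adjoint_limit:
  assumes "\<And>n. self_adjoint (X n)" and "X \<longlonglongrightarrow> L"
  shows "self_adjoint L"
  unfolding self_adjoint_def
proof (intro allI)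
  fix x y
  have "(\<lambda>n. X n x \<bullet> y) \<longlonglongrightarrow> L x \<bullet> y" "(\<lambda>n. x \<bullet> X n y) \<longlonglongrightarrow> x \<bullet> L y"
    by (intro tendsto_intros assms)+
  moreover have "X n x \<bullet> y = x \<bullet> X n y" for n
    using assms(1) by (simp add: self_adjoint_def)
  ultimately show "L x \<bullet> y = x \<bullet> L y" using LIMSEQ_unique by simp
qed

lemma loewner_iff:
  "loewner A B \<longleftrightarrow> self_adjoint (B - A) \<and> (\<forall>x. A x \<bullet> x \<le> B x \<bullet> x)"
  by (simp add: loewner_def positive_op_def blinfun.bilinear_simps inner_simps)

lemma loewnerD: "loewner A B \<Longrightarrow> A x \<bullet> x \<le> B x \<bullet> x"
  by (simp add: loewner_iff)

lemma loewnerI: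
  "self_adjoint A \<Longrightarrow> self_adjoint B \<Longrightarrow> (\<And>x. A x \<bullet> x \<le> B x \<bullet> x) \<Longrightarrow> loewner A B"
  by (simp add: loewner_iff)

lemma loewner_trans: "loewner A B \<Longrightarrow> loewner B C \<Longrightarrow> loewner A C"
proof -
  assume *: "loewner A B" "loewner B C"
  have "self_adjoint ((C - B) + (B - A))"
    using * self_adjoint_simps(4)[of "C - B" "B - A"] unfolding loewner_iff by blast
  then show ?thesis
    using order_trans[OF loewnerD[OF *(1)] loewnerD[OF *(2)]] by (simp add: loewner_iff)
qed

lemma self_adjoint_of_loewner_left:
  "loewner (a *\<^sub>R id_blinfun) X \<Longrightarrow> self_adjoint X"
  using self_adjoint_simps(4)[of "X - a *\<^sub>R id_blinfun" "a *\<^sub>R id_blinfun"]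
  by (simp add: loewner_iff)

lemma loewner_limit:
  assumes "\<And>n. loewner (X n) (Y n)" "X \<longlonglongrightarrow> A" "Y \<longlonglongrightarrow> B"
  shows "loewner A B"
proof -
  have "self_adjoint (B - A)"
    by (rule self_adjoint_limit[of "\<lambda>n. Y n - X n"])
      (use assms in \<open>auto simp: loewner_iff intro: tendsto_diff\<close>)
  moreover have "A x \<bullet> x \<le> B x \<bullet> x" for x
  proof (rule LIMSEQ_le)
    show "(\<lambda>n. X n x \<bullet> x) \<longlonglongrightarrow> A x \<bullet> x" "(\<lambda>n. Y n x \<bullet> x) \<longlonglongrightarrow> B x \<bullet> x"
      by (intro tendsto_intros assms)+
  qed (use assms(1) in \<open>auto simp: loewner_iff\<close>)
  ultimately show ?thesis by (simp add: loewner_iff)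
qed

lemma loewner_refl [simp]: "loewner A A"
  by (simp add: loewner_iff)

lemma loewner_add: "loewner A B \<Longrightarrow> loewner C D \<Longrightarrow> loewner (A + C) (B + D)"
  using self_adjoint_simps(4)[of "B - A" "D - C"]
  by (auto simp: loewner_iff blinfun.bilinear_simps inner_simps algebra_simps add_mono)

lemma loewner_scaleR: "loewner A B \<Longrightarrow> 0 \<le> c \<Longrightarrow> loewner (c *\<^sub>R A) (c *\<^sub>R B)"
  using self_adjoint_simps(3)[of "B - A" c]
  by (auto simp: loewner_iff blinfun.bilinear_simps inner_simps algebra_simps mult_left_mono)

lemma loewner_sandwich:
  assumes "loewner A B" "self_adjoint S"
  shows "loewner (S o\<^sub>L A o\<^sub>L S) (S o\<^sub>L B o\<^sub>L S)"
proof -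
  have "self_adjoint (S o\<^sub>L (B - A) o\<^sub>L S)"
    using assms by (intro self_adjoint_sandwich) (auto simp: loewner_iff)
  then show ?thesis
    using assms(1) by (simp add: loewner_iff compose_bilinear_simps self_adjointD[OF assms(2)])
qed

lemma positive_op_iff_loewner: "positive_op A \<longleftrightarrow> loewner 0 A"
  by (simp add: loewner_def)

lemma loewner_scaleR_id_mono:
  "a \<le> b \<Longrightarrow> loewner (a *\<^sub>R id_blinfun) (b *\<^sub>R id_blinfun)"
  by (rule loewnerI) (auto simp: blinfun.bilinear_simps mult_right_mono)

lemma loewner_scaleR_mono:
  assumes "positive_op A" "c \<le> d"
  shows "loewner (c *\<^sub>R A) (d *\<^sub>R A)"
  using assms by (intro loewnerI) (auto simp: positive_op_def blinfun.bilinear_simps mult_right_mono)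

text \<open>Polarisation bounds the norm by the numerical radius.\<close>

lemma norm_self_adjoint_le:
  assumes T: "self_adjoint T" and c: "0 \<le> c" and b: "\<And>x. \<bar>T x \<bullet> x\<bar> \<le> c * (norm x)\<^sup>2"
  shows "norm T \<le> c"
proof (rule norm_blinfun_bound[OF c])
  fix x
  have pol: "4 * (T x \<bullet> y) \<le> 2 * c * ((norm x)\<^sup>2 + (norm y)\<^sup>2)" for y
  proof -
    have "T (x + y) \<bullet> (x + y) - T (x - y) \<bullet> (x - y) = 4 * (T x \<bullet> y)"
      using self_adjointD[OF T, of y x]
      by (simp add: blinfun.bilinear_simps inner_simps inner_commute)
    moreover have "T (x + y) \<bullet> (x + y) - T (x - y) \<bullet> (x - y)
        \<le> c * (norm (x + y))\<^sup>2 + c * (norm (x - y))\<^sup>2"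
      using b[of "x + y"] b[of "x - y"] by linarith
    moreover have "c * (norm (x + y))\<^sup>2 + c * (norm (x - y))\<^sup>2 = 2 * c * ((norm x)\<^sup>2 + (norm y)\<^sup>2)"
      by (simp add: power2_norm_eq_inner inner_simps inner_commute algebra_simps)
    ultimately show ?thesis by linarith
  qed
  show "norm (T x) \<le> c * norm x"
  proof (cases "T x = 0")
    case False
    define s where "s = norm x / norm (T x)"
    have n: "norm (T x) > 0" using False by simp
    have "T x \<bullet> (s *\<^sub>R T x) = norm x * norm (T x)"
      using n by (simp add: s_def dot_square_norm power2_eq_square)
    moreover have "norm (s *\<^sub>R T x) = norm x" using n by (simp add: s_def)
    ultimately have "4 * (norm x * norm (T x)) \<le> 4 * c * (norm x)\<^sup>2"
      using pol[of "s *\<^sub>R T x"] by simp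
    moreover have "norm x > 0" using False by (auto simp: blinfun.zero_right)
    ultimately show ?thesis by (simp add: power2_eq_square)
  qed (use c in simp)
qed

text \<open>The form of S at x + s y is a nonnegative quadratic in s. For b > 0 its minimum at s =
  -c/b gives the claim; for b = 0 it is affine in s, which forces c = 0.\<close>

lemma positive_op_Cauchy_Schwarz:
  assumes "positive_op S"
  shows "(S x \<bullet> y)\<^sup>2 \<le> (S x \<bullet> x) * (S y \<bullet> y)"
proof -
  define a b c where "a = S x \<bullet> x" and "b = S y \<bullet> y" and "c = S x \<bullet> y"
  have sym: "S y \<bullet> x = c"
    using assms by (simp add: c_def positive_op_def self_adjoint_def inner_commute)
  have q: "0 \<le> a + 2 * s * c + s\<^sup>2 * b" for s
  proof -
    have "0 \<le> S (x + s *\<^sub>R y) \<bullet> (x + s *\<^sub>R y)"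
      using assms by (simp add: positive_op_def)
    also have "\<dots> = a + 2 * s * c + s\<^sup>2 * b"
      by (simp add: blinfun.bilinear_simps inner_simps sym a_def b_def c_def[symmetric]
          power2_eq_square algebra_simps)
    finally show ?thesis .
  qed
  have "b \<ge> 0" using assms by (simp add: b_def positive_op_def)
  have "c\<^sup>2 \<le> a * b"
  proof (cases "b = 0")
    case True
    have "c = 0"
    proof (rule ccontr)
      assume "c \<noteq> 0"
      \<comment> \<open>This s makes the affine function a + 2 s c equal to -1.\<close>
      then have eq: "2 * (- (a + 1) / (2 * c)) * c = - (a + 1)" by simp
      have "0 \<le> a + 2 * (- (a + 1) / (2 * c)) * c"
        using q[of "- (a + 1) / (2 * c)"] unfolding True by (simp only: mult_zero_right add_0_right)
      then show False unfolding eq by simp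
    qed
    then show ?thesis using True by simp
  next
    case False
    then have "b > 0" using \<open>b \<ge> 0\<close> by simp
    then have "0 \<le> a - c\<^sup>2 / b"
      using q[of "- c / b"] by (simp add: power2_eq_square)
    then have "c\<^sup>2 / b \<le> a" by simp
    then show ?thesis using \<open>b > 0\<close> by (simp add: pos_divide_le_eq)
  qed
  then show ?thesis by (simp add: a_def b_def c_def)
qed

text \<open>This is S^2 \<le> \<open>norm S\<close> S in terms of forms. A square root of S is only
  available once the functional calculus is, so Cauchy-Schwarz for the form of S is applied to x and
  S x instead.\<close>

lemma norm_positive_op_apply:
  assumes "positive_op S"
  shows "(norm (S x))\<^sup>2 \<le> norm S * (S x \<bullet> x)"
proof (cases "S x = 0")
  case False
  have "((norm (S x))\<^sup>2)\<^sup>2 \<le> (S x \<bullet> x) * (S (S x) \<bullet> S x)"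
    using positive_op_Cauchy_Schwarz[OF assms, of x "S x"] by (simp add: dot_square_norm)
  also have "\<dots> \<le> (S x \<bullet> x) * (norm S * (norm (S x))\<^sup>2)"
  proof (rule mult_left_mono)
    have "S (S x) \<bullet> S x \<le> norm (S (S x)) * norm (S x)" by (rule norm_cauchy_schwarz)
    also have "\<dots> \<le> norm S * norm (S x) * norm (S x)"
      by (intro mult_right_mono norm_blinfun) simp
    finally show "S (S x) \<bullet> S x \<le> norm S * (norm (S x))\<^sup>2" by (simp add: power2_eq_square)
  qed (use assms in \<open>simp add: positive_op_def\<close>)
  finally have "(norm (S x))\<^sup>2 * (norm (S x))\<^sup>2 \<le> (norm S * (S x \<bullet> x)) * (norm (S x))\<^sup>2"
    by (simp add: power2_eq_square algebra_simps)
  moreover have "0 < (norm (S x))\<^sup>2" using False by simp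
  ultimately show ?thesis by (rule mult_right_le_imp_le)
qed (use assms in \<open>simp add: positive_op_def\<close>)

text \<open>Turns a lower bound on the norm of S x into a gap of the form above 0. It serves twice:
  such a norm bound comes from an inverse, and also from a polynomial without roots on the
  interval.\<close>

lemma positive_op_bounded_below:
  assumes "positive_op S" "0 < e" "\<And>x. e * norm x \<le> norm (S x)"
  shows "\<exists>\<delta>>0. loewner (\<delta> *\<^sub>R id_blinfun) S"
proof (intro exI conjI)
  \<comment> \<open>The summand 1 keeps the denominator positive when S = 0.\<close>
  let ?\<delta> = "e\<^sup>2 / (norm S + 1)"
  have p: "norm S + 1 > 0" by (simp add: add_nonneg_pos)
  show "?\<delta> > 0" using assms(2) p by simp
  show "loewner (?\<delta> *\<^sub>R id_blinfun) S"
  proof (rule loewnerI)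
    fix x
    have nn: "0 \<le> S x \<bullet> x" using assms(1) by (simp add: positive_op_def)
    have "e\<^sup>2 * (norm x)\<^sup>2 \<le> (norm (S x))\<^sup>2"
      using power_mono[OF assms(3)[of x], of 2] assms(2) by (simp add: power_mult_distrib)
    also have "\<dots> \<le> norm S * (S x \<bullet> x)" by (rule norm_positive_op_apply[OF assms(1)])
    also have "\<dots> \<le> (norm S + 1) * (S x \<bullet> x)" using nn by (simp add: algebra_simps)
    finally show "(?\<delta> *\<^sub>R id_blinfun) x \<bullet> x \<le> S x \<bullet> x"
      using p by (simp add: blinfun.bilinear_simps dot_square_norm field_simps)
  qed (use assms(1) in \<open>auto simp: positive_op_def\<close>)
qed

text \<open>Invertibility is read as norm x \<le> \<open>norm B\<close> norm (X x). The strict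
  positivity of a matters later: on [a,b] with a > 0 every real power is continuous, so the
  functional calculus applies to \<open>powr\<close>.\<close>

lemma posinv_bounds:
  assumes "posinv X"
  obtains a b where "0 < a" "loewner (a *\<^sub>R id_blinfun) X" "loewner X (b *\<^sub>R id_blinfun)"
proof -
  have P: "positive_op X" using assms by (simp add: posinv_def)
  obtain B where B: "B o\<^sub>L X = id_blinfun" using assms by (auto simp: posinv_def invertible_op_def)
  have n: "norm B + 1 > 0" by (simp add: add_nonneg_pos)
  have "1 / (norm B + 1) * norm x \<le> norm (X x)" for x
  proof -
    have "norm x = norm (B (X x))" using arg_cong[OF B, of "\<lambda>T. blinfun_apply T x"] by simp
    also have "\<dots> \<le> norm B * norm (X x)" by (rule norm_blinfun)
    also have "\<dots> \<le> (norm B + 1) * norm (X x)" by (simp add: algebra_simps)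
    finally show ?thesis using n by (simp add: field_simps)
  qed
  then obtain a where "0 < a" "loewner (a *\<^sub>R id_blinfun) X"
    using positive_op_bounded_below[OF P, of "1 / (norm B + 1)"] n by auto
  moreover have "loewner X (norm X *\<^sub>R id_blinfun)"
  proof (rule loewnerI)
    fix x
    have "X x \<bullet> x \<le> norm (X x) * norm x" by (rule norm_cauchy_schwarz)
    also have "\<dots> \<le> norm X * norm x * norm x" by (intro mult_right_mono norm_blinfun) simp
    finally show "X x \<bullet> x \<le> (norm X *\<^sub>R id_blinfun) x \<bullet> x"
      by (simp add: blinfun.bilinear_simps dot_square_norm power2_eq_square)
  qed (use P in \<open>auto simp: positive_op_def\<close>)
  ultimately show ?thesis using that by blast
qed

subsection \<open>Polynomials of a self-adjoint operator\<close>

lemma op_power_Suc: "op_power X (Suc k) = X o\<^sub>L op_power X k"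
  by (simp add: op_power_def)

lemma op_power_0: "op_power X 0 = id_blinfun"
  by (simp add: op_power_def)

lemma polyop_altdef:
  assumes "degree q \<le> N"
  shows "polyop q X = (\<Sum>i\<le>N. coeff q i *\<^sub>R op_power X i)"
  unfolding polyop_def
  by (rule sum.mono_neutral_left) (use assms in \<open>auto simp: coeff_eq_0\<close>)

lemma polyop_0 [simp]: "polyop 0 X = 0"
  by (simp add: polyop_def)

lemma polyop_add: "polyop (p + q) X = polyop p X + polyop q X"
proof -
  let ?N = "max (degree p) (degree q)"
  have "polyop (p + q) X = (\<Sum>i\<le>?N. coeff (p + q) i *\<^sub>R op_power X i)"
    by (rule polyop_altdef) (rule degree_add_le_max)
  also have "\<dots> = (\<Sum>i\<le>?N. coeff p i *\<^sub>R op_power X i) + (\<Sum>i\<le>?N. coeff q i *\<^sub>R op_power X i)"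
    by (simp add: scaleR_add_left sum.distrib)
  finally show ?thesis
    using polyop_altdef[of p ?N X] polyop_altdef[of q ?N X] by simp
qed

text \<open>Horner's rule; with it, facts about \<open>polyop\<close> follow by induction over
  \<open>pCons\<close> instead of by manipulating sums.\<close>

lemma polyop_pCons: "polyop (pCons a p) X = a *\<^sub>R id_blinfun + (X o\<^sub>L polyop p X)"
proof -
  have "polyop (pCons a p) X = (\<Sum>i\<le>Suc (degree p). coeff (pCons a p) i *\<^sub>R op_power X i)"
    by (rule polyop_altdef) (rule degree_pCons_le)
  also have "\<dots> = a *\<^sub>R id_blinfun + (\<Sum>i\<le>degree p. coeff p i *\<^sub>R (X o\<^sub>L op_power X i))"
    unfolding sum.atMost_Suc_shift by (simp add: op_power_0 op_power_Suc)
  also have "(\<Sum>i\<le>degree p. coeff p i *\<^sub>R (X o\<^sub>L op_power X i)) = X o\<^sub>L polyop p X"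
    unfolding polyop_def
      bounded_bilinear.sum_right[OF bounded_bilinear_blinfun_compose]
    by (simp add: compose_bilinear_simps)
  finally show ?thesis .
qed

lemma polyop_smult: "polyop (smult c q) X = c *\<^sub>R polyop q X"
  using polyop_altdef[OF degree_smult_le, of c q X] by (simp add: polyop_def scaleR_sum_right)

lemma polyop_diff: "polyop (p - q) X = polyop p X - polyop q X"
  using polyop_add[of "p" "smult (-1) q" X] polyop_smult[of "-1" q X] by simp

lemma polyop_mult: "polyop (p * q) X = polyop p X o\<^sub>L polyop q X"
  by (induction p) (simp_all add: polyop_add polyop_smult polyop_pCons compose_bilinear_simps
      blinfun_compose_assoc)

text \<open>Z is an arbitrary bounded operator. Z = Y = X gives commutation with X; the form with
  two operators is what later moves powers across the operator Z of \<open>sharp_flip\<close>, which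
  is not self-adjoint in general.\<close>

lemma polyop_intertwine:
  assumes "Z o\<^sub>L X = Y o\<^sub>L Z"
  shows "Z o\<^sub>L polyop q X = polyop q Y o\<^sub>L Z"
proof (induction q)
  case (pCons a q)
  have "Z o\<^sub>L (X o\<^sub>L polyop q X) = Y o\<^sub>L (Z o\<^sub>L polyop q X)"
    using assms by (metis blinfun_compose_assoc)
  then show ?case
    using pCons by (simp add: polyop_pCons compose_bilinear_simps blinfun_compose_assoc)
qed simp

lemma self_adjoint_polyop:
  assumes "self_adjoint X"
  shows "self_adjoint (polyop q X)"
proof (induction q)
  case (pCons a q)
  have "X o\<^sub>L polyop q X = polyop q X o\<^sub>L X" by (rule polyop_intertwine) simp
  then have "self_adjoint (X o\<^sub>L polyop q X)" using assms pCons by (intro self_adjoint_compose) auto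
  then show ?case by (simp add: polyop_pCons)
qed simp

lemma polyop_pcompose_scale: "polyop (pcompose q [:0, c:]) X = polyop q (c *\<^sub>R X)"
proof (induction q)
  case (pCons a q)
  have "polyop (pcompose (pCons a q) [:0, c:]) X
      = polyop [:a:] X + (polyop [:0, c:] X o\<^sub>L polyop (pcompose q [:0, c:]) X)"
    by (simp only: pcompose_pCons polyop_add polyop_mult)
  then show ?case using pCons by (simp add: polyop_pCons compose_bilinear_simps)
qed simp

text \<open>A root z of the complexified polynomial decides the case. A real z splits off a linear
  factor. Otherwise the real quadratic with roots z and its conjugate divides r: the remainder has
  degree at most 1 and real coefficients, and it can vanish at a nonreal point only if it is
  0.\<close>

lemma real_poly_factor:
  fixes r :: "real poly"
  assumes "degree r > 0"
  obtains (linear) c s where "r = [:-c, 1:] * s"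
  | (quadratic) u v s where "v \<noteq> 0" "r = [:u\<^sup>2 + v\<^sup>2, -2 * u, 1:] * s"
proof -
  define ev where "ev p z = poly (map_poly complex_of_real p) z" for p z
  have ev_pCons: "ev (pCons a p) z = of_real a + z * ev p z" for a p z
    by (simp add: ev_def map_poly_pCons)
  have ev_0: "ev 0 z = 0" for z by (simp add: ev_def)
  have ev_add: "ev (p + q) z = ev p z + ev q z" for p q z
  proof -
    have "map_poly complex_of_real (p + q) = map_poly of_real p + map_poly of_real q"
      by (rule poly_eqI) (simp add: coeff_map_poly)
    then show ?thesis by (simp add: ev_def)
  qed
  have ev_smult: "ev (smult a q) z = of_real a * ev q z" for a q z
    by (simp add: ev_def map_poly_smult)
  have ev_mult: "ev (p * q) z = ev p z * ev q z" for p q z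
    by (induction p) (simp_all add: ev_0 ev_add ev_smult ev_pCons algebra_simps)
  have "degree (map_poly complex_of_real r) = degree r" by (intro degree_map_poly) simp
  then obtain z where z: "ev r z = 0"
    using fundamental_theorem_of_algebra[of "map_poly complex_of_real r"] assms
    by (auto simp: ev_def constant_degree)
  show thesis
  proof (cases "Im z = 0")
    case True
    have "ev p (of_real x) = of_real (poly p x)" for p x
      by (induction p) (simp_all add: ev_0 ev_pCons)
    moreover have "z = of_real (Re z)" using True by (simp add: complex_eq_iff)
    ultimately have "poly r (Re z) = 0" using z by (metis of_real_eq_0_iff)
    then show thesis using linear by (auto simp: poly_eq_0_iff_dvd)
  next
    case False
    define u v g where "u = Re z" and "v = Im z" and "g = [:u\<^sup>2 + v\<^sup>2, -2 * u, 1:]"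
    have "ev g z = 0"
      by (simp add: g_def ev_pCons ev_0 complex_eq_iff u_def v_def power2_eq_square algebra_simps)
    moreover have "r = g * (r div g) + r mod g" by (simp add: mult.commute)
    ultimately have m: "ev (r mod g) z = 0"
      using z ev_add ev_mult by (metis add_0 mult_zero_left)
    have "degree (r mod g) < 2"
      using degree_mod_less'[of g r] by (fastforce simp: g_def)
    then obtain \<alpha> \<beta> where ab: "r mod g = [:\<alpha>, \<beta>:]"
      using degree1_coeffs[of "r mod g"]  degree_eq_zeroE[of "r mod g"]
      by (metis less_2_cases One_nat_def pCons_0_0)
    have "\<beta> * Im z = 0" "\<alpha> + \<beta> * Re z = 0"
      using m by (simp_all add: ab ev_pCons ev_0 complex_eq_iff mult.commute)
    then have "r mod g = 0" using False ab by simp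
    then show thesis
      using quadratic[of v u "r div g"] False \<open>r = g * (r div g) + r mod g\<close>
      by (simp add: g_def v_def)
  qed
qed

text \<open>Stands for the spectrum lying in [a,b]. No order between a and b is built in, so
  intersections of two enclosures can be formed freely; members with a > b exist only on the zero
  space.\<close>

definition op_interval :: "real \<Rightarrow> real \<Rightarrow> 'a::{real_inner,complete_space} op set" where
  "op_interval a b = {X. loewner (a *\<^sub>R id_blinfun) X \<and> loewner X (b *\<^sub>R id_blinfun)}"

lemma op_interval_self_adjoint: "X \<in> op_interval a b \<Longrightarrow> self_adjoint X"
  by (auto simp: op_interval_def intro: self_adjoint_of_loewner_left)

lemma op_interval_iff:
  "X \<in> op_interval a b \<longleftrightarrow>
    self_adjoint X \<and> (\<forall>x. a * (norm x)\<^sup>2 \<le> X x \<bullet> x \<and> X x \<bullet> x \<le> b * (norm x)\<^sup>2)"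
proof -
  have *: "(c *\<^sub>R id_blinfun) x \<bullet> x = c * (norm x)\<^sup>2" for c and x :: 'a
    by (simp add: blinfun.bilinear_simps dot_square_norm)
  show ?thesis (is "_ \<longleftrightarrow> ?R")
  proof
    assume X: "X \<in> op_interval a b"
    then have "loewner (a *\<^sub>R id_blinfun) X" "loewner X (b *\<^sub>R id_blinfun)"
      by (simp_all add: op_interval_def)
    from this[THEN loewnerD, unfolded *] op_interval_self_adjoint[OF X] show ?R by blast
  next
    assume ?R
    then have "loewner (a *\<^sub>R id_blinfun) X" "loewner X (b *\<^sub>R id_blinfun)"
      by (intro loewnerI; simp add: *)+
    then show "X \<in> op_interval a b" by (simp add: op_interval_def)
  qed
qed

lemma bounded_below_of_form:
  assumes "e > 0" "\<And>x. e * (norm x)\<^sup>2 \<le> \<bar>T x \<bullet> x\<bar>"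
  shows "e * norm x \<le> norm (T x)"
proof (cases "x = 0")
  case False
  have "e * (norm x)\<^sup>2 \<le> norm (T x) * norm x"
    using assms(2)[of x] Cauchy_Schwarz_ineq2[of "T x" x] by linarith
  then show ?thesis using False by (simp add: power2_eq_square)
qed simp

text \<open>A fragment of the spectral mapping theorem, by induction on the degree. A root c outside
  [a,b] gives a factor whose form stays away from 0 by a - c or c - b, a quadratic factor without
  real roots has form at least v^2, and lower bounds multiply along a composition.\<close>

lemma polyop_bounded_below:
  assumes X: "X \<in> op_interval a b" and "r \<noteq> 0" and "\<And>x. x \<in> {a..b} \<Longrightarrow> poly r x \<noteq> 0"
  shows "\<exists>e>0. \<forall>x. e * norm x \<le> norm (polyop r X x)"
  using assms(2,3)
proof (induction "degree r" arbitrary: r rule: less_induct)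
  case less
  have sa: "self_adjoint X" using X by (rule op_interval_self_adjoint)
  show ?case
  proof (cases "degree r = 0")
    case True
    then obtain c where c: "r = [:c:]" by (auto elim: degree_eq_zeroE)
    then have "c \<noteq> 0" using less.prems(1) by simp
    then show ?thesis
      by (intro exI[of _ "\<bar>c\<bar>"]) (simp add: c polyop_pCons blinfun.bilinear_simps)
  next
    case False
    have step: ?thesis
      if r: "r = g * s" and g: "degree g > 0" and e: "e > 0"
        and ge: "\<And>x. e * (norm x)\<^sup>2 \<le> \<bar>polyop g X x \<bullet> x\<bar>" for g s e
    proof -
      have "g \<noteq> 0" "s \<noteq> 0" using r less.prems(1) by auto
      then have "degree s < degree r" using r g by (simp add: degree_mult_eq)
      moreover have "poly s x \<noteq> 0" if "x \<in> {a..b}" for x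
        using less.prems(2)[OF that] r by auto
      ultimately obtain e' where e': "e' > 0" "\<And>x. e' * norm x \<le> norm (polyop s X x)"
        using less.hyps[of s] \<open>s \<noteq> 0\<close> by auto
      have "e * e' * norm x \<le> norm (polyop r X x)" for x
      proof -
        have "e * (e' * norm x) \<le> e * norm (polyop s X x)" using e e' by simp
        also have "\<dots> \<le> norm (polyop g X (polyop s X x))"
          by (rule bounded_below_of_form[OF e ge])
        finally show ?thesis by (simp add: r polyop_mult mult.assoc)
      qed
      then show ?thesis using e e' by (intro exI[of _ "e * e'"]) simp
    qed
    have "degree r > 0" using False by simp
    then show ?thesis
    proof (cases r rule: real_poly_factor)
      case (linear c s)
      have "poly r c = 0" using linear by simp
      then have c: "c \<notin> {a..b}" using less.prems(2) by blast
      have p: "polyop [:-c, 1:] X x \<bullet> x = X x \<bullet> x - c * (norm x)\<^sup>2" for x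
        by (simp add: polyop_pCons blinfun.bilinear_simps inner_simps dot_square_norm)
      have bd: "a * (norm x)\<^sup>2 \<le> X x \<bullet> x" "X x \<bullet> x \<le> b * (norm x)\<^sup>2" for x
        using X by (auto simp: op_interval_iff)
      show ?thesis
      proof (cases "c < a")
        case True
        show ?thesis
        proof (rule step[OF linear, of "a - c"])
          fix x show "(a - c) * (norm x)\<^sup>2 \<le> \<bar>polyop [:-c, 1:] X x \<bullet> x\<bar>"
            using bd(1)[of x] unfolding p by (simp add: left_diff_distrib)
        qed (use True in auto)
      next
        case False
        then have "b < c" using c by auto
        show ?thesis
        proof (rule step[OF linear, of "c - b"])
          fix x show "(c - b) * (norm x)\<^sup>2 \<le> \<bar>polyop [:-c, 1:] X x \<bullet> x\<bar>"
            using bd(2)[of x] unfolding p by (simp add: left_diff_distrib)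
        qed (use \<open>b < c\<close> in auto)
      qed
    next
      case (quadratic u v s)
      have "v\<^sup>2 * (norm x)\<^sup>2 \<le> \<bar>polyop [:u\<^sup>2 + v\<^sup>2, -2 * u, 1:] X x \<bullet> x\<bar>" for x
      proof -
        have "polyop [:u\<^sup>2 + v\<^sup>2, -2 * u, 1:] X x \<bullet> x = (norm (X x - u *\<^sub>R x))\<^sup>2 + v\<^sup>2 * (norm x)\<^sup>2"
          using self_adjointD[OF sa, of "X x" x] unfolding power2_norm_eq_inner
          by (simp add: polyop_pCons blinfun.bilinear_simps inner_simps
              inner_commute power2_eq_square algebra_simps)
        moreover have "0 \<le> (norm (X x - u *\<^sub>R x))\<^sup>2" by simp
        ultimately show ?thesis by linarith
      qed
      then show ?thesis using step[OF quadratic(2), of "v\<^sup>2"] quadratic(1) by simp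
    qed
  qed
qed

text \<open>Positivity: at the bottom \<open>\<alpha>\<close> of the numerical range of \<open>q(X)\<close> the operator
  \<open>q(X) - \<alpha>\<close> is not bounded below, so \<open>q - \<alpha>\<close> has a root in \<open>[a,b]\<close>.\<close>

lemma polyop_nonneg:
  assumes X: "X \<in> op_interval a b" and ab: "a \<le> b" and q: "\<And>x. x \<in> {a..b} \<Longrightarrow> 0 \<le> poly q x"
  shows "loewner 0 (polyop q X)"
proof (rule ccontr)
  assume neg: "\<not> loewner 0 (polyop q X)"
  define T where "T = polyop q X"
  have sT: "self_adjoint T"
    unfolding T_def by (intro self_adjoint_polyop op_interval_self_adjoint[OF X])
  define R where "R = {T x \<bullet> x | x. norm x = 1}"
  have bdd: "bdd_below R"
  proof (rule bdd_belowI[of _ "- norm T"])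
    fix y assume "y \<in> R"
    then obtain x where x: "y = T x \<bullet> x" "norm x = 1" by (auto simp: R_def)
    have "\<bar>T x \<bullet> x\<bar> \<le> norm (T x) * norm x" by (rule Cauchy_Schwarz_ineq2)
    also have "\<dots> \<le> norm T" using norm_blinfun[of T x] x by simp
    finally show "- norm T \<le> y" using x by simp
  qed
  have scale: "T x \<bullet> x = (norm x)\<^sup>2 * (T (x /\<^sub>R norm x) \<bullet> (x /\<^sub>R norm x))" if "x \<noteq> 0" for x
    using that by (simp add: blinfun.bilinear_simps power2_eq_square field_simps)
  have unit: "T (x /\<^sub>R norm x) \<bullet> (x /\<^sub>R norm x) \<in> R" if "x \<noteq> 0" for x
    unfolding R_def using that by (intro CollectI exI[of _ "x /\<^sub>R norm x"]) simp
  obtain x0 where x0: "T x0 \<bullet> x0 < 0"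
    using neg sT by (auto simp: T_def loewner_iff not_le)
  then have "x0 \<noteq> 0" by auto
  note x0R = unit[OF \<open>x0 \<noteq> 0\<close>]
  have n0: "T (x0 /\<^sub>R norm x0) \<bullet> (x0 /\<^sub>R norm x0) < 0"
    using scale[OF \<open>x0 \<noteq> 0\<close>] x0 \<open>x0 \<noteq> 0\<close> by (simp add: mult_less_0_iff)
  define \<alpha> where "\<alpha> = Inf R"
  have "\<alpha> < 0" using cInf_lower[OF x0R bdd] n0 by (simp add: \<alpha>_def)
  have form: "(T - \<alpha> *\<^sub>R id_blinfun) x \<bullet> x = T x \<bullet> x - \<alpha> * (norm x)\<^sup>2" for x
    by (simp add: blinfun.bilinear_simps inner_simps dot_square_norm)
  have pos: "positive_op (T - \<alpha> *\<^sub>R id_blinfun)"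
    unfolding positive_op_def
  proof (intro conjI allI)
    fix x
    show "0 \<le> (T - \<alpha> *\<^sub>R id_blinfun) x \<bullet> x"
    proof (cases "x = 0")
      case False
      have "\<alpha> \<le> T (x /\<^sub>R norm x) \<bullet> (x /\<^sub>R norm x)"
        unfolding \<alpha>_def by (rule cInf_lower[OF unit[OF False] bdd])
      then have "(norm x)\<^sup>2 * \<alpha> \<le> T x \<bullet> x"
        unfolding scale[OF False] by (rule mult_left_mono) simp
      then show ?thesis unfolding form by (simp add: mult.commute)
    qed simp
  qed (use sT in simp)
  define r where "r = q - [:\<alpha>:]"
  have r: "polyop r X = T - \<alpha> *\<^sub>R id_blinfun"
    by (simp add: r_def polyop_diff polyop_pCons T_def)
  have rpos: "poly r x \<noteq> 0" if "x \<in> {a..b}" for x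
    using q[OF that] \<open>\<alpha> < 0\<close> by (simp add: r_def)
  \<comment> \<open>The interval is nonempty, and r does not vanish at its points.\<close>
  then have "r \<noteq> 0" using ab by force
  then obtain e where "e > 0" "\<And>x. e * norm x \<le> norm (polyop r X x)"
    using polyop_bounded_below[OF X] rpos by blast
  then obtain \<delta> where \<delta>: "\<delta> > 0" "loewner (\<delta> *\<^sub>R id_blinfun) (T - \<alpha> *\<^sub>R id_blinfun)"
    using positive_op_bounded_below[OF pos, of e] r by auto
  have "\<alpha> + \<delta> \<le> y" if "y \<in> R" for y
  proof -
    obtain x where x: "y = T x \<bullet> x" "norm x = 1" using \<open>y \<in> R\<close> by (auto simp: R_def)
    show ?thesis
      using loewnerD[OF \<delta>(2), of x] x
      by (simp add: form) (simp add: blinfun.bilinear_simps dot_square_norm)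
  qed
  then have "\<alpha> + \<delta> \<le> Inf R" using x0R by (intro cInf_greatest) auto
  then show False using \<delta>(1) by (simp add: \<alpha>_def)
qed

text \<open>Positivity of c - q and c + q bounds the form, and the form bounds the norm. The map
  from q to q(X) is therefore contractive for the supremum norm on [a,b], on which all limits of the
  functional calculus rest. With a > b only x = 0 remains.\<close>

lemma norm_polyop_le:
  assumes X: "X \<in> op_interval a b" and c: "0 \<le> c" and q: "\<And>x. x \<in> {a..b} \<Longrightarrow> \<bar>poly q x\<bar> \<le> c"
  shows "norm (polyop q X) \<le> c"
proof (rule norm_self_adjoint_le[OF _ c])
  show "self_adjoint (polyop q X)"
    by (intro self_adjoint_polyop op_interval_self_adjoint[OF X])
  fix x
  show "\<bar>polyop q X x \<bullet> x\<bar> \<le> c * (norm x)\<^sup>2"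
  proof (cases "a \<le> b")
    case True
    have "loewner 0 (polyop ([:c:] - q) X)" "loewner 0 (polyop ([:c:] + q) X)"
      using q by (intro polyop_nonneg[OF X True]; force simp: abs_le_iff)+
    from this[THEN loewnerD, of x] show ?thesis
      by (simp add: polyop_diff polyop_add polyop_pCons blinfun.bilinear_simps inner_simps dot_square_norm)
  next
    case False
    have "a * (norm x)\<^sup>2 \<le> b * (norm x)\<^sup>2" using X by (force simp: op_interval_iff intro: order_trans)
    then have "x = 0" using False by (auto simp: mult_le_cancel_right)
    then show ?thesis by (simp add: blinfun.zero_right)
  qed
qed

subsection \<open>The continuous functional calculus\<close>

lemma op_interval_Int:
  assumes "X \<in> op_interval a b" "X \<in> op_interval a' b'"
  shows "X \<in> op_interval (max a a') (min b b')"
  using assms by (auto simp: op_interval_iff max_def min_def)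

text \<open>Shows that the description in \<open>cfun\<close> denotes. Approximating polynomials
  give a Cauchy sequence of operators, and approximations on two different enclosing intervals are
  compared on the intersection, which still encloses X, so the limit does not depend on the
  choice.\<close>

lemma tendsto_cfun:
  assumes X: "X \<in> op_interval a b"
    and q: "uniform_limit {a..b} (\<lambda>k x. poly (q k) x) f sequentially"
  shows "(\<lambda>k. polyop (q k) X) \<longlonglongrightarrow> cfun f X"
proof -
  have "Cauchy (\<lambda>k. polyop (q k) X)"
  proof (rule CauchyI)
    fix e :: real assume "e > 0"
    then have "e / 4 > 0" by simp
    then obtain N where N: "\<And>k x. k \<ge> N \<Longrightarrow> x \<in> {a..b} \<Longrightarrow> \<bar>poly (q k) x - f x\<bar> < e / 4"
      using q unfolding uniform_limit_sequentially_iff dist_real_def by blast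
    have "norm (polyop (q j) X - polyop (q k) X) < e" if "j \<ge> N" "k \<ge> N" for j k
    proof -
      have "norm (polyop (q j - q k) X) \<le> e / 2"
      proof (rule norm_polyop_le[OF X])
        fix x assume "x \<in> {a..b}"
        then show "\<bar>poly (q j - q k) x\<bar> \<le> e / 2"
          using N[OF that(1), of x] N[OF that(2), of x] by (simp add: abs_if split: if_splits)
      qed (use \<open>e > 0\<close> in simp)
      then show ?thesis using \<open>e > 0\<close> by (simp add: polyop_diff)
    qed
    then show "\<exists>M. \<forall>m\<ge>M. \<forall>n\<ge>M. norm (polyop (q m) X - polyop (q n) X) < e"
      by blast
  qed
  then obtain Y where Y: "(\<lambda>k. polyop (q k) X) \<longlonglongrightarrow> Y"
    using blinfun_Cauchy_convergent by (auto simp: convergent_def)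
  have Y': "(\<lambda>k. polyop (q' k) X) \<longlonglongrightarrow> Y"
    if X': "X \<in> op_interval a' b'"
      and q': "uniform_limit {a'..b'} (\<lambda>k x. poly (q' k) x) f sequentially" for a' b' q'
  proof -
    have "(\<lambda>k. polyop (q k) X - polyop (q' k) X) \<longlonglongrightarrow> 0"
    proof (rule LIMSEQ_I)
      fix e :: real assume "e > 0"
      then have "e / 4 > 0" by simp
      then obtain N where
        N: "\<And>k x. k \<ge> N \<Longrightarrow> x \<in> {a..b} \<Longrightarrow> \<bar>poly (q k) x - f x\<bar> < e / 4"
        using q unfolding uniform_limit_sequentially_iff dist_real_def by blast
      obtain N' where
        N': "\<And>k x. k \<ge> N' \<Longrightarrow> x \<in> {a'..b'} \<Longrightarrow> \<bar>poly (q' k) x - f x\<bar> < e / 4"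
        using q' \<open>e / 4 > 0\<close> unfolding uniform_limit_sequentially_iff dist_real_def by blast
      have "norm (polyop (q k) X - polyop (q' k) X - 0) < e" if "k \<ge> max N N'" for k
      proof -
        have "norm (polyop (q k - q' k) X) \<le> e / 2"
        proof (rule norm_polyop_le[OF op_interval_Int[OF X X']])
          fix x assume "x \<in> {max a a'..min b b'}"
          then show "\<bar>poly (q k - q' k) x\<bar> \<le> e / 2"
            using N[of k x] N'[of k x] that by (simp add: abs_if split: if_splits)
        qed (use \<open>e > 0\<close> in simp)
        then show ?thesis using \<open>e > 0\<close> by (simp add: polyop_diff)
      qed
      then show "\<exists>no. \<forall>n\<ge>no. norm (polyop (q n) X - polyop (q' n) X - 0) < e"
        by blast
    qed
    from tendsto_diff[OF Y this] show ?thesis by simp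
  qed
  have "cfun f X = Y"
    unfolding cfun_def
  proof (rule the_equality)
    show "\<forall>a b q. loewner (a *\<^sub>R id_blinfun) X \<and> loewner X (b *\<^sub>R id_blinfun) \<and>
        uniform_limit {a..b} (\<lambda>k x. poly (q k) x) f sequentially
        \<longrightarrow> (\<lambda>k. polyop (q k) X) \<longlonglongrightarrow> Y"
      using Y' unfolding op_interval_def by blast
    fix Z
    assume "\<forall>a b q. loewner (a *\<^sub>R id_blinfun) X \<and> loewner X (b *\<^sub>R id_blinfun) \<and>
        uniform_limit {a..b} (\<lambda>k x. poly (q k) x) f sequentially
        \<longrightarrow> (\<lambda>k. polyop (q k) X) \<longlonglongrightarrow> Z"
    then have "(\<lambda>k. polyop (q k) X) \<longlonglongrightarrow> Z"
      using X q unfolding op_interval_def by blast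
    then show "Z = Y" using Y LIMSEQ_unique by blast
  qed
  then show ?thesis using Y by simp
qed

text \<open>The Weierstrass polynomial is raised by its own tolerance and so approximates from
  above. A nonnegative f then has nonnegative approximants, to which \<open>polyop_nonneg\<close>
  applies in \<open>cfun_mono\<close>.\<close>

lemma polynomial_upper_approximation:
  fixes f :: "real \<Rightarrow> real"
  assumes "continuous_on {a..b} f"
  obtains q where "uniform_limit {a..b} (\<lambda>k x. poly (q k) x) f sequentially"
    and "\<And>k x. x \<in> {a..b} \<Longrightarrow> f x \<le> poly (q k) x"
proof -
  have "\<exists>q. \<forall>x\<in>{a..b}. f x \<le> poly q x \<and> \<bar>poly q x - f x\<bar> \<le> 2 / real (Suc k)" for k
  proof -
    let ?e = "1 / real (Suc k)"
    obtain g where "real_polynomial_function g" and g: "\<And>x. x \<in> {a..b} \<Longrightarrow> \<bar>f x - g x\<bar> < ?e"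
      using Stone_Weierstrass_real_polynomial_function[of "{a..b}" f ?e] assms by auto
    then obtain c n where cn: "g = (\<lambda>x. \<Sum>i\<le>n. c i * x ^ i)"
      by (auto simp: real_polynomial_function_iff_sum)
    define q where "q = (\<Sum>i\<le>n. monom (c i) i) + [:?e:]"
    have "poly q x = g x + ?e" for x
      by (simp add: q_def cn poly_sum poly_monom)
    moreover have "2 / real (Suc k) = 2 * ?e" by simp
    ultimately show ?thesis
      using g by (intro exI[of _ q]) (force simp: abs_if split: if_splits)
  qed
  then obtain q where q: "\<And>k x. x \<in> {a..b} \<Longrightarrow> f x \<le> poly (q k) x"
      "\<And>k x. x \<in> {a..b} \<Longrightarrow> \<bar>poly (q k) x - f x\<bar> \<le> 2 / real (Suc k)"
    by metis
  have "uniform_limit {a..b} (\<lambda>k x. poly (q k) x) f sequentially"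
    unfolding uniform_limit_sequentially_iff
  proof (intro allI impI)
    fix e :: real assume "e > 0"
    then obtain N where N: "2 / e < real N" using reals_Archimedean2 by blast
    have "2 / real (Suc n) < e" if "n \<ge> N" for n
    proof -
      have "2 / e < real (Suc n)" using N that by linarith
      then show ?thesis using \<open>e > 0\<close> by (simp add: field_simps)
    qed
    then show "\<exists>N. \<forall>n\<ge>N. \<forall>x\<in>{a..b}. dist (poly (q n) x) (f x) < e"
      unfolding dist_real_def using le_less_trans[OF q(2)] by blast
  qed
  then show thesis using that q(1) by blast
qed

lemma polynomial_approximation:
  fixes f :: "real \<Rightarrow> real"
  assumes "continuous_on {a..b} f"
  obtains q where "uniform_limit {a..b} (\<lambda>k x. poly (q k) x) f sequentially"
  by (rule polynomial_upper_approximation[OF assms])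

lemma self_adjoint_cfun:
  assumes "X \<in> op_interval a b" "continuous_on {a..b} f"
  shows "self_adjoint (cfun f X)"
proof -
  obtain q where "uniform_limit {a..b} (\<lambda>k x. poly (q k) x) f sequentially"
    using polynomial_approximation[OF assms(2)] .
  from self_adjoint_limit[OF _ tendsto_cfun[OF assms(1) this]] show ?thesis
    using self_adjoint_polyop[OF op_interval_self_adjoint[OF assms(1)]] .
qed

lemma cfun_diff:
  assumes X: "X \<in> op_interval a b" and "continuous_on {a..b} f" "continuous_on {a..b} g"
  shows "cfun (\<lambda>x. f x - g x) X = cfun f X - cfun g X"
proof -
  obtain p where p: "uniform_limit {a..b} (\<lambda>k x. poly (p k) x) f sequentially"
    using polynomial_approximation[OF assms(2)] .
  obtain q where q: "uniform_limit {a..b} (\<lambda>k x. poly (q k) x) g sequentially"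
    using polynomial_approximation[OF assms(3)] .
  have "uniform_limit {a..b} (\<lambda>k x. poly (p k - q k) x) (\<lambda>x. f x - g x) sequentially"
    using uniform_limit_minus[OF p q] by simp
  from tendsto_cfun[OF X this] tendsto_diff[OF tendsto_cfun[OF X p] tendsto_cfun[OF X q]]
  show ?thesis by (simp add: polyop_diff LIMSEQ_unique)
qed

lemma cfun_mult:
  assumes X: "X \<in> op_interval a b" and f: "continuous_on {a..b} f" and g: "continuous_on {a..b} g"
  shows "cfun (\<lambda>x. f x * g x) X = cfun f X o\<^sub>L cfun g X"
proof -
  obtain p where p: "uniform_limit {a..b} (\<lambda>k x. poly (p k) x) f sequentially"
    using polynomial_approximation[OF assms(2)] .
  obtain q where q: "uniform_limit {a..b} (\<lambda>k x. poly (q k) x) g sequentially"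
    using polynomial_approximation[OF assms(3)] .
  have "bounded (f ` {a..b})" "bounded (g ` {a..b})"
    by (intro compact_imp_bounded compact_continuous_image f g compact_Icc)+
  then have "uniform_limit {a..b} (\<lambda>k x. poly (p k * q k) x) (\<lambda>x. f x * g x) sequentially"
    using uniform_lim_mult[OF p q] by simp
  from tendsto_cfun[OF X this] tendsto_blinfun_compose[OF tendsto_cfun[OF X p] tendsto_cfun[OF X q]]
  show ?thesis by (simp add: polyop_mult LIMSEQ_unique)
qed

text \<open>Only values on the enclosing interval count. This discards what \<open>powr\<close> does
  at 0 and below, for instance when \<open>x powr 0\<close> is identified with 1.\<close>

lemma cfun_cong:
  assumes X: "X \<in> op_interval a b" and f: "continuous_on {a..b} f"
    and fg: "\<And>x. x \<in> {a..b} \<Longrightarrow> f x = g x"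
  shows "cfun f X = cfun g X"
proof -
  obtain q where q: "uniform_limit {a..b} (\<lambda>k x. poly (q k) x) f sequentially"
    using polynomial_approximation[OF f] .
  then have "uniform_limit {a..b} (\<lambda>k x. poly (q k) x) g sequentially"
    using fg by (simp add: uniform_limit_sequentially_iff)
  then show ?thesis using tendsto_cfun[OF X] q LIMSEQ_unique by blast
qed

lemma cfun_poly:
  assumes "X \<in> op_interval a b" and "\<And>x. f x = poly q x"
  shows "cfun f X = polyop q X"
proof -
  have "uniform_limit {a..b} (\<lambda>k x. poly q x) f (sequentially :: nat filter)"
    by (simp add: uniform_limit_sequentially_iff assms(2))
  from tendsto_cfun[OF assms(1) this] show ?thesis by (simp add: LIMSEQ_const_iff)
qed

lemma cfun_const: "X \<in> op_interval a b \<Longrightarrow> cfun (\<lambda>x. c) X = c *\<^sub>R id_blinfun"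
  using cfun_poly[of X a b "\<lambda>x. c" "[:c:]"] by (simp add: polyop_pCons)

lemma cfun_ident: "X \<in> op_interval a b \<Longrightarrow> cfun (\<lambda>x. x) X = X"
  using cfun_poly[of X a b "\<lambda>x. x" "[:0, 1:]"] by (simp add: polyop_pCons)

lemma cfun_mult_left:
  "X \<in> op_interval a b \<Longrightarrow> continuous_on {a..b} f \<Longrightarrow> cfun (\<lambda>x. c * f x) X = c *\<^sub>R cfun f X"
  by (simp add: cfun_mult[of X a b] cfun_const[of X a b] compose_bilinear_simps)

lemma cfun_mono:
  assumes X: "X \<in> op_interval a b" and "a \<le> b"
    and f: "continuous_on {a..b} f" and g: "continuous_on {a..b} g"
    and fg: "\<And>x. x \<in> {a..b} \<Longrightarrow> f x \<le> g x"
  shows "loewner (cfun f X) (cfun g X)"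
proof -
  have "continuous_on {a..b} (\<lambda>x. g x - f x)" using f g by (intro continuous_intros)
  then obtain q where q: "uniform_limit {a..b} (\<lambda>k x. poly (q k) x) (\<lambda>x. g x - f x) sequentially"
    and le: "\<And>k x. x \<in> {a..b} \<Longrightarrow> g x - f x \<le> poly (q k) x"
    using polynomial_upper_approximation by blast
  have "loewner 0 (polyop (q k) X)" for k
  proof (rule polyop_nonneg[OF X \<open>a \<le> b\<close>])
    show "0 \<le> poly (q k) x" if "x \<in> {a..b}" for x using le[OF that, of k] fg[OF that] by linarith
  qed
  then have "loewner 0 (cfun (\<lambda>x. g x - f x) X)"
    using loewner_limit[OF _ tendsto_const tendsto_cfun[OF X q]] by blast
  then show ?thesis
    by (simp add: cfun_diff[OF X g f] loewner_def)
qed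

lemma norm_cfun_le:
  assumes X: "X \<in> op_interval a b" and ab: "a \<le> b" and f: "continuous_on {a..b} f" and c: "0 \<le> c"
    and fc: "\<And>x. x \<in> {a..b} \<Longrightarrow> \<bar>f x\<bar> \<le> c"
  shows "norm (cfun f X) \<le> c"
proof (rule norm_self_adjoint_le[OF self_adjoint_cfun[OF X f] c])
  fix x
  have "loewner (cfun (\<lambda>x. - c) X) (cfun f X)" "loewner (cfun f X) (cfun (\<lambda>x. c) X)"
    using fc by (auto intro!: cfun_mono[OF X ab] f simp: abs_le_iff minus_le_iff)
  from this[THEN loewnerD, of x] show "\<bar>cfun f X x \<bullet> x\<bar> \<le> c * (norm x)\<^sup>2"
    by (simp add: cfun_const[OF X] blinfun.bilinear_simps dot_square_norm)
qed

lemma cfun_intertwine: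
  assumes X: "X \<in> op_interval a b" and Y: "Y \<in> op_interval a b" and f: "continuous_on {a..b} f"
    and Z: "Z o\<^sub>L X = Y o\<^sub>L Z"
  shows "Z o\<^sub>L cfun f X = cfun f Y o\<^sub>L Z"
proof -
  obtain q where q: "uniform_limit {a..b} (\<lambda>k x. poly (q k) x) f sequentially"
    using polynomial_approximation[OF f] .
  have "(\<lambda>k. Z o\<^sub>L polyop (q k) X) \<longlonglongrightarrow> (Z o\<^sub>L cfun f X)"
    "(\<lambda>k. polyop (q k) Y o\<^sub>L Z) \<longlonglongrightarrow> (cfun f Y o\<^sub>L Z)"
    by (intro tendsto_blinfun_compose tendsto_const tendsto_cfun[OF X q] tendsto_cfun[OF Y q])+
  then show ?thesis using polyop_intertwine[OF Z] LIMSEQ_unique by simp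
qed

lemma op_interval_scaleR:
  "X \<in> op_interval a b \<Longrightarrow> 0 \<le> c \<Longrightarrow> c *\<^sub>R X \<in> op_interval (c * a) (c * b)"
  by (auto simp: op_interval_iff blinfun.bilinear_simps mult_left_mono mult.assoc)

lemma cfun_scaleR:
  assumes X: "X \<in> op_interval a b" and c: "0 < c" and f: "continuous_on {c * a..c * b} f"
  shows "cfun f (c *\<^sub>R X) = cfun (\<lambda>x. f (c * x)) X"
proof -
  obtain q where q: "uniform_limit {c * a..c * b} (\<lambda>k x. poly (q k) x) f sequentially"
    using polynomial_approximation[OF f] .
  have "uniform_limit {a..b} (\<lambda>k x. poly (q k) (c * x)) (\<lambda>x. f (c * x)) sequentially"
    by (rule uniform_limit_compose'[OF q]) (use c in auto)
  then have "uniform_limit {a..b} (\<lambda>k x. poly (pcompose (q k) [:0, c:]) x) (\<lambda>x. f (c * x)) sequentially"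
    by (simp add: poly_pcompose mult.commute)
  from tendsto_cfun[OF X this] tendsto_cfun[OF op_interval_scaleR[OF X] q] c
  show ?thesis by (simp add: polyop_pcompose_scale LIMSEQ_unique)
qed

subsection \<open>Powers of positive invertible operators\<close>

lemma op_interval_mono:
  assumes "X \<in> op_interval a b" "a' \<le> a" "b \<le> b'"
  shows "X \<in> op_interval a' b'"
proof -
  have X: "loewner (a *\<^sub>R id_blinfun) X" "loewner X (b *\<^sub>R id_blinfun)"
    using assms(1) by (simp_all add: op_interval_def)
  show ?thesis
    unfolding op_interval_def
    using loewner_trans[OF loewner_scaleR_id_mono[OF assms(2)] X(1)]
      loewner_trans[OF X(2) loewner_scaleR_id_mono[OF assms(3)]] by simp
qed

lemma posinv_op_interval:
  assumes "posinv X"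
  obtains a b where "0 < a" "a \<le> b" "X \<in> op_interval a b"
proof -
  obtain a b where a: "0 < a" and "loewner (a *\<^sub>R id_blinfun) X" "loewner X (b *\<^sub>R id_blinfun)"
    using posinv_bounds[OF assms] .
  then have ab: "0 < a" "X \<in> op_interval a b" by (simp_all add: op_interval_def)
  have "X \<in> op_interval a (max a b)" by (rule op_interval_mono[OF ab(2)]) auto
  then show thesis using that[of a "max a b"] ab(1) by simp
qed

lemma continuous_on_powr_Icc: "0 < (a::real) \<Longrightarrow> continuous_on {a..b} (\<lambda>x. x powr r)"
  by (intro continuous_intros) auto

lemma opow_add:
  assumes "posinv X"
  shows "opow X (r + s) = opow X r o\<^sub>L opow X s"
proof -
  obtain a b where "0 < a" "X \<in> op_interval a b" using posinv_op_interval[OF assms] .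
  then show ?thesis
    using cfun_mult[of X a b "\<lambda>x. x powr r" "\<lambda>x. x powr s"]
    by (simp add: opow_def powr_add continuous_on_powr_Icc)
qed

lemma opow_0_interval:
  assumes "X \<in> op_interval a b" "0 < a"
  shows "opow X 0 = id_blinfun"
  unfolding opow_def
  using cfun_cong[OF assms(1) continuous_on_powr_Icc[OF assms(2)], of 0 "\<lambda>x. 1"] assms
  by (simp add: cfun_const[OF assms(1)])

lemma opow_0: "posinv X \<Longrightarrow> opow X 0 = id_blinfun"
  by (erule posinv_op_interval) (rule opow_0_interval)

lemma opow_1:
  assumes "posinv X"
  shows "opow X 1 = X"
proof -
  obtain a b where ab: "0 < a" "X \<in> op_interval a b" using posinv_op_interval[OF assms] .
  then show ?thesis
    unfolding opow_def
    using cfun_cong[OF ab(2) continuous_on_powr_Icc[OF ab(1)], of 1 "\<lambda>x. x"]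
    by (simp add: cfun_ident[OF ab(2)])
qed

lemma self_adjoint_opow: "posinv X \<Longrightarrow> self_adjoint (opow X r)"
  unfolding opow_def
  by (erule posinv_op_interval) (erule self_adjoint_cfun, rule continuous_on_powr_Icc)

lemma posinv_self_adjoint: "posinv X \<Longrightarrow> self_adjoint X"
  by (simp add: posinv_def positive_op_def)

text \<open>The calculus itself supplies the inverse as \<open>opow X (-1)\<close>. Addition of
  exponents is derived here directly on the interval, since \<open>opow_add\<close> presupposes
  \<open>posinv X\<close>.\<close>

lemma op_interval_posinv:
  fixes X :: "'a::{real_inner,complete_space} op"
  assumes X: "X \<in> op_interval a b" and a: "0 < a"
  shows "posinv X"
proof -
  have c: "continuous_on {a..b} (\<lambda>x. x powr r)" for r :: real
    using continuous_on_powr_Icc[OF a] .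
  have "cfun (\<lambda>x. x powr 1) X = X"
    using cfun_cong[OF X c, of 1 "\<lambda>x. x"] a by (simp add: cfun_ident[OF X])
  then have 1: "opow X 1 = X" by (simp add: opow_def)
  have add: "opow X (r + s) = opow X r o\<^sub>L opow X s" for r s
    unfolding opow_def powr_add by (rule cfun_mult[OF X c c])
  have "X o\<^sub>L opow X (-1) = id_blinfun" "opow X (-1) o\<^sub>L X = id_blinfun"
    using add[of 1 "-1"] add[of "-1" 1] opow_0_interval[OF X a] by (simp_all add: 1)
  moreover have "positive_op X"
    unfolding positive_op_def
  proof (intro conjI allI)
    fix x :: 'a
    have "0 \<le> a * (norm x)\<^sup>2" using a by simp
    also have "\<dots> \<le> X x \<bullet> x" using X by (simp add: op_interval_iff)
    finally show "0 \<le> X x \<bullet> x" .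
  qed (rule op_interval_self_adjoint[OF X])
  ultimately show ?thesis by (auto simp: posinv_def invertible_op_def)
qed

lemma opow_inverse:
  assumes "posinv X"
  shows "opow X r o\<^sub>L opow X (- r) = id_blinfun" "opow X (- r) o\<^sub>L opow X r = id_blinfun"
  using opow_add[OF assms, of r "- r"] opow_add[OF assms, of "- r" r] opow_0[OF assms] by simp_all

lemma posinv_opow:
  assumes "posinv X"
  shows "posinv (opow X r)"
proof -
  obtain a b where ab: "0 < a" "a \<le> b" "X \<in> op_interval a b" using posinv_op_interval[OF assms] .
  have "loewner (cfun (\<lambda>x. 0) X) (opow X r)"
    unfolding opow_def by (rule cfun_mono[OF ab(3,2)]) (auto simp: continuous_on_powr_Icc[OF ab(1)])
  then have "positive_op (opow X r)"
    by (simp add: cfun_const[OF ab(3)] positive_op_iff_loewner)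
  then show ?thesis
    using opow_inverse[OF assms] by (auto simp: posinv_def invertible_op_def)
qed

lemma opow_scaleR:
  assumes "posinv X" "0 < c"
  shows "opow (c *\<^sub>R X) r = c powr r *\<^sub>R opow X r"
proof -
  obtain a b where ab: "0 < a" "a \<le> b" "X \<in> op_interval a b" using posinv_op_interval[OF assms(1)] .
  have ca: "0 < c * a" using ab assms by simp
  have "opow (c *\<^sub>R X) r = cfun (\<lambda>x. (c * x) powr r) X"
    unfolding opow_def by (rule cfun_scaleR[OF ab(3) assms(2) continuous_on_powr_Icc[OF ca]])
  also have "\<dots> = cfun (\<lambda>x. c powr r * x powr r) X"
    by (rule cfun_cong[OF ab(3)]) (use ab assms in \<open>auto intro!: continuous_intros simp: powr_mult\<close>)
  also have "\<dots> = c powr r *\<^sub>R opow X r"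
    unfolding opow_def by (rule cfun_mult_left[OF ab(3) continuous_on_powr_Icc[OF ab(1)]])
  finally show ?thesis .
qed

lemma posinv_scaleR:
  assumes "posinv X" "0 < c"
  shows "posinv (c *\<^sub>R X)"
proof -
  obtain a b where ab: "0 < a" "a \<le> b" "X \<in> op_interval a b" using posinv_op_interval[OF assms(1)] .
  show ?thesis
    by (rule op_interval_posinv[OF op_interval_scaleR[OF ab(3)]]) (use ab assms in auto)
qed

lemma posinv_common_interval:
  assumes "posinv X" "posinv Y"
  obtains a b where "0 < a" "a \<le> b" "X \<in> op_interval a b" "Y \<in> op_interval a b"
proof -
  obtain a b where ab: "0 < a" "a \<le> b" "X \<in> op_interval a b" using posinv_op_interval[OF assms(1)] .
  obtain a' b' where ab': "0 < a'" "a' \<le> b'" "Y \<in> op_interval a' b'"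
    using posinv_op_interval[OF assms(2)] .
  show thesis
  proof (rule that[of "min a a'" "max b b'"])
    show "X \<in> op_interval (min a a') (max b b')" by (rule op_interval_mono[OF ab(3)]) auto
    show "Y \<in> op_interval (min a a') (max b b')" by (rule op_interval_mono[OF ab'(3)]) auto
  qed (use ab ab' in auto)
qed

lemma opow_intertwine:
  assumes "posinv X" "posinv Y" "Z o\<^sub>L X = Y o\<^sub>L Z"
  shows "Z o\<^sub>L opow X r = opow Y r o\<^sub>L Z"
proof -
  obtain a b where "0 < a" "X \<in> op_interval a b" "Y \<in> op_interval a b"
    using posinv_common_interval[OF assms(1,2)] .
  then show ?thesis
    unfolding opow_def using cfun_intertwine[OF _ _ continuous_on_powr_Icc assms(3)] by blast
qed

section \<open>Norms of powers of a self-adjoint operator\<close>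

lemma op_power_add: "op_power X (m + n) = op_power X m o\<^sub>L op_power X n"
  by (induction m) (simp_all add: op_power_0 op_power_Suc blinfun_compose_assoc)

lemma self_adjoint_op_power: "self_adjoint X \<Longrightarrow> self_adjoint (op_power X n)"
proof (induction n)
  case (Suc n)
  have "op_power X (n + 1) = op_power X (1 + n)" by simp
  then have "op_power X n o\<^sub>L X = X o\<^sub>L op_power X n"
    unfolding op_power_add by (simp add: op_power_0 op_power_Suc)
  then show ?case using Suc by (simp add: op_power_Suc self_adjoint_compose)
qed (simp add: op_power_0)

text \<open>The half of the C*-identity that lets norms grow under squaring, from <S x, S x> = <S S
  x, x>.\<close>

lemma norm_self_adjoint_square:
  assumes "self_adjoint S"
  shows "(norm S)\<^sup>2 \<le> norm (S o\<^sub>L S)"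
proof -
  have "norm S \<le> sqrt (norm (S o\<^sub>L S))"
  proof (rule norm_blinfun_bound)
    fix x
    have "(norm (S x))\<^sup>2 = (S o\<^sub>L S) x \<bullet> x"
      by (simp add: power2_norm_eq_inner self_adjointD[OF assms])
    also have "\<dots> \<le> norm ((S o\<^sub>L S) x) * norm x" by (rule norm_cauchy_schwarz)
    also have "\<dots> \<le> norm (S o\<^sub>L S) * norm x * norm x"
      by (intro mult_right_mono norm_blinfun) simp
    also have "\<dots> = (sqrt (norm (S o\<^sub>L S)) * norm x)\<^sup>2"
      by (simp add: power_mult_distrib power2_eq_square)
    finally show "norm (S x) \<le> sqrt (norm (S o\<^sub>L S)) * norm x"
      by (rule power2_le_imp_le) simp
  qed simp
  then have "(norm S)\<^sup>2 \<le> (sqrt (norm (S o\<^sub>L S)))\<^sup>2" by (rule power_mono) simp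
  then show ?thesis by simp
qed

text \<open>Repeated squaring reaches only the exponents 2^k, which suffice to detect exponential
  growth.\<close>

lemma norm_op_power_self_adjoint:
  assumes "self_adjoint S"
  shows "norm S ^ (2 ^ k) \<le> norm (op_power S (2 ^ k))"
proof (induction k)
  case (Suc k)
  have "norm S ^ (2 ^ Suc k) = (norm S ^ (2 ^ k))\<^sup>2" by (simp add: power_mult[symmetric] mult.commute)
  also have "\<dots> \<le> (norm (op_power S (2 ^ k)))\<^sup>2" by (rule power_mono[OF Suc]) simp
  also have "\<dots> \<le> norm (op_power S (2 ^ k) o\<^sub>L op_power S (2 ^ k))"
    by (rule norm_self_adjoint_square[OF self_adjoint_op_power[OF assms]])
  also have "\<dots> = norm (op_power S (2 ^ Suc k))"
    by (simp add: op_power_add[symmetric] mult_2)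
  finally show ?case .
qed (simp add: op_power_0 op_power_Suc)

lemma norm_op_power_contraction: "norm V \<le> 1 \<Longrightarrow> norm (op_power V n) \<le> 1"
proof (induction n)
  case (Suc n)
  have "norm (op_power V (Suc n)) \<le> norm V * norm (op_power V n)"
    unfolding op_power_Suc by (rule norm_blinfun_compose)
  also have "\<dots> \<le> 1 * 1" using Suc by (intro mult_mono) auto
  finally show ?case by simp
qed (simp add: op_power_0 norm_blinfun_id_le)

text \<open>A self-adjoint operator attains its spectral radius as norm, and the spectral radius
  is invariant under similarity.\<close>

lemma norm_self_adjoint_similar_contraction:
  fixes W D V D' :: "'a::{real_inner,complete_space} op"
  assumes W: "self_adjoint W" and WV: "W = D o\<^sub>L V o\<^sub>L D'" and D: "D' o\<^sub>L D = id_blinfun"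
    "D o\<^sub>L D' = id_blinfun" and V: "norm V \<le> 1"
  shows "norm W \<le> 1"
proof (rule ccontr)
  assume "\<not> norm W \<le> 1"
  then have W1: "norm W > 1" by simp
  have pw: "op_power W n = D o\<^sub>L op_power V n o\<^sub>L D'" for n
  proof (induction n)
    case (Suc n)
    have "op_power W (Suc n) = W o\<^sub>L (D o\<^sub>L op_power V n o\<^sub>L D')"
      by (simp only: op_power_Suc Suc)
    also have "\<dots> = D o\<^sub>L (V o\<^sub>L ((D' o\<^sub>L D) o\<^sub>L (op_power V n o\<^sub>L D')))"
      by (simp only: WV blinfun_compose_assoc)
    finally show ?case by (simp add: D op_power_Suc blinfun_compose_assoc)
  qed (simp add: op_power_0 D)
  have bd: "norm W ^ (2 ^ k) \<le> norm D * norm D'" for k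
  proof -
    have "norm W ^ (2 ^ k) \<le> norm (D o\<^sub>L op_power V (2 ^ k) o\<^sub>L D')"
      using norm_op_power_self_adjoint[OF W, of k] by (simp add: pw)
    also have "\<dots> \<le> norm (D o\<^sub>L op_power V (2 ^ k)) * norm D'" by (rule norm_blinfun_compose)
    also have "\<dots> \<le> (norm D * norm (op_power V (2 ^ k))) * norm D'"
      by (intro mult_right_mono norm_blinfun_compose) simp
    also have "\<dots> \<le> (norm D * 1) * norm D'"
      by (intro mult_right_mono mult_left_mono norm_op_power_contraction V) auto
    finally show ?thesis by simp
  qed
  \<comment> \<open>A norm above 1 outgrows the fixed bound at some exponent n, and n \<le> 2^n
    leads to an exponent of the form treated in \<open>bd\<close>.\<close>
  obtain n where n: "norm D * norm D' < norm W ^ n" using real_arch_pow[OF W1] by blast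
  have "norm W ^ n \<le> norm W ^ (2 ^ n)"
    using W1 by (intro power_increasing) (auto intro: less_imp_le)
  then show False using n bd[of n] by linarith
qed

text \<open>B is the adjoint of A, given only through the pairing; taking z = B w in the pairing
  gives the bound.\<close>

lemma norm_adjoint_le:
  fixes A B :: "'a::{real_inner,complete_space} op"
  assumes "\<And>z w. A z \<bullet> w = z \<bullet> B w"
  shows "norm B \<le> norm A"
proof (rule norm_blinfun_bound)
  fix w
  show "norm (B w) \<le> norm A * norm w"
  proof (cases "B w = 0")
    case False
    have "norm (B w) * norm (B w) = A (B w) \<bullet> w"
      by (simp add: assms dot_square_norm power2_eq_square)
    also have "\<dots> \<le> norm (A (B w)) * norm w" by (rule norm_cauchy_schwarz)
    also have "\<dots> \<le> norm A * norm (B w) * norm w"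
      by (intro mult_right_mono norm_blinfun) simp
    finally have "norm (B w) * norm (B w) \<le> (norm A * norm w) * norm (B w)"
      by (simp add: mult.commute mult.left_commute)
    moreover have "0 < norm (B w)" using False by simp
    ultimately show ?thesis by (rule mult_right_le_imp_le)
  qed simp
qed simp

section \<open>Composition in the functional calculus\<close>

lemma cfun_add:
  assumes X: "X \<in> op_interval a b" and f: "continuous_on {a..b} f" and g: "continuous_on {a..b} g"
  shows "cfun (\<lambda>x. f x + g x) X = cfun f X + cfun g X"
proof -
  have "continuous_on {a..b} (\<lambda>x. - g x)" using g by (intro continuous_intros)
  from cfun_diff[OF X f this] show ?thesis
    using cfun_mult_left[OF X g, of "-1"] by simp
qed

lemma cfun_in_op_interval:
  assumes X: "X \<in> op_interval a b" "a \<le> b" and f: "continuous_on {a..b} f"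
    and "\<And>x. x \<in> {a..b} \<Longrightarrow> f x \<in> {c..d}"
  shows "cfun f X \<in> op_interval c d"
  using cfun_mono[OF X _ f, of "\<lambda>x. c"] cfun_mono[OF X f, of "\<lambda>x. d"] assms(4)
  by (simp add: op_interval_def cfun_const[OF X(1)])

lemma cfun_poly_compose:
  assumes X: "X \<in> op_interval a b" and g: "continuous_on {a..b} g"
  shows "cfun (\<lambda>x. poly q (g x)) X = polyop q (cfun g X)"
proof (induction q)
  case (pCons c q)
  have *: "continuous_on {a..b} (\<lambda>x. poly q (g x))" using g by (intro continuous_intros)
  show ?case
    using cfun_add[OF X continuous_on_const continuous_on_mult[OF g *], of c] cfun_mult[OF X g *] pCons
    by (simp add: polyop_pCons cfun_const[OF X])
qed (simp add: cfun_const[OF X])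

text \<open>For polynomial f this is the algebra of \<open>cfun_poly_compose\<close>. A general f is
  replaced by polynomials uniformly close on [c,d]; their composites with g are uniformly close on
  [a,b], so the two limits agree.\<close>

lemma cfun_compose:
  assumes X: "X \<in> op_interval a b" "a \<le> b" and g: "continuous_on {a..b} g"
    and gcd: "\<And>x. x \<in> {a..b} \<Longrightarrow> g x \<in> {c..d}" and f: "continuous_on {c..d} f"
  shows "cfun f (cfun g X) = cfun (\<lambda>x. f (g x)) X"
proof -
  obtain q where q: "uniform_limit {c..d} (\<lambda>k x. poly (q k) x) f sequentially"
    using polynomial_approximation[OF f] .
  have lim: "(\<lambda>k. polyop (q k) (cfun g X)) \<longlonglongrightarrow> cfun f (cfun g X)"
    by (rule tendsto_cfun[OF cfun_in_op_interval[OF X g gcd] q])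
  have fg: "continuous_on {a..b} (\<lambda>x. f (g x))"
    using continuous_on_compose2[OF f g] gcd by blast
  have qg: "continuous_on {a..b} (\<lambda>x. poly (q k) (g x))" for k using g by (intro continuous_intros)
  have "(\<lambda>k. polyop (q k) (cfun g X)) \<longlonglongrightarrow> cfun (\<lambda>x. f (g x)) X"
  proof (rule LIMSEQ_I)
    fix e :: real assume "e > 0"
    then have "e / 2 > 0" by simp
    then obtain N where N: "\<And>k x. k \<ge> N \<Longrightarrow> x \<in> {c..d} \<Longrightarrow> \<bar>poly (q k) x - f x\<bar> < e / 2"
      using q unfolding uniform_limit_sequentially_iff dist_real_def by blast
    have "norm (polyop (q k) (cfun g X) - cfun (\<lambda>x. f (g x)) X) < e" if "k \<ge> N" for k
    proof -
      have "norm (cfun (\<lambda>x. poly (q k) (g x) - f (g x)) X) \<le> e / 2"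
      proof (rule norm_cfun_le[OF X])
        fix x assume "x \<in> {a..b}"
        from N[OF that gcd[OF this]] show "\<bar>poly (q k) (g x) - f (g x)\<bar> \<le> e / 2" by simp
      qed (use \<open>e > 0\<close> in \<open>auto intro!: continuous_on_diff qg fg\<close>)
      then show ?thesis
        using \<open>e > 0\<close> by (simp add: cfun_diff[OF X(1) qg fg] cfun_poly_compose[OF X(1) g])
    qed
    then show "\<exists>no. \<forall>n\<ge>no. norm (polyop (q n) (cfun g X) - cfun (\<lambda>x. f (g x)) X) < e" by blast
  qed
  then show ?thesis using lim LIMSEQ_unique by blast
qed

lemma opow_opow:
  assumes "posinv X"
  shows "opow (opow X r) s = opow X (r * s)"
proof -
  obtain a b where ab: "0 < a" "a \<le> b" "X \<in> op_interval a b" using posinv_op_interval[OF assms] .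
  \<comment> \<open>A negative r exchanges the endpoints, hence the minimum and maximum.\<close>
  define c d where "c = min (a powr r) (b powr r)" and "d = max (a powr r) (b powr r)"
  have "c > 0" using ab by (simp add: c_def)
  have "x powr r \<in> {c..d}" if "x \<in> {a..b}" for x
  proof (cases "r \<ge> 0")
    case True
    then show ?thesis using that ab by (auto simp: c_def d_def min_le_iff_disj le_max_iff_disj intro: powr_mono2)
  next
    case False
    then show ?thesis
      using that ab by (auto simp: c_def d_def min_le_iff_disj le_max_iff_disj intro: powr_mono2')
  qed
  from cfun_compose[OF ab(3,2) continuous_on_powr_Icc[OF ab(1)] this continuous_on_powr_Icc[OF \<open>c > 0\<close>]]
  show ?thesis by (simp add: opow_def powr_powr)
qed

subsection \<open>The Loewner--Heinz inequality\<close>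

lemma opow_apply_inverse:
  assumes "posinv X"
  shows "opow X r (opow X (- r) x) = x" "opow X (- r) (opow X r x) = x"
  using opow_inverse[OF assms, of r, THEN arg_cong, of "\<lambda>T. blinfun_apply T x"] by simp_all

lemma opow_add_apply: "posinv X \<Longrightarrow> opow X r (opow X s x) = opow X (r + s) x"
  by (simp add: opow_add)

lemma norm_opow_half:
  assumes "posinv X"
  shows "(norm (opow X (s / 2) x))\<^sup>2 = opow X s x \<bullet> x"
  using self_adjointD[OF self_adjoint_opow[OF assms], of "s / 2" "opow X (s / 2) x" x]
  by (simp add: power2_norm_eq_inner opow_add_apply[OF assms])

text \<open>Evaluating the order relation at Y^(-s/2) z turns it into a contraction property,
  because both forms are squared norms of half powers.\<close>

lemma norm_opow_quotient_le_1:
  assumes X: "posinv X" and Y: "posinv Y" and le: "loewner (opow X s) (opow Y s)"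
  shows "norm (opow X (s / 2) o\<^sub>L opow Y (- (s / 2))) \<le> 1"
proof (rule norm_blinfun_bound)
  fix z
  let ?w = "opow Y (- (s / 2)) z"
  have "(norm (opow X (s / 2) ?w))\<^sup>2 \<le> opow Y s ?w \<bullet> ?w"
    using loewnerD[OF le] by (simp add: norm_opow_half[OF X])
  also have "\<dots> = (norm z)\<^sup>2"
    by (simp add: norm_opow_half[OF Y, symmetric] opow_apply_inverse[OF Y])
  finally show "norm ((opow X (s / 2) o\<^sub>L opow Y (- (s / 2))) z) \<le> 1 * norm z"
    by (simp add: power2_le_iff_abs_le)
qed simp

text \<open>W = Y^(-r/2) X^r Y^(-r/2) is conjugate, by a power of Y, to the product V of the two
  contractions belonging to s and t. Similarity preserves the spectral radius, which is the norm for
  the self-adjoint W; so W is a contraction, and this is the claim written at Y^(r/2) x.\<close>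

lemma opow_mono_midpoint:
  assumes X: "posinv X" and Y: "posinv Y"
    and s: "loewner (opow X s) (opow Y s)" and t: "loewner (opow X t) (opow Y t)"
  shows "loewner (opow X ((s + t) / 2)) (opow Y ((s + t) / 2))"
proof -
  define r where "r = (s + t) / 2"
  define W where "W = opow Y (- (r / 2)) o\<^sub>L opow X r o\<^sub>L opow Y (- (r / 2))"
  define V where "V = (opow Y (- (s / 2)) o\<^sub>L opow X (s / 2)) o\<^sub>L (opow X (t / 2) o\<^sub>L opow Y (- (t / 2)))"
  \<comment> \<open>The exponent (s - r)/2 makes both outer powers of Y in D V D' equal to -r/2,
    because s + t = 2 r.\<close>
  define D D' where "D = opow Y ((s - r) / 2)" and "D' = opow Y (- ((s - r) / 2))"
  have sa: "opow Z u x \<bullet> y = x \<bullet> opow Z u y" if "posinv Z" for Z u x y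
    by (rule self_adjointD[OF self_adjoint_opow[OF that]])
  \<comment> \<open>The factor for s enters V in reversed order, as the adjoint of the known
    contraction.\<close>
  have "norm (opow Y (- (s / 2)) o\<^sub>L opow X (s / 2)) \<le> norm (opow X (s / 2) o\<^sub>L opow Y (- (s / 2)))"
    by (rule norm_adjoint_le) (simp add: sa X Y)
  then have 1: "norm (opow Y (- (s / 2)) o\<^sub>L opow X (s / 2)) \<le> 1"
    using norm_opow_quotient_le_1[OF X Y s] by linarith
  have "norm V \<le> norm (opow Y (- (s / 2)) o\<^sub>L opow X (s / 2)) * norm (opow X (t / 2) o\<^sub>L opow Y (- (t / 2)))"
    unfolding V_def by (rule norm_blinfun_compose)
  also have "\<dots> \<le> 1 * 1"
    using 1 norm_opow_quotient_le_1[OF X Y t] by (intro mult_mono) auto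
  finally have V1: "norm V \<le> 1" by simp
  have "norm W \<le> 1"
  proof (rule norm_self_adjoint_similar_contraction[OF _ _ _ _ V1])
    show "self_adjoint W"
      unfolding W_def by (intro self_adjoint_sandwich self_adjoint_opow X Y)
    have e: "(s - r) / 2 + - (s / 2) = - (r / 2)" "s / 2 + t / 2 = r" "- (t / 2) + - ((s - r) / 2) = - (r / 2)"
      by (simp_all add: r_def field_simps)
    have "D o\<^sub>L V o\<^sub>L D' = opow Y ((s - r) / 2 + - (s / 2)) o\<^sub>L opow X (s / 2 + t / 2)
        o\<^sub>L opow Y (- (t / 2) + - ((s - r) / 2))"
      unfolding opow_add[OF X] opow_add[OF Y] D_def D'_def V_def by (simp add: blinfun_compose_assoc)
    then show "W = D o\<^sub>L V o\<^sub>L D'" unfolding e W_def by simp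
    show "D' o\<^sub>L D = id_blinfun" "D o\<^sub>L D' = id_blinfun"
      unfolding D_def D'_def by (rule opow_inverse[OF Y])+
  qed
  have "loewner (opow X r) (opow Y r)"
  proof (rule loewnerI)
    fix x
    let ?z = "opow Y (r / 2) x"
    have "opow X r x \<bullet> x = W ?z \<bullet> ?z"
      by (simp add: W_def opow_apply_inverse[OF Y] sa[OF Y])
    also have "\<dots> \<le> norm (W ?z) * norm ?z" by (rule norm_cauchy_schwarz)
    also have "\<dots> \<le> norm W * norm ?z * norm ?z" by (intro mult_right_mono norm_blinfun) simp
    also have "\<dots> \<le> 1 * norm ?z * norm ?z" using \<open>norm W \<le> 1\<close> by (intro mult_right_mono) auto
    also have "\<dots> = opow Y r x \<bullet> x" by (simp add: norm_opow_half[OF Y, symmetric] power2_eq_square)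
    finally show "opow X r x \<bullet> x \<le> opow Y r x \<bullet> x" .
  qed (intro self_adjoint_opow X Y)+
  then show ?thesis by (simp add: r_def)
qed

lemma exp_diff_le: "\<bar>exp u - exp v\<bar> \<le> \<bar>u - v\<bar> * exp (max u v)" for u v :: real
proof -
  have *: "exp v - exp u \<le> (v - u) * exp v" for u v :: real
  proof -
    have "exp v * (1 + (u - v)) \<le> exp v * exp (u - v)" by (intro mult_left_mono exp_ge_add_one_self) simp
    then show ?thesis by (simp add: exp_diff algebra_simps)
  qed
  show ?thesis
    using *[of u v] *[of v u] by (cases "u \<le> v") (simp_all add: abs_if max_def)
qed

text \<open>The functions x^(\<tau> k) converge uniformly on [a,b]: if L bounds |ln x| there,
  \<open>exp_diff_le\<close> gives the error |\<tau> k - t| L exp L. Exponents from [0,1] keep the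
  factor exp L independent of k.\<close>

lemma tendsto_opow_exponent:
  assumes X: "posinv X" and t: "\<tau> \<longlonglongrightarrow> t" and T: "\<And>k. \<tau> k \<in> {0..1}"
  shows "(\<lambda>k. opow X (\<tau> k)) \<longlonglongrightarrow> opow X t"
proof -
  obtain a b where ab: "0 < a" "a \<le> b" "X \<in> op_interval a b" using posinv_op_interval[OF X] .
  have t01: "t \<in> {0..1}" using t T by (intro closed_sequentially[of "{0..1}" \<tau> t]) auto
  define L where "L = max \<bar>ln a\<bar> \<bar>ln b\<bar>"
  have L: "\<bar>ln x\<bar> \<le> L" if "x \<in> {a..b}" for x
  proof -
    have "ln a \<le> ln x" "ln x \<le> ln b" using that ab by auto
    then show ?thesis by (auto simp: L_def)
  qed
  have bd: "norm (opow X (\<tau> k) - opow X t) \<le> \<bar>\<tau> k - t\<bar> * (L * exp L)" for k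
  proof -
    note c = continuous_on_powr_Icc[OF ab(1)]
    have "norm (cfun (\<lambda>x. x powr \<tau> k - x powr t) X) \<le> \<bar>\<tau> k - t\<bar> * (L * exp L)"
    proof (rule norm_cfun_le[OF ab(3,2) continuous_on_diff[OF c c]])
      show "0 \<le> \<bar>\<tau> k - t\<bar> * (L * exp L)" by (simp add: L_def)
      fix x assume x: "x \<in> {a..b}"
      have "x > 0" using x ab by simp
      have le: "u * ln x \<le> L" if "u \<in> {0..1}" for u
      proof -
        have "u * ln x \<le> \<bar>u\<bar> * \<bar>ln x\<bar>" by (simp add: abs_mult[symmetric])
        also have "\<dots> \<le> 1 * L" using that L[OF x] by (intro mult_mono) auto
        finally show ?thesis by simp
      qed
      have "\<bar>x powr \<tau> k - x powr t\<bar> \<le> \<bar>\<tau> k * ln x - t * ln x\<bar> * exp (max (\<tau> k * ln x) (t * ln x))"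
        using exp_diff_le[of "\<tau> k * ln x" "t * ln x"] \<open>x > 0\<close> by (simp add: powr_def)
      also have "\<dots> \<le> \<bar>\<tau> k * ln x - t * ln x\<bar> * exp L"
        using le[OF T[of k]] le[OF t01] by (intro mult_left_mono) auto
      also have "\<bar>\<tau> k * ln x - t * ln x\<bar> = \<bar>\<tau> k - t\<bar> * \<bar>ln x\<bar>"
        by (simp add: abs_mult[symmetric] left_diff_distrib)
      also have "\<dots> * exp L \<le> \<bar>\<tau> k - t\<bar> * L * exp L"
        using L[OF x] by (intro mult_right_mono mult_left_mono) auto
      finally show "\<bar>x powr \<tau> k - x powr t\<bar> \<le> \<bar>\<tau> k - t\<bar> * (L * exp L)" by (simp add: mult.assoc)
    qed
    then show ?thesis by (simp add: opow_def cfun_diff[OF ab(3) c c])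
  qed
  have "(\<lambda>k. \<bar>\<tau> k - t\<bar> * (L * exp L)) \<longlonglongrightarrow> \<bar>t - t\<bar> * (L * exp L)"
    by (intro tendsto_intros t)
  then have "(\<lambda>k. \<bar>\<tau> k - t\<bar> * (L * exp L)) \<longlonglongrightarrow> 0" by simp
  then have "(\<lambda>k. opow X (\<tau> k) - opow X t) \<longlonglongrightarrow> 0"
    by (rule Lim_null_comparison[rotated]) (simp add: bd)
  then show ?thesis by (simp add: Lim_null[symmetric])
qed

text \<open>The exponents in [0,1] that preserve the order contain 0 and 1, are closed under
  midpoints by \<open>opow_mono_midpoint\<close>, and form a closed set by continuity in the
  exponent; the dyadic rationals are dense.\<close>

theorem Loewner_Heinz:
  assumes X: "posinv X" and Y: "posinv Y" and XY: "loewner X Y" and t: "0 \<le> t" "t \<le> 1"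
  shows "loewner (opow X t) (opow Y t)"
proof -
  have dyadic: "loewner (opow X (real j / 2 ^ k)) (opow Y (real j / 2 ^ k))" if "j \<le> 2 ^ k" for j k :: nat
    using that
  proof (induction k arbitrary: j)
    case 0
    then have "j = 0 \<or> j = 1" by auto
    then show ?case using XY by (auto simp: opow_0 opow_1 X Y)
  next
    case (Suc k)
    show ?case
    proof (cases "even j")
      case True
      then obtain i where "j = 2 * i" by blast
      then show ?thesis using Suc by simp
    next
      case False
      then obtain i where i: "j = 2 * i + 1" using oddE by blast
      then have "i \<le> 2 ^ k" "Suc i \<le> 2 ^ k" using Suc.prems by auto
      from opow_mono_midpoint[OF X Y Suc.IH[OF this(1)] Suc.IH[OF this(2)]]
      have "loewner (opow X ((real i / 2 ^ k + real (Suc i) / 2 ^ k) / 2))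
        (opow Y ((real i / 2 ^ k + real (Suc i) / 2 ^ k) / 2))" .
      moreover have "(real i / 2 ^ k + real (Suc i) / 2 ^ k) / 2 = real j / 2 ^ Suc k"
        by (simp add: i add_divide_distrib[symmetric] mult.commute add.commute)
      ultimately show ?thesis by metis
    qed
  qed
  \<comment> \<open>Rounding t down to the grid of width 2^(-k) stays in [0,1] and within 2^(-k) of
    t.\<close>
  define \<tau> where "\<tau> k = real (nat \<lfloor>t * 2 ^ k\<rfloor>) / 2 ^ k" for k
  have fl: "real (nat \<lfloor>t * 2 ^ k\<rfloor>) = of_int \<lfloor>t * 2 ^ k\<rfloor>" for k using t by simp
  have up: "\<tau> k \<le> t" for k
    unfolding \<tau>_def fl by (simp add: pos_divide_le_eq)
  have lo: "t - 1 / 2 ^ k \<le> \<tau> k" for k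
  proof -
    have "(t * 2 ^ k - 1) / 2 ^ k \<le> of_int \<lfloor>t * 2 ^ k\<rfloor> / 2 ^ k"
      by (intro divide_right_mono) (linarith, simp)
    then show ?thesis unfolding \<tau>_def fl by (simp add: diff_divide_distrib)
  qed
  have "(\<lambda>k. t - (1 / 2) ^ k) \<longlonglongrightarrow> t - 0"
    by (intro tendsto_intros LIMSEQ_realpow_zero) auto
  then have low: "(\<lambda>k. t - 1 / 2 ^ k) \<longlonglongrightarrow> t" by (simp add: power_one_over)
  have lim: "\<tau> \<longlonglongrightarrow> t"
    by (rule real_tendsto_sandwich[OF _ _ low tendsto_const]) (simp_all add: lo up)
  have T: "\<tau> k \<in> {0..1}" for k
    using order_trans[OF up[of k] t(2)] by (simp only: atLeastAtMost_iff) (simp add: \<tau>_def)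
  have "loewner (opow X (\<tau> k)) (opow Y (\<tau> k))" for k
  proof -
    have "real (nat \<lfloor>t * 2 ^ k\<rfloor>) \<le> 2 ^ k"
      using T[of k] by (simp add: \<tau>_def pos_divide_le_eq)
    then have "nat \<lfloor>t * 2 ^ k\<rfloor> \<le> 2 ^ k" by (metis of_nat_le_iff of_nat_numeral of_nat_power)
    then show ?thesis unfolding \<tau>_def by (rule dyadic)
  qed
  from loewner_limit[OF this tendsto_opow_exponent[OF X lim T] tendsto_opow_exponent[OF Y lim T]]
  show ?thesis .
qed

subsection \<open>The weighted geometric mean of two operators\<close>

lemma sharp_eq:
  "sharp t A B = opow A (1/2) o\<^sub>L opow (opow A (- (1/2)) o\<^sub>L B o\<^sub>L opow A (- (1/2))) t o\<^sub>L opow A (1/2)"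
  by (simp add: sharp_def)

lemma opow_half_simps:
  assumes "posinv A"
  shows "opow A (1/2) (opow A (1/2) x) = A x"
    and "opow A (1/2) (opow A (- (1/2)) x) = x"
    and "opow A (- (1/2)) (opow A (1/2) x) = x"
    and "opow A (- (1/2)) (A x) = opow A (1/2) x"
    and "A (opow A (- (1/2)) x) = opow A (1/2) x"
proof -
  show 1: "opow A (1/2) (opow A (1/2) x) = A x" for x
    by (simp add: opow_add_apply opow_1 assms)
  show 2: "opow A (1/2) (opow A (- (1/2)) x) = x" and 3: "opow A (- (1/2)) (opow A (1/2) x) = x" for x
    by (simp_all add: opow_add_apply opow_0 assms)
  show "opow A (- (1/2)) (A x) = opow A (1/2) x" by (simp only: 1[symmetric] 3)
  show "A (opow A (- (1/2)) x) = opow A (1/2) x" by (simp only: 1[symmetric] 2)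
qed

lemma opow_minus_one_simps:
  assumes "posinv A"
  shows "opow A (-1) (A x) = x" "A (opow A (-1) x) = x"
  using opow_apply_inverse[OF assms, of 1 x] by (simp_all add: opow_1 assms)

text \<open>A right inverse agrees with the two-sided inverse \<open>opow A (-1)\<close>; explicit
  inverses of sandwiches are recognised this way.\<close>

lemma opow_minus_one_eqI:
  fixes A B :: "'a::{real_inner,complete_space} op"
  assumes "posinv A" "\<And>x. A (B x) = x"
  shows "opow A (-1) = B"
  by (rule blinfun_eqI) (metis assms opow_minus_one_simps(1))

lemma posinv_sandwich:
  fixes B S S' :: "'a::{real_inner,complete_space} op"
  assumes B: "posinv B" and S: "self_adjoint S" and inv: "\<And>x. S (S' x) = x" "\<And>x. S' (S x) = x"
  shows "posinv (S o\<^sub>L B o\<^sub>L S)"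
proof -
  have "positive_op (S o\<^sub>L B o\<^sub>L S)"
    unfolding positive_op_def
  proof (intro conjI allI)
    show "self_adjoint (S o\<^sub>L B o\<^sub>L S)" by (intro self_adjoint_sandwich S posinv_self_adjoint B)
    fix x
    have "0 \<le> B (S x) \<bullet> S x" using B by (simp add: posinv_def positive_op_def)
    then show "0 \<le> (S o\<^sub>L B o\<^sub>L S) x \<bullet> x" by (simp add: self_adjointD[OF S])
  qed
  moreover have "S o\<^sub>L B o\<^sub>L S o\<^sub>L (S' o\<^sub>L opow B (-1) o\<^sub>L S') = id_blinfun"
    "S' o\<^sub>L opow B (-1) o\<^sub>L S' o\<^sub>L (S o\<^sub>L B o\<^sub>L S) = id_blinfun"
    by (rule blinfun_eqI, simp add: inv opow_minus_one_simps[OF B])+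
  ultimately show ?thesis unfolding posinv_def invertible_op_def by blast
qed

lemma posinv_opow_sandwich:
  assumes "posinv A" "posinv B"
  shows "posinv (opow A r o\<^sub>L B o\<^sub>L opow A r)"
  by (rule posinv_sandwich[OF assms(2) self_adjoint_opow[OF assms(1)], of _ "opow A (- r)"])
    (simp_all add: opow_apply_inverse[OF assms(1)])

lemma posinv_sharp: "posinv A \<Longrightarrow> posinv B \<Longrightarrow> posinv (sharp t A B)"
  unfolding sharp_eq by (intro posinv_opow_sandwich posinv_opow)

lemma opow_id: "opow (id_blinfun :: 'a::{real_inner,complete_space} op) t = id_blinfun"
proof -
  have I: "(id_blinfun :: 'a op) \<in> op_interval 1 1" by (simp add: op_interval_def)
  have "cfun (\<lambda>x. x powr t) (id_blinfun :: 'a op) = cfun (\<lambda>x. 1) id_blinfun"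
    by (rule cfun_cong[OF I continuous_on_powr_Icc]) auto
  then show ?thesis by (simp add: opow_def cfun_const[OF I])
qed

lemma sharp_same:
  assumes A: "posinv A"
  shows "sharp t A A = A"
proof -
  have "opow A (- (1/2)) o\<^sub>L A o\<^sub>L opow A (- (1/2)) = id_blinfun"
    by (rule blinfun_eqI) (simp add: opow_half_simps[OF A])
  then show ?thesis
    unfolding sharp_eq by (intro blinfun_eqI) (simp add: opow_id opow_half_simps[OF A])
qed

lemma sharp_mono_right:
  assumes A: "posinv A" and B: "posinv B" and D: "posinv D" and "loewner B D" and "0 \<le> t" "t \<le> 1"
  shows "loewner (sharp t A B) (sharp t A D)"
  unfolding sharp_eq
  by (intro loewner_sandwich Loewner_Heinz posinv_opow_sandwich self_adjoint_opow assms)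

lemma sharp_scaleR_right:
  assumes A: "posinv A" and B: "posinv B" and c: "0 < c"
  shows "sharp t A (c *\<^sub>R B) = c powr t *\<^sub>R sharp t A B"
  using opow_scaleR[OF posinv_opow_sandwich[OF A B] c]
  by (simp add: sharp_eq compose_bilinear_simps)

text \<open>The two sandwiches are linked by Z = A^(-1/2) B^(1/2) through X Z Y = Z, so Z carries
  powers of Y to powers of X^(-1). The symmetry transfers monotonicity and homogeneity from the
  right argument to the left one, which occurs three times in the formula for the mean.\<close>

lemma sharp_flip:
  assumes A: "posinv A" and B: "posinv B"
  shows "sharp t A B = sharp (1 - t) B A"
proof -
  define X where "X = opow A (- (1/2)) o\<^sub>L B o\<^sub>L opow A (- (1/2))"
  define Y where "Y = opow B (- (1/2)) o\<^sub>L A o\<^sub>L opow B (- (1/2))"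
  define Z where "Z = opow A (- (1/2)) o\<^sub>L opow B (1/2)"
  note simps = opow_half_simps[OF A] opow_half_simps[OF B]
  have X: "posinv X" and Y: "posinv Y"
    unfolding X_def Y_def by (intro posinv_opow_sandwich A B)+
  have XZY: "X (Z (Y x)) = Z x" for x
    by (simp add: X_def Y_def Z_def simps)
  have "Z o\<^sub>L Y = opow X (-1) o\<^sub>L Z"
    by (rule blinfun_eqI) (simp, metis XZY opow_minus_one_simps(1)[OF X])
  from opow_intertwine[OF Y posinv_opow[OF X] this, of "1 - t"]
  have "Z o\<^sub>L opow Y (1 - t) = opow X (t - 1) o\<^sub>L Z"
    by (simp add: opow_opow[OF X])
  then have ZY: "Z (opow Y (1 - t) x) = opow X (t - 1) (Z x)" for x
    by (metis blinfun_apply_blinfun_compose)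
  show ?thesis
  proof (rule blinfun_eqI)
    fix x
    \<comment> \<open>B^(1/2) = A^(1/2) Z and Z B^(1/2) = X A^(1/2) trade the square roots; the
      extra X raises the exponent from t - 1 to t.\<close>
    have aZ: "opow B (1/2) y = opow A (1/2) (Z y)" for y by (simp add: Z_def simps)
    have Zb: "Z (opow B (1/2) y) = X (opow A (1/2) y)" for y by (simp add: Z_def X_def simps)
    have "sharp (1 - t) B A x = opow A (1/2) (Z (opow Y (1 - t) (opow B (1/2) x)))"
      by (simp add: sharp_eq Y_def[symmetric] aZ[symmetric])
    also have "\<dots> = opow A (1/2) (opow X (t - 1) (opow X 1 (opow A (1/2) x)))"
      by (simp add: ZY Zb opow_1[OF X])
    also have "\<dots> = sharp t A B x"
      by (simp add: opow_add_apply[OF X] sharp_eq X_def[symmetric])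
    finally show "sharp t A B x = sharp (1 - t) B A x" by simp
  qed
qed

lemma weighted_am_gm_one:
  fixes x t :: real
  assumes "0 < x" "0 \<le> t" "t \<le> 1"
  shows "x powr t \<le> (1 - t) + t * x"
  using Youngs_inequality_0[of "1 - t" t 1 x] assms by simp

lemma opow_le_linear:
  assumes X: "posinv X" and t: "0 \<le> t" "t \<le> 1"
  shows "loewner (opow X t) ((1 - t) *\<^sub>R id_blinfun + t *\<^sub>R X)"
proof -
  obtain a b where ab: "0 < a" "a \<le> b" "X \<in> op_interval a b" using posinv_op_interval[OF X] .
  have "loewner (opow X t) (cfun (\<lambda>x. (1 - t) + t * x) X)"
    unfolding opow_def
    by (rule cfun_mono[OF ab(3,2) continuous_on_powr_Icc[OF ab(1)]])
      (use ab t weighted_am_gm_one in \<open>auto intro!: continuous_intros\<close>)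
  also have "cfun (\<lambda>x. (1 - t) + t * x) X = (1 - t) *\<^sub>R id_blinfun + t *\<^sub>R X"
    using cfun_add[OF ab(3) continuous_on_const continuous_on_mult_left[OF continuous_on_id], of "1 - t" t]
      cfun_mult_left[OF ab(3) continuous_on_id, of t]
    by (simp add: cfun_const[OF ab(3)] cfun_ident[OF ab(3)])
  finally show ?thesis .
qed

lemma sharp_le_arithmetic:
  assumes A: "posinv A" and B: "posinv B" and t: "0 \<le> t" "t \<le> 1"
  shows "loewner (sharp t A B) ((1 - t) *\<^sub>R A + t *\<^sub>R B)"
proof -
  let ?X = "opow A (- (1/2)) o\<^sub>L B o\<^sub>L opow A (- (1/2))"
  have "loewner (sharp t A B)
      (opow A (1/2) o\<^sub>L ((1 - t) *\<^sub>R id_blinfun + t *\<^sub>R ?X) o\<^sub>L opow A (1/2))"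
    unfolding sharp_eq
    by (intro loewner_sandwich opow_le_linear posinv_opow_sandwich self_adjoint_opow A B t)
  also have "opow A (1/2) o\<^sub>L ((1 - t) *\<^sub>R id_blinfun + t *\<^sub>R ?X) o\<^sub>L opow A (1/2) = (1 - t) *\<^sub>R A + t *\<^sub>R B"
    by (rule blinfun_eqI) (simp add: blinfun.bilinear_simps opow_half_simps[OF A])
  finally show ?thesis .
qed

text \<open>With k = A^(-1/2) the inverse of the mean is k (X^(-1))^t k, and X^(-1) = A^(1/2) B^(-1)
  A^(1/2). It is thus the geometric mean of the inverses, and the scalar bound x^t \<le> 1 - t + t x
  applies to X^(-1).\<close>

lemma sharp_inverse_le:
  assumes A: "posinv A" and B: "posinv B" and t: "0 \<le> t" "t \<le> 1"
  shows "loewner (opow (sharp t A B) (-1)) ((1 - t) *\<^sub>R opow A (-1) + t *\<^sub>R opow B (-1))"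
proof -
  let ?k = "opow A (- (1/2))"
  define X where "X = ?k o\<^sub>L B o\<^sub>L ?k"
  have X: "posinv X" unfolding X_def by (intro posinv_opow_sandwich A B)
  note simps = opow_half_simps[OF A]
  have inv: "opow (sharp t A B) (-1) = ?k o\<^sub>L opow (opow X (-1)) t o\<^sub>L ?k"
    by (rule opow_minus_one_eqI[OF posinv_sharp[OF A B]])
      (simp add: sharp_eq X_def[symmetric] simps opow_opow[OF X] opow_apply_inverse[OF X])
  have Xi: "opow X (-1) = opow A (1/2) o\<^sub>L opow B (-1) o\<^sub>L opow A (1/2)"
    by (rule opow_minus_one_eqI[OF X]) (simp add: X_def simps opow_minus_one_simps[OF B])
  have Ai: "opow A (-1) x = ?k (?k x)" for x by (simp add: opow_add_apply[OF A])
  have "loewner (opow (sharp t A B) (-1)) (?k o\<^sub>L ((1 - t) *\<^sub>R id_blinfun + t *\<^sub>R opow X (-1)) o\<^sub>L ?k)"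
    unfolding inv by (intro loewner_sandwich opow_le_linear posinv_opow self_adjoint_opow A X t)
  also have "?k o\<^sub>L ((1 - t) *\<^sub>R id_blinfun + t *\<^sub>R opow X (-1)) o\<^sub>L ?k
      = (1 - t) *\<^sub>R opow A (-1) + t *\<^sub>R opow B (-1)"
    by (rule blinfun_eqI) (simp add: blinfun.bilinear_simps Xi Ai simps)
  finally show ?thesis .
qed

subsection \<open>The Thompson metric\<close>

lemma posinv_loewner_scaleR:
  assumes "posinv A" "posinv B"
  obtains c where "0 < c" "loewner A (c *\<^sub>R B)"
proof -
  obtain a b where ab: "0 < a" "a \<le> b" "A \<in> op_interval a b" "B \<in> op_interval a b"
    using posinv_common_interval[OF assms] .
  have A: "loewner A (b *\<^sub>R id_blinfun)" and B: "loewner (a *\<^sub>R id_blinfun) B"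
    using ab by (simp_all add: op_interval_def)
  have "loewner ((b / a) *\<^sub>R (a *\<^sub>R id_blinfun)) ((b / a) *\<^sub>R B)"
    using ab by (intro loewner_scaleR[OF B]) simp
  then have "loewner (b *\<^sub>R id_blinfun) ((b / a) *\<^sub>R B)" using ab by simp
  then show thesis using that[of "b / a"] loewner_trans[OF A] ab by simp
qed

lemma posinv_form_nonneg: "posinv A \<Longrightarrow> 0 \<le> A x \<bullet> x"
  by (simp add: posinv_def positive_op_def)

lemma Mop_bdd: "bdd_below {c. 0 < c \<and> loewner A (c *\<^sub>R B)}"
  by (rule bdd_belowI[of _ 0]) simp

lemma Mop_nonneg:
  assumes "posinv A" "posinv B"
  shows "0 \<le> Mop A B"
proof -
  obtain c where "0 < c" "loewner A (c *\<^sub>R B)" using posinv_loewner_scaleR[OF assms] .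
  then show ?thesis unfolding Mop_def by (intro cInf_greatest) auto
qed

text \<open>The infimum inherits the order relation, since every admissible c bounds the quotient of
  the forms at each x. Where the form of B vanishes, a single admissible c already makes the form of
  A at most 0.\<close>

lemma loewner_Mop:
  assumes A: "posinv A" and B: "posinv B"
  shows "loewner A (Mop A B *\<^sub>R B)"
proof (rule loewnerI)
  fix x
  obtain c0 where c0: "0 < c0" "loewner A (c0 *\<^sub>R B)" using posinv_loewner_scaleR[OF assms] .
  have le: "A x \<bullet> x \<le> c * (B x \<bullet> x)" if "loewner A (c *\<^sub>R B)" for c
    using loewnerD[OF that, of x] by (simp add: blinfun.bilinear_simps)
  show "A x \<bullet> x \<le> (Mop A B *\<^sub>R B) x \<bullet> x"
  proof (cases "B x \<bullet> x = 0")
    case True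
    then show ?thesis using le[OF c0(2)] by (simp add: blinfun.bilinear_simps)
  next
    case False
    then have p: "B x \<bullet> x > 0" using posinv_form_nonneg[OF B, of x] by simp
    have "(A x \<bullet> x) / (B x \<bullet> x) \<le> Mop A B"
      unfolding Mop_def
    proof (rule cInf_greatest)
      show "{c. 0 < c \<and> loewner A (c *\<^sub>R B)} \<noteq> {}" using c0 by blast
      fix c assume "c \<in> {c. 0 < c \<and> loewner A (c *\<^sub>R B)}"
      then show "(A x \<bullet> x) / (B x \<bullet> x) \<le> c" using le[of c] p by (simp add: pos_divide_le_eq)
    qed
    then show ?thesis using p by (simp add: blinfun.bilinear_simps pos_divide_le_eq)
  qed
qed (use A B in \<open>simp_all add: posinv_self_adjoint\<close>)

lemma thompson_sym: "thompson A B = thompson B A"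
  by (simp add: thompson_def max.commute)

lemma loewner_thompson:
  assumes A: "posinv A" and B: "posinv B"
  shows "loewner A (exp (thompson A B) *\<^sub>R B)"
proof -
  \<comment> \<open>For \<open>Mop A B = 0\<close> the convention \<open>ln 0 = 0\<close> makes the
    right side 1, so the inequality survives.\<close>
  have "Mop A B \<le> exp (ln (Mop A B))"
    using Mop_nonneg[OF A B] by (cases "Mop A B = 0") simp_all
  also have "\<dots> \<le> exp (thompson A B)" by (simp add: thompson_def)
  finally have "loewner (Mop A B *\<^sub>R B) (exp (thompson A B) *\<^sub>R B)"
    using B by (intro loewner_scaleR_mono) (simp_all add: posinv_def)
  then show ?thesis using loewner_trans[OF loewner_Mop[OF A B]] by blast
qed

text \<open>A vanishing \<open>Mop A B\<close> has logarithm 0 by convention; 0 \<le> \<delta>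
  covers this value.\<close>

lemma ln_Mop_le:
  assumes A: "posinv A" and B: "posinv B" and "0 \<le> \<delta>" "loewner A (exp \<delta> *\<^sub>R B)"
  shows "ln (Mop A B) \<le> \<delta>"
proof (cases "Mop A B = 0")
  case False
  then have "Mop A B > 0" using Mop_nonneg[OF A B] by simp
  moreover have "Mop A B \<le> exp \<delta>"
    unfolding Mop_def by (rule cInf_lower[OF _ Mop_bdd]) (simp add: assms)
  ultimately show ?thesis by (metis ln_exp ln_le_cancel_iff exp_gt_zero)
qed (use assms in simp)

lemma thompson_leI:
  assumes "posinv A" "posinv B" "0 \<le> \<delta>" "loewner A (exp \<delta> *\<^sub>R B)" "loewner B (exp \<delta> *\<^sub>R A)"
  shows "thompson A B \<le> \<delta>"
  unfolding thompson_def using assms by (simp add: ln_Mop_le)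

text \<open>On the zero space \<^const>\<open>Mop\<close> is \<open>0\<close> and the claim rests on \<open>ln 0 = 0\<close>.\<close>

lemma thompson_nonneg:
  fixes A B :: "'a::{real_inner,complete_space} op"
  assumes A: "posinv A" and B: "posinv B"
  shows "0 \<le> thompson A B"
proof (cases "\<exists>x::'a. x \<noteq> 0")
  case True
  then obtain x :: 'a where "x \<noteq> 0" by blast
  obtain a b where a: "0 < a" "A \<in> op_interval a b" using posinv_op_interval[OF A] .
  let ?e = "exp (thompson A B)"
  have "0 < a * (norm x)\<^sup>2" using a \<open>x \<noteq> 0\<close> by simp
  also have "\<dots> \<le> A x \<bullet> x" using a by (simp add: op_interval_iff)
  finally have p: "0 < A x \<bullet> x" .
  have "A x \<bullet> x \<le> ?e * (B x \<bullet> x)"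
    using loewnerD[OF loewner_thompson[OF A B], of x] by (simp add: blinfun.bilinear_simps)
  also have "\<dots> \<le> ?e * (?e * (A x \<bullet> x))"
    using loewnerD[OF loewner_thompson[OF B A], of x]
    by (intro mult_left_mono) (simp_all add: blinfun.bilinear_simps thompson_sym)
  finally have "1 * (A x \<bullet> x) \<le> exp (2 * thompson A B) * (A x \<bullet> x)"
    by (simp add: mult.assoc[symmetric] exp_add[symmetric])
  then have "1 \<le> exp (2 * thompson A B)" using p by (rule mult_right_le_imp_le)
  then show ?thesis by simp
next
  case False
  then have z: "x = 0" for x :: 'a by blast
  have "loewner C D" for C D :: "'a op"
    unfolding loewner_iff self_adjoint_def by (metis inner_zero_left inner_zero_right order_refl z)
  then have "Mop C D = 0" for C D :: "'a op"
    by (simp add: Mop_def greaterThan_def[symmetric])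
  then show ?thesis by (simp add: thompson_def)
qed

lemma thompson_triangle:
  assumes A: "posinv A" and B: "posinv B" and C: "posinv C"
  shows "thompson A C \<le> thompson A B + thompson B C"
proof -
  have *: "loewner X (exp (thompson X Y + thompson Y Z) *\<^sub>R Z)"
    if "posinv X" "posinv Y" "posinv Z" for X Y Z :: "'a op"
  proof -
    have "loewner (exp (thompson X Y) *\<^sub>R Y) (exp (thompson X Y) *\<^sub>R (exp (thompson Y Z) *\<^sub>R Z))"
      by (rule loewner_scaleR[OF loewner_thompson[OF that(2,3)]]) simp
    from loewner_trans[OF loewner_thompson[OF that(1,2)] this] show ?thesis
      by (simp add: exp_add)
  qed
  show ?thesis
  proof (rule thompson_leI[OF A C])
    show "loewner C (exp (thompson A B + thompson B C) *\<^sub>R A)"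
      using *[OF C B A] by (simp add: thompson_sym add.commute)
  qed (use *[OF A B C] thompson_nonneg[OF A B] thompson_nonneg[OF B C] in auto)
qed

lemma norm_diff_le_of_loewner:
  assumes A: "self_adjoint A" and B: "self_adjoint B" and e: "0 \<le> e"
    and AB: "loewner A (B + e *\<^sub>R id_blinfun)" "loewner B (A + e *\<^sub>R id_blinfun)"
  shows "norm (A - B) \<le> e"
proof (rule norm_self_adjoint_le[OF _ e])
  fix x
  show "\<bar>(A - B) x \<bullet> x\<bar> \<le> e * (norm x)\<^sup>2"
    using AB[THEN loewnerD, of x]
    by (simp add: blinfun.bilinear_simps inner_simps dot_square_norm)
qed (use A B in simp)

lemma loewner_add_norm_diff:
  assumes A: "self_adjoint A" and B: "self_adjoint B"
  shows "loewner A (B + norm (A - B) *\<^sub>R id_blinfun)"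
proof (rule loewnerI)
  fix x
  have "(A - B) x \<bullet> x \<le> norm ((A - B) x) * norm x" by (rule norm_cauchy_schwarz)
  also have "\<dots> \<le> norm (A - B) * norm x * norm x" by (intro mult_right_mono norm_blinfun) simp
  finally show "A x \<bullet> x \<le> (B + norm (A - B) *\<^sub>R id_blinfun) x \<bullet> x"
    by (simp add: blinfun.bilinear_simps inner_simps dot_square_norm power2_eq_square)
qed (use A B in simp_all)

text \<open>Converts an additive error into a multiplicative one: e I \<le> (e/m) B because B is at
  least m, and 1 + e/m \<le> exp (e/m).\<close>

lemma loewner_scaleR_of_add:
  assumes B: "B \<in> op_interval m M" and m: "0 < m" and e: "0 \<le> e"
  shows "loewner (B + e *\<^sub>R id_blinfun) (exp (e / m) *\<^sub>R B)"
proof -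
  have B': "loewner (m *\<^sub>R id_blinfun) B" using B by (simp add: op_interval_def)
  have "loewner ((e / m) *\<^sub>R (m *\<^sub>R id_blinfun)) ((e / m) *\<^sub>R B)"
    using m e by (intro loewner_scaleR[OF B']) simp
  then have "loewner (B + e *\<^sub>R id_blinfun) (B + (e / m) *\<^sub>R B)"
    using m by (intro loewner_add) simp_all
  moreover have "loewner ((1 + e / m) *\<^sub>R B) (exp (e / m) *\<^sub>R B)"
    using op_interval_posinv[OF B m] by (intro loewner_scaleR_mono exp_ge_add_one_self) (simp add: posinv_def)
  ultimately show ?thesis
    using loewner_trans by (simp add: scaleR_add_left) blast
qed

lemma thompson_le_norm:
  assumes A: "A \<in> op_interval m M" and B: "B \<in> op_interval m M" and m: "0 < m"
  shows "thompson A B \<le> norm (A - B) / m"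
proof -
  note sa = op_interval_self_adjoint[OF A] op_interval_self_adjoint[OF B]
  have "loewner A (exp (norm (A - B) / m) *\<^sub>R B)"
    by (rule loewner_trans[OF loewner_add_norm_diff[OF sa] loewner_scaleR_of_add[OF B m]]) simp
  moreover have "loewner B (exp (norm (B - A) / m) *\<^sub>R A)"
    by (rule loewner_trans[OF loewner_add_norm_diff[OF sa(2,1)] loewner_scaleR_of_add[OF A m]]) simp
  ultimately show ?thesis
    using op_interval_posinv[OF A m] op_interval_posinv[OF B m] m
    by (intro thompson_leI) (simp_all add: norm_minus_commute)
qed

text \<open>The constant collects three losses: a factor exp \<delta> costs an additive error (exp
  \<delta> - 1) M, the exponential satisfies exp \<delta> - 1 \<le> \<delta> exp \<delta>, and exp
  \<delta> is at most M/m because A and B share the interval.\<close>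

lemma norm_le_thompson:
  assumes A: "A \<in> op_interval m M" and B: "B \<in> op_interval m M" and m: "0 < m" "m \<le> M"
  shows "norm (A - B) \<le> (M\<^sup>2 / m) * thompson A B"
proof -
  note p = op_interval_posinv[OF A m(1)] op_interval_posinv[OF B m(1)]
  define \<delta> where "\<delta> = thompson A B"
  have "0 \<le> \<delta>" unfolding \<delta>_def by (rule thompson_nonneg[OF p])
  have scale: "loewner X ((M / m) *\<^sub>R Y)" if "X \<in> op_interval m M" "Y \<in> op_interval m M" for X Y :: "'a op"
  proof -
    have X: "loewner X (M *\<^sub>R id_blinfun)" and Y: "loewner (m *\<^sub>R id_blinfun) Y"
      using that by (simp_all add: op_interval_def)
    have "loewner ((M / m) *\<^sub>R (m *\<^sub>R id_blinfun)) ((M / m) *\<^sub>R Y)"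
      using m by (intro loewner_scaleR[OF Y]) simp
    then show ?thesis using loewner_trans[OF X] m by simp
  qed
  have "\<delta> \<le> ln (M / m)"
    unfolding \<delta>_def
    by (rule thompson_leI[OF p]) (use m scale[OF A B] scale[OF B A] in simp_all)
  then have "exp \<delta> \<le> M / m" using m by (metis exp_le_cancel_iff exp_ln divide_pos_pos less_le_trans)
  have "exp \<delta> * (1 + - \<delta>) \<le> exp \<delta> * exp (- \<delta>)" by (intro mult_left_mono exp_ge_add_one_self) simp
  then have "exp \<delta> - 1 \<le> \<delta> * exp \<delta>" by (simp add: exp_minus algebra_simps)
  also have "\<dots> \<le> \<delta> * (M / m)" using \<open>exp \<delta> \<le> M / m\<close> \<open>0 \<le> \<delta>\<close> by (rule mult_left_mono)
  finally have e1: "exp \<delta> - 1 \<le> \<delta> * (M / m)" .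
  have add: "loewner X (Y + ((exp \<delta> - 1) * M) *\<^sub>R id_blinfun)"
    if le: "loewner X (exp \<delta> *\<^sub>R Y)" and Y: "Y \<in> op_interval m M" for X Y :: "'a op"
  proof -
    have "loewner ((exp \<delta> - 1) *\<^sub>R Y) ((exp \<delta> - 1) *\<^sub>R (M *\<^sub>R id_blinfun))"
      using Y \<open>0 \<le> \<delta>\<close> by (intro loewner_scaleR) (simp_all add: op_interval_def)
    from loewner_add[OF loewner_refl[of Y] this]
    have "loewner (exp \<delta> *\<^sub>R Y) (Y + ((exp \<delta> - 1) * M) *\<^sub>R id_blinfun)"
      by (simp add: scaleR_diff_left)
    then show ?thesis by (rule loewner_trans[OF le])
  qed
  have "norm (A - B) \<le> (exp \<delta> - 1) * M"
  proof (rule norm_diff_le_of_loewner)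
    show "loewner A (B + ((exp \<delta> - 1) * M) *\<^sub>R id_blinfun)"
      using add[OF _ B] loewner_thompson[OF p] by (simp add: \<delta>_def)
    show "loewner B (A + ((exp \<delta> - 1) * M) *\<^sub>R id_blinfun)"
      using add[OF _ A] loewner_thompson[OF p(2,1)] by (simp add: \<delta>_def thompson_sym)
  qed (use A B m \<open>0 \<le> \<delta>\<close> in \<open>simp_all add: op_interval_self_adjoint\<close>)
  also have "\<dots> \<le> \<delta> * (M / m) * M" using e1 m by (intro mult_right_mono) simp_all
  also have "\<dots> = (M\<^sup>2 / m) * \<delta>" by (simp add: power2_eq_square)
  finally show ?thesis by (simp add: \<delta>_def)
qed

lemma op_interval_limit:
  assumes "\<And>n. X n \<in> op_interval a b" "X \<longlonglongrightarrow> L"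
  shows "L \<in> op_interval a b"
  using loewner_limit[OF _ tendsto_const assms(2), of "a *\<^sub>R id_blinfun"]
    loewner_limit[OF _ assms(2) tendsto_const, of "b *\<^sub>R id_blinfun"] assms(1)
  by (simp add: op_interval_def)

text \<open>L is any positive invertible operator, as in the description inside
  \<open>llrec\<close>, and may lie outside the interval of the sequence; the interval is widened to
  contain it before the two Lipschitz bounds are used.\<close>

lemma tendsto_thompson_iff:
  assumes X: "\<And>n. X n \<in> op_interval m M" and m: "0 < m" and L: "posinv L"
  shows "(\<lambda>n. thompson (X n) L) \<longlonglongrightarrow> 0 \<longleftrightarrow> X \<longlonglongrightarrow> L"
proof -
  obtain a b where ab: "0 < a" "a \<le> b" "L \<in> op_interval a b" using posinv_op_interval[OF L] .
  define c e where "c = min a m" and "e = max b M"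
  have c: "0 < c" "c \<le> e" using ab m by (auto simp: c_def e_def)
  have L': "L \<in> op_interval c e" by (rule op_interval_mono[OF ab(3)]) (auto simp: c_def e_def)
  have X': "X n \<in> op_interval c e" for n by (rule op_interval_mono[OF X]) (auto simp: c_def e_def)
  show ?thesis
  proof
    assume "(\<lambda>n. thompson (X n) L) \<longlonglongrightarrow> 0"
    then have "(\<lambda>n. (e\<^sup>2 / c) * thompson (X n) L) \<longlonglongrightarrow> (e\<^sup>2 / c) * 0" by (intro tendsto_intros)
    then have "(\<lambda>n. (e\<^sup>2 / c) * thompson (X n) L) \<longlonglongrightarrow> 0" by simp
    then have "(\<lambda>n. X n - L) \<longlonglongrightarrow> 0"
      by (rule Lim_null_comparison[rotated]) (intro always_eventually allI norm_le_thompson[OF X' L' c])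
    then show "X \<longlonglongrightarrow> L" by (simp add: Lim_null[symmetric])
  next
    assume "X \<longlonglongrightarrow> L"
    then have "(\<lambda>n. norm (X n - L) / c) \<longlonglongrightarrow> norm (L - L) / c" by (intro tendsto_intros) (use c in simp_all)
    then have "(\<lambda>n. norm (X n - L) / c) \<longlonglongrightarrow> 0" by simp
    then show "(\<lambda>n. thompson (X n) L) \<longlonglongrightarrow> 0"
      by (rule Lim_null_comparison[rotated])
        (simp add: thompson_le_norm[OF X' L' c(1)] thompson_nonneg[OF op_interval_posinv[OF X' c(1)] L])
  qed
qed

subsection \<open>Convergence of the Lawson--Lim recursion\<close>

lemma geometric_steps_convergent:
  fixes X :: "nat \<Rightarrow> 'b::real_normed_vector \<Rightarrow>\<^sub>L 'c::{real_normed_vector,complete_space}"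
  assumes \<rho>: "0 \<le> \<rho>" "\<rho> < 1" and C: "0 \<le> C" and step: "\<And>r. norm (X (Suc r) - X r) \<le> C * \<rho> ^ r"
  shows "convergent X"
proof (rule blinfun_Cauchy_convergent, rule CauchyI)
  fix e :: real assume "e > 0"
  \<comment> \<open>Keeping the partial geometric sum as a difference of powers makes the induction
    telescope.\<close>
  have sum: "norm (X (n + p) - X n) \<le> (C / (1 - \<rho>)) * (\<rho> ^ n - \<rho> ^ (n + p))" for n p
  proof (induction p)
    case (Suc p)
    have "norm (X (n + Suc p) - X n) \<le> norm (X (Suc (n + p)) - X (n + p)) + norm (X (n + p) - X n)"
      using norm_triangle_ineq[of "X (Suc (n + p)) - X (n + p)" "X (n + p) - X n"] by simp
    also have "\<dots> \<le> C * \<rho> ^ (n + p) + (C / (1 - \<rho>)) * (\<rho> ^ n - \<rho> ^ (n + p))"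
      by (intro add_mono step Suc)
    also have "C * \<rho> ^ (n + p) = (C / (1 - \<rho>)) * (\<rho> ^ (n + p) - \<rho> ^ (n + Suc p))"
      using \<rho> by (simp add: field_simps)
    finally show ?case by (simp add: algebra_simps)
  qed simp
  have "(\<lambda>n. (C / (1 - \<rho>)) * \<rho> ^ n) \<longlonglongrightarrow> (C / (1 - \<rho>)) * 0"
    using \<rho> by (intro tendsto_intros LIMSEQ_realpow_zero)
  then have "\<forall>\<^sub>F n in sequentially. (C / (1 - \<rho>)) * \<rho> ^ n < e / 2"
    using \<open>e > 0\<close> by (intro order_tendstoD) auto
  then obtain N where N: "(C / (1 - \<rho>)) * \<rho> ^ N < e / 2" by (auto simp: eventually_sequentially)
  have near: "norm (X n - X N) < e / 2" if "n \<ge> N" for n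
  proof -
    have "norm (X n - X N) \<le> (C / (1 - \<rho>)) * (\<rho> ^ N - \<rho> ^ n)" using sum[of N "n - N"] that by simp
    also have "\<dots> \<le> (C / (1 - \<rho>)) * \<rho> ^ N" using \<rho> C by (intro mult_left_mono) auto
    finally show ?thesis using N by linarith
  qed
  have "norm (X i - X j) < e" if "i \<ge> N" "j \<ge> N" for i j
  proof -
    have "norm (X i - X j) \<le> norm (X i - X N) + norm (X N - X j)"
      using norm_triangle_ineq[of "X i - X N" "X N - X j"] by simp
    then show ?thesis using near[OF that(1)] near[OF that(2)] by (simp add: norm_minus_commute)
  qed
  then show "\<exists>M. \<forall>m\<ge>M. \<forall>n\<ge>M. norm (X m - X n) < e" by blast
qed

section \<open>Lists with one entry left out, and one step of the recursion\<close>

lemma length_drop_nth: "i < length xs \<Longrightarrow> length (drop_nth i xs) = length xs - 1"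
  by (simp add: drop_nth_def)

lemma nth_drop_nth:
  assumes "i < length xs" "j < length xs - 1"
  shows "drop_nth i xs ! j = (if j < i then xs ! j else xs ! Suc j)"
  using assms by (auto simp: drop_nth_def nth_append min_def)

lemma set_drop_nth_subset: "set (drop_nth i xs) \<subseteq> set xs"
  by (auto simp: drop_nth_def dest: in_set_takeD in_set_dropD)

lemma drop_nth_replicate: "i < Suc n \<Longrightarrow> drop_nth i (replicate (Suc n) x) = replicate n x"
  by (rule nth_equalityI) (auto simp: length_drop_nth nth_drop_nth simp del: replicate_Suc)

text \<open>The local \<open>step\<close> of \<open>llrec\<close> as a constant, so that its
  iterates can be named in statements.\<close>

definition mean_step ::
  "(real \<Rightarrow> 'a::{real_inner,complete_space} op \<Rightarrow> 'a op \<Rightarrow> 'a op) \<Rightarrow> real \<Rightarrow> nat \<Rightarrow> 'a op list \<Rightarrow> 'a op list"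
  where "mean_step base t k Bs = map (\<lambda>i. llrec base t k (drop_nth i Bs)) [0..<length Bs]"

lemma llrec_Suc:
  "llrec base t (Suc k) As = (THE L. posinv L \<and>
    (\<forall>i<length As. (\<lambda>r. thompson ((mean_step base t k ^^ r) As ! i) L) \<longlonglongrightarrow> 0))"
  by (simp add: mean_step_def[abs_def])

lemma length_mean_step_iter: "length ((mean_step base t k ^^ r) As) = length As"
  by (induction r) (simp_all add: mean_step_def)

lemma nth_mean_step_iter:
  "i < length As \<Longrightarrow>
    (mean_step base t k ^^ Suc r) As ! i = llrec base t k (drop_nth i ((mean_step base t k ^^ r) As))"
  using length_mean_step_iter[of r base t k As] by (simp add: mean_step_def)

text \<open>A two-variable mean on the operator interval \<open>[m,M]\<close> that is jointly convex for a metric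
  \<open>d\<close> which is bi-Lipschitz equivalent to the norm there: the operator norm for the
  arithmetic and the Thompson metric for the geometric mean.\<close>

locale interval_mean =
  fixes m M t K :: real
    and base :: "real \<Rightarrow> 'a::{real_inner,complete_space} op \<Rightarrow> 'a op \<Rightarrow> 'a op"
    and d :: "'a op \<Rightarrow> 'a op \<Rightarrow> real"
  assumes m: "0 < m" and t: "0 < t" "t < 1" and K: "0 < K"
    and base_in: "A \<in> op_interval m M \<Longrightarrow> B \<in> op_interval m M \<Longrightarrow> base t A B \<in> op_interval m M"
    and base_same: "A \<in> op_interval m M \<Longrightarrow> base t A A = A"
    and d_sym: "d A B = d B A"
    and d_triangle: "A \<in> op_interval m M \<Longrightarrow> B \<in> op_interval m M \<Longrightarrow> C \<in> op_interval m M \<Longrightarrow>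
      d A C \<le> d A B + d B C"
    and base_d: "A \<in> op_interval m M \<Longrightarrow> B \<in> op_interval m M \<Longrightarrow>
      A' \<in> op_interval m M \<Longrightarrow> B' \<in> op_interval m M \<Longrightarrow>
      d (base t A B) (base t A' B') \<le> (1 - t) * d A A' + t * d B B'"
    and norm_le_d: "A \<in> op_interval m M \<Longrightarrow> B \<in> op_interval m M \<Longrightarrow> norm (A - B) \<le> K * d A B"
    and d_le_norm: "A \<in> op_interval m M \<Longrightarrow> B \<in> op_interval m M \<Longrightarrow> d A B \<le> K * norm (A - B)"
begin

abbreviation "S \<equiv> op_interval m M :: 'a op set"
abbreviation "mean \<equiv> llrec base t"
abbreviation "iter k r As \<equiv> (mean_step base t k ^^ r) As"

definition "\<rho> = max t (1 - t)"

lemma \<rho>_bounds: "0 \<le> \<rho>" "\<rho> < 1" "t \<le> \<rho>" "1 - t \<le> \<rho>"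
  using t by (auto simp: \<rho>_def)

lemma d_nonneg: "A \<in> S \<Longrightarrow> B \<in> S \<Longrightarrow> 0 \<le> d A B"
  using norm_le_d[of A B] K order_trans[OF norm_ge_zero, of "A - B" "K * d A B"]
  by (simp add: zero_le_mult_iff)

lemma d_refl: "A \<in> S \<Longrightarrow> d A A = 0"
  using d_nonneg[of A A] d_le_norm[of A A] by simp

text \<open>Continuity of d along norm limits, from the triangle inequality and the bound of d by
  the norm. The threshold r0 lets the estimate begin at a later iterate.\<close>

lemma d_limit_le:
  assumes A: "\<And>r. A r \<in> S" "A \<longlonglongrightarrow> L" and B: "\<And>r. B r \<in> S" "B \<longlonglongrightarrow> L'"
    and le: "\<And>r. r \<ge> r0 \<Longrightarrow> d (A r) (B r) \<le> \<delta>"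
  shows "d L L' \<le> \<delta>"
proof -
  have L: "L \<in> S" "L' \<in> S" using op_interval_limit A B by blast+
  have "(\<lambda>r. K * norm (L - A r) + \<delta> + K * norm (B r - L')) \<longlonglongrightarrow> K * norm (L - L) + \<delta> + K * norm (L' - L')"
    by (intro tendsto_intros A B)
  moreover have "\<forall>\<^sub>F r in sequentially. d L L' \<le> K * norm (L - A r) + \<delta> + K * norm (B r - L')"
    using eventually_ge_at_top[of r0]
  proof eventually_elim
    case (elim r)
    have "d L L' \<le> d L (A r) + d (A r) L'" by (rule d_triangle[OF L(1) A(1) L(2)])
    also have "d (A r) L' \<le> d (A r) (B r) + d (B r) L'" by (rule d_triangle[OF A(1) B(1) L(2)])
    finally show ?case
      using le[OF elim] d_le_norm[OF L(1) A(1), of r] d_le_norm[OF B(1) L(2), of r] by simp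
  qed
  ultimately have "d L L' \<le> K * norm (L - L) + \<delta> + K * norm (L' - L')"
    by (rule tendsto_lowerbound) simp
  then show ?thesis by simp
qed

text \<open>The invariant of the induction on the number k + 2 of arguments. Nonexpansiveness for
  the largest distance carries estimates to the limit, the factor \<rho> for a change in one place
  shrinks neighbouring entries, and idempotence allows an iterate to be compared with its
  predecessor.\<close>

definition mean_ok :: "nat \<Rightarrow> bool" where
  "mean_ok k \<longleftrightarrow>
    (\<forall>As. length As = k + 2 \<longrightarrow> set As \<subseteq> S \<longrightarrow> mean k As \<in> S) \<and>
    (\<forall>As Bs \<delta>. length As = k + 2 \<longrightarrow> length Bs = k + 2 \<longrightarrow> set As \<subseteq> S \<longrightarrow> set Bs \<subseteq> S \<longrightarrow>
      (\<forall>i<k + 2. d (As ! i) (Bs ! i) \<le> \<delta>) \<longrightarrow> d (mean k As) (mean k Bs) \<le> \<delta>) \<and>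
    (\<forall>As Bs j. length As = k + 2 \<longrightarrow> length Bs = k + 2 \<longrightarrow> set As \<subseteq> S \<longrightarrow> set Bs \<subseteq> S \<longrightarrow> j < k + 2 \<longrightarrow>
      (\<forall>i<k + 2. i \<noteq> j \<longrightarrow> As ! i = Bs ! i) \<longrightarrow> d (mean k As) (mean k Bs) \<le> \<rho> * d (As ! j) (Bs ! j)) \<and>
    (\<forall>A\<in>S. mean k (replicate (k + 2) A) = A)"

lemma mean_okD:
  assumes "mean_ok k"
  shows "length As = k + 2 \<Longrightarrow> set As \<subseteq> S \<Longrightarrow> mean k As \<in> S"
    and "length As = k + 2 \<Longrightarrow> length Bs = k + 2 \<Longrightarrow> set As \<subseteq> S \<Longrightarrow> set Bs \<subseteq> S \<Longrightarrow>
      (\<And>i. i < k + 2 \<Longrightarrow> d (As ! i) (Bs ! i) \<le> \<delta>) \<Longrightarrow> d (mean k As) (mean k Bs) \<le> \<delta>"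
    and "length As = k + 2 \<Longrightarrow> length Bs = k + 2 \<Longrightarrow> set As \<subseteq> S \<Longrightarrow> set Bs \<subseteq> S \<Longrightarrow> j < k + 2 \<Longrightarrow>
      (\<And>i. i < k + 2 \<Longrightarrow> i \<noteq> j \<Longrightarrow> As ! i = Bs ! i) \<Longrightarrow> d (mean k As) (mean k Bs) \<le> \<rho> * d (As ! j) (Bs ! j)"
    and "A \<in> S \<Longrightarrow> mean k (replicate (k + 2) A) = A"
  using assms unfolding mean_ok_def by simp_all

lemma iter_in_S:
  assumes ok: "mean_ok k" and As: "length As = k + 3" "set As \<subseteq> S"
  shows "set (iter k r As) \<subseteq> S"
proof (induction r)
  case (Suc r)
  have len: "length (iter k r As) = k + 3" by (simp add: length_mean_step_iter As)
  have "mean k (drop_nth i (iter k r As)) \<in> S" if "i < k + 3" for i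
    by (rule mean_okD(1)[OF ok])
      (use that len Suc set_drop_nth_subset[of i "iter k r As"] in \<open>auto simp: length_drop_nth\<close>)
  then have "set (mean_step base t k (iter k r As)) \<subseteq> S"
    unfolding mean_step_def[of base t k "iter k r As"] len by auto
  then show ?case by simp
qed (use As in simp)

lemma iter_nth_in_S:
  assumes "mean_ok k" "length As = k + 3" "set As \<subseteq> S" "i < k + 3"
  shows "iter k r As ! i \<in> S"
  using iter_in_S[OF assms(1-3), of r] nth_mem[of i "iter k r As"] assms(2,4)
  by (auto simp: length_mean_step_iter)

text \<open>The lists omitting entry \<open>i\<close> and entry \<open>i + 1\<close> differ in position \<open>i\<close> only, so one step
  contracts the distance of neighbouring entries.\<close>

lemma iter_neighbours:
  assumes ok: "mean_ok k" and As: "length As = k + 3" "set As \<subseteq> S" and i: "i < k + 2"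
  shows "d (iter k (Suc r) As ! i) (iter k (Suc r) As ! Suc i)
    \<le> \<rho> * d (iter k r As ! i) (iter k r As ! Suc i)"
proof -
  let ?B = "iter k r As"
  have len: "length ?B = k + 3" by (simp add: length_mean_step_iter As)
  have "d (mean k (drop_nth i ?B)) (mean k (drop_nth (Suc i) ?B))
      \<le> \<rho> * d (drop_nth i ?B ! i) (drop_nth (Suc i) ?B ! i)"
  proof (rule mean_okD(3)[OF ok])
    show "set (drop_nth i ?B) \<subseteq> S" "set (drop_nth (Suc i) ?B) \<subseteq> S"
      by (rule subset_trans[OF set_drop_nth_subset iter_in_S[OF ok As]])+
    fix j assume "j < k + 2" "j \<noteq> i"
    then show "drop_nth i ?B ! j = drop_nth (Suc i) ?B ! j"
      using i len by (simp add: nth_drop_nth)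
  qed (use i len in \<open>simp_all add: length_drop_nth\<close>)
  moreover have "drop_nth i ?B ! i = ?B ! Suc i" "drop_nth (Suc i) ?B ! i = ?B ! i"
    using i len by (simp_all add: nth_drop_nth)
  moreover have "iter k (Suc r) As ! i = mean k (drop_nth i ?B)"
    "iter k (Suc r) As ! Suc i = mean k (drop_nth (Suc i) ?B)"
    using i As by (intro nth_mean_step_iter; simp)+
  ultimately show ?thesis by (simp only: d_sym[of "?B ! Suc i"])
qed

text \<open>Neighbours decay like \<rho>^r, and two entries are joined by a chain of fewer than k +
  3 neighbour steps. D adds up all initial neighbour distances and so dominates each of
  them.\<close>

lemma iter_diameter:
  assumes ok: "mean_ok k" and As: "length As = k + 3" "set As \<subseteq> S"
  shows "\<exists>C\<ge>0. \<forall>r i j. i < k + 3 \<longrightarrow> j < k + 3 \<longrightarrow> d (iter k r As ! i) (iter k r As ! j) \<le> C * \<rho> ^ r"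
proof -
  note inS = iter_nth_in_S[OF ok As]
  define D where "D = (\<Sum>i<k + 2. d (As ! i) (As ! Suc i))"
  have dA: "0 \<le> d (As ! i) (As ! Suc i)" if "i < k + 2" for i
    using that inS[of i 0] inS[of "Suc i" 0] by (intro d_nonneg) simp_all
  have D0: "0 \<le> D" unfolding D_def by (intro sum_nonneg dA) simp
  have nb: "d (iter k r As ! i) (iter k r As ! Suc i) \<le> \<rho> ^ r * D" if i: "i < k + 2" for r i
  proof (induction r)
    case 0
    show ?case
      unfolding D_def using i member_le_sum[of i "{..<k + 2}" "\<lambda>i. d (As ! i) (As ! Suc i)"] dA by simp
  next
    case (Suc r)
    have "\<rho> * d (iter k r As ! i) (iter k r As ! Suc i) \<le> \<rho> * (\<rho> ^ r * D)"
      by (rule mult_left_mono[OF Suc \<rho>_bounds(1)])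
    then show ?case using iter_neighbours[OF ok As i, of r] by (simp add: mult.assoc)
  qed
  have chain: "d (iter k r As ! i) (iter k r As ! (i + n)) \<le> real n * (\<rho> ^ r * D)" if "i + n < k + 3" for r i n
    using that
  proof (induction n)
    case 0
    then show ?case using inS[of i r] by (simp add: d_refl)
  next
    case (Suc n)
    have "d (iter k r As ! i) (iter k r As ! (i + Suc n))
        \<le> d (iter k r As ! i) (iter k r As ! (i + n)) + d (iter k r As ! (i + n)) (iter k r As ! Suc (i + n))"
      using d_triangle[OF inS inS inS, of i "i + n" "Suc (i + n)" r r r] Suc.prems by simp
    also have "\<dots> \<le> real n * (\<rho> ^ r * D) + \<rho> ^ r * D"
      using Suc.prems by (intro add_mono Suc.IH nb) simp_all
    finally show ?case by (simp add: distrib_right add.commute)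
  qed
  have le: "d (iter k r As ! i) (iter k r As ! j) \<le> (real (k + 3) * D) * \<rho> ^ r"
    if "i \<le> j" "j < k + 3" for r i j
  proof -
    have "d (iter k r As ! i) (iter k r As ! j) \<le> real (j - i) * (\<rho> ^ r * D)"
      using chain[of i "j - i" r] that by simp
    also have "\<dots> \<le> real (k + 3) * (\<rho> ^ r * D)"
      using that D0 \<rho>_bounds(1) by (intro mult_right_mono mult_nonneg_nonneg zero_le_power) simp_all
    finally show ?thesis by (simp add: algebra_simps)
  qed
  show ?thesis
  proof (intro exI[of _ "real (k + 3) * D"] conjI allI impI)
    show "0 \<le> real (k + 3) * D" using D0 by simp
    show "d (iter k r As ! i) (iter k r As ! j) \<le> (real (k + 3) * D) * \<rho> ^ r"
      if "i < k + 3" "j < k + 3" for r i j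
    proof (cases "i \<le> j")
      case True
      then show ?thesis by (rule le[OF _ that(2)])
    next
      case False
      then have "d (iter k r As ! j) (iter k r As ! i) \<le> (real (k + 3) * D) * \<rho> ^ r"
        by (intro le that) simp
      then show ?thesis by (subst d_sym)
    qed
  qed
qed

text \<open>The next entry 0 is a mean of operators within the current diameter of the present entry
  0, and the mean of a constant list is that constant, so entry 0 moves by at most C \<rho>^r in d.
  It therefore converges, and the shrinking diameter draws the other entries to the same
  limit.\<close>

lemma iter_converges:
  assumes ok: "mean_ok k" and As: "length As = k + 3" "set As \<subseteq> S"
  shows "\<exists>L\<in>S. \<forall>i<k + 3. (\<lambda>r. iter k r As ! i) \<longlonglongrightarrow> L"
proof -
  note inS = iter_nth_in_S[OF ok As]
  obtain C where C: "0 \<le> C"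
    "\<And>r i j. i < k + 3 \<Longrightarrow> j < k + 3 \<Longrightarrow> d (iter k r As ! i) (iter k r As ! j) \<le> C * \<rho> ^ r"
    using iter_diameter[OF ok As] by blast
  have len: "length (iter k r As) = k + 3" for r by (simp add: length_mean_step_iter As)
  have step: "norm (iter k (Suc r) As ! 0 - iter k r As ! 0) \<le> (K * C) * \<rho> ^ r" for r
  proof -
    let ?B = "iter k r As"
    have "d (mean k (drop_nth 0 ?B)) (mean k (replicate (k + 2) (?B ! 0))) \<le> C * \<rho> ^ r"
    proof (rule mean_okD(2)[OF ok])
      show "set (drop_nth 0 ?B) \<subseteq> S" by (rule subset_trans[OF set_drop_nth_subset iter_in_S[OF ok As]])
      show "set (replicate (k + 2) (?B ! 0)) \<subseteq> S" using inS[of 0 r] by (auto simp: set_replicate_conv_if)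
      fix i assume "i < k + 2"
      then show "d (drop_nth 0 ?B ! i) (replicate (k + 2) (?B ! 0) ! i) \<le> C * \<rho> ^ r"
        using C(2)[of "Suc i" 0 r] len[of r] by (simp add: nth_drop_nth del: replicate_Suc)
    qed (simp_all add: len length_drop_nth)
    then have "d (iter k (Suc r) As ! 0) (?B ! 0) \<le> C * \<rho> ^ r"
      using nth_mean_step_iter[of 0 As r base t k] mean_okD(4)[OF ok inS[of 0 r]] As by simp
    then have "K * d (iter k (Suc r) As ! 0) (?B ! 0) \<le> K * (C * \<rho> ^ r)" using K by simp
    then show ?thesis
      using norm_le_d[OF inS[of 0 "Suc r"] inS[of 0 r]] by (simp add: mult.assoc)
  qed
  have "convergent (\<lambda>r. iter k r As ! 0)"
    by (rule geometric_steps_convergent[OF \<rho>_bounds(1,2) _ step]) (use K C in simp)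
  then obtain L where L: "(\<lambda>r. iter k r As ! 0) \<longlonglongrightarrow> L" by (auto simp: convergent_def)
  show ?thesis
  proof (intro bexI[of _ L] allI impI)
    show "L \<in> S" by (rule op_interval_limit[OF _ L]) (simp add: inS)
    fix i assume i: "i < k + 3"
    have "(\<lambda>r. (K * C) * \<rho> ^ r) \<longlonglongrightarrow> (K * C) * 0"
      using \<rho>_bounds by (intro tendsto_intros LIMSEQ_realpow_zero)
    then have lim0: "(\<lambda>r. (K * C) * \<rho> ^ r) \<longlonglongrightarrow> 0" by simp
    have bd: "norm (iter k r As ! i - iter k r As ! 0) \<le> (K * C) * \<rho> ^ r" for r
    proof -
      have "K * d (iter k r As ! i) (iter k r As ! 0) \<le> K * (C * \<rho> ^ r)"
        using K C(2)[OF i, of 0 r] by simp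
      then show ?thesis using norm_le_d[OF inS[OF i, of r] inS[of 0 r]] by (simp add: mult.assoc)
    qed
    have "(\<lambda>r. iter k r As ! i - iter k r As ! 0) \<longlonglongrightarrow> 0"
      by (rule Lim_null_comparison[OF _ lim0]) (intro always_eventually allI bd)
    from tendsto_add[OF this L] show "(\<lambda>r. iter k r As ! i) \<longlonglongrightarrow> L" by simp
  qed
qed

text \<open>Identifies the norm limit with the operator described in \<open>llrec\<close>; entry 0
  alone decides uniqueness among all positive invertible candidates.\<close>

lemma mean_eq_limit:
  assumes ok: "mean_ok k" and As: "length As = k + 3" "set As \<subseteq> S"
    and L: "L \<in> S" "\<And>i. i < k + 3 \<Longrightarrow> (\<lambda>r. iter k r As ! i) \<longlonglongrightarrow> L"
  shows "mean (Suc k) As = L"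
  unfolding llrec_Suc
proof (rule the_equality)
  note inS = iter_nth_in_S[OF ok As]
  have pL: "posinv L" by (rule op_interval_posinv[OF L(1) m])
  show "posinv L \<and> (\<forall>i<length As. (\<lambda>r. thompson (iter k r As ! i) L) \<longlonglongrightarrow> 0)"
    using pL L(2) As(1) by (simp add: tendsto_thompson_iff[OF inS m pL])
  fix L' assume L': "posinv L' \<and> (\<forall>i<length As. (\<lambda>r. thompson (iter k r As ! i) L') \<longlonglongrightarrow> 0)"
  then have "(\<lambda>r. thompson (iter k r As ! 0) L') \<longlonglongrightarrow> 0" "posinv L'" using As(1) by auto
  then have "(\<lambda>r. iter k r As ! 0) \<longlonglongrightarrow> L'"
    using tendsto_thompson_iff[OF inS[of 0] m] by simp
  from LIMSEQ_unique[OF this L(2)] show "L' = L" by simp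
qed

lemma mean_limit_aux:
  assumes ok: "mean_ok k" and As: "length As = k + 3" "set As \<subseteq> S"
  shows "mean (Suc k) As \<in> S" "i < k + 3 \<Longrightarrow> (\<lambda>r. iter k r As ! i) \<longlonglongrightarrow> mean (Suc k) As"
proof -
  obtain L where L: "L \<in> S" "\<And>i. i < k + 3 \<Longrightarrow> (\<lambda>r. iter k r As ! i) \<longlonglongrightarrow> L"
    using iter_converges[OF ok As] by blast
  have "mean (Suc k) As = L" by (rule mean_eq_limit[OF ok As L])
  then show "mean (Suc k) As \<in> S" "i < k + 3 \<Longrightarrow> (\<lambda>r. iter k r As ! i) \<longlonglongrightarrow> mean (Suc k) As"
    using L by simp_all
qed

text \<open>The starting index is free: r0 = 0 serves the nonexpansive bound and r0 = 1 the
  contraction, which becomes visible only after one step.\<close>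

lemma iter_nonexpansive:
  assumes ok: "mean_ok k" and As: "length As = k + 3" "set As \<subseteq> S" and Bs: "length Bs = k + 3" "set Bs \<subseteq> S"
    and r0: "\<And>i. i < k + 3 \<Longrightarrow> d (iter k r0 As ! i) (iter k r0 Bs ! i) \<le> \<delta>"
  shows "r0 \<le> r \<Longrightarrow> i < k + 3 \<Longrightarrow> d (iter k r As ! i) (iter k r Bs ! i) \<le> \<delta>"
proof (induction r arbitrary: i rule: dec_induct)
  case base
  then show ?case by (rule r0)
next
  case (step r)
  have len: "length (iter k r As) = k + 3" "length (iter k r Bs) = k + 3"
    by (simp_all add: length_mean_step_iter As Bs)
  have "d (mean k (drop_nth i (iter k r As))) (mean k (drop_nth i (iter k r Bs))) \<le> \<delta>"
  proof (rule mean_okD(2)[OF ok])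
    show "set (drop_nth i (iter k r As)) \<subseteq> S" "set (drop_nth i (iter k r Bs)) \<subseteq> S"
      by (rule subset_trans[OF set_drop_nth_subset iter_in_S[OF ok As]],
          rule subset_trans[OF set_drop_nth_subset iter_in_S[OF ok Bs]])
    fix j assume "j < k + 2"
    then show "d (drop_nth i (iter k r As) ! j) (drop_nth i (iter k r Bs) ! j) \<le> \<delta>"
      using step.IH[of j] step.IH[of "Suc j"] step.prems len by (simp add: nth_drop_nth)
  qed (use len step.prems in \<open>simp_all add: length_drop_nth\<close>)
  then show ?case
    using nth_mean_step_iter[of i As r base t k] nth_mean_step_iter[of i Bs r base t k] step.prems As Bs
    by simp
qed

lemma mean_d_le:
  assumes ok: "mean_ok k" and As: "length As = k + 3" "set As \<subseteq> S" and Bs: "length Bs = k + 3" "set Bs \<subseteq> S"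
    and r0: "\<And>i. i < k + 3 \<Longrightarrow> d (iter k r0 As ! i) (iter k r0 Bs ! i) \<le> \<delta>"
  shows "d (mean (Suc k) As) (mean (Suc k) Bs) \<le> \<delta>"
proof (rule d_limit_le[OF _ mean_limit_aux(2)[OF ok As, of 0] _ mean_limit_aux(2)[OF ok Bs, of 0]])
  show "d (iter k r As ! 0) (iter k r Bs ! 0) \<le> \<delta>" if "r \<ge> r0" for r
    by (rule iter_nonexpansive[OF ok As Bs r0 that]) simp_all
qed (simp_all add: iter_nth_in_S[OF ok As] iter_nth_in_S[OF ok Bs])

lemma mean_step_replicate:
  assumes ok: "mean_ok k" and A: "A \<in> S"
  shows "mean_step base t k (replicate (k + 3) A) = replicate (k + 3) A"
proof (rule nth_equalityI)
  fix i assume "i < length (mean_step base t k (replicate (k + 3) A))"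
  then have i: "i < k + 3" by (simp add: mean_step_def)
  have "drop_nth i (replicate (k + 3) A) = replicate (k + 2) A"
    using drop_nth_replicate[of i "k + 2" A] i by (simp add: numeral_eq_Suc)
  then show "mean_step base t k (replicate (k + 3) A) ! i = replicate (k + 3) A ! i"
    using i mean_okD(4)[OF ok A] by (simp add: mean_step_def del: upt_Suc replicate_Suc)
qed (simp add: mean_step_def)

text \<open>For lists differing only at j, the first iterates agree at entry j, where both omit the
  changed operator; at any other entry they are means of shorter lists with a single change, hence
  within \<rho> times the original distance. Nonexpansiveness from iterate 1 on keeps this bound in
  the limit.\<close>

lemma mean_ok: "mean_ok k"
proof (induction k)
  case 0
  have len2: "set As \<subseteq> S \<Longrightarrow> length As = 2 \<Longrightarrow> As ! 0 \<in> S \<and> As ! 1 \<in> S" for As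
    using nth_mem[of 0 As] nth_mem[of 1 As] by auto
  show ?case
    unfolding mean_ok_def
  proof (intro conjI allI impI ballI)
    fix As :: "'a op list" assume "length As = 0 + 2" "set As \<subseteq> S"
    then show "mean 0 As \<in> S" using len2[of As] base_in by simp
  next
    fix As Bs :: "'a op list" and \<delta>
    assume "length As = 0 + 2" "length Bs = 0 + 2" "set As \<subseteq> S" "set Bs \<subseteq> S"
      and \<delta>: "\<forall>i<0 + 2. d (As ! i) (Bs ! i) \<le> \<delta>"
    then have mem: "As ! 0 \<in> S" "As ! 1 \<in> S" "Bs ! 0 \<in> S" "Bs ! 1 \<in> S"
      using len2[of As] len2[of Bs] by simp_all
    have "(1 - t) * d (As ! 0) (Bs ! 0) + t * d (As ! 1) (Bs ! 1) \<le> (1 - t) * \<delta> + t * \<delta>"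
      using \<delta> t by (intro add_mono mult_left_mono) simp_all
    also have "\<dots> = \<delta>" by (simp add: algebra_simps)
    finally show "d (mean 0 As) (mean 0 Bs) \<le> \<delta>"
      using base_d[OF mem] by simp
  next
    fix As Bs :: "'a op list" and j :: nat
    assume "length As = 0 + 2" "length Bs = 0 + 2" "set As \<subseteq> S" "set Bs \<subseteq> S" and j: "j < 0 + 2"
      and eq: "\<forall>i<0 + 2. i \<noteq> j \<longrightarrow> As ! i = Bs ! i"
    then have mem: "As ! 0 \<in> S" "As ! 1 \<in> S" "Bs ! 0 \<in> S" "Bs ! 1 \<in> S"
      using len2[of As] len2[of Bs] by simp_all
    have nn: "0 \<le> d (As ! 0) (Bs ! 0)" "0 \<le> d (As ! 1) (Bs ! 1)" using mem by (auto intro: d_nonneg)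
    have w: "(1 - t) * d (As ! 0) (Bs ! 0) \<le> \<rho> * d (As ! 0) (Bs ! 0)"
      "t * d (As ! 1) (Bs ! 1) \<le> \<rho> * d (As ! 1) (Bs ! 1)"
      using \<rho>_bounds nn by (auto intro: mult_right_mono)
    consider "j = 0" | "j = 1" using j by linarith
    then have "(1 - t) * d (As ! 0) (Bs ! 0) + t * d (As ! 1) (Bs ! 1) \<le> \<rho> * d (As ! j) (Bs ! j)"
    proof cases
      case 1
      then have "As ! 1 = Bs ! 1" using eq by simp
      then show ?thesis using w(1) 1 mem by (simp add: d_refl)
    next
      case 2
      then have "As ! 0 = Bs ! 0" using eq by simp
      then show ?thesis using w(2) 2 mem by (simp add: d_refl)
    qed
    then show "d (mean 0 As) (mean 0 Bs) \<le> \<rho> * d (As ! j) (Bs ! j)"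
      using base_d[OF mem] by simp
  next
    fix A assume "A \<in> S"
    then show "mean 0 (replicate (0 + 2) A) = A" by (simp add: base_same numeral_2_eq_2)
  qed
next
  case (Suc k)
  note ok = Suc
  have n: "Suc k + 2 = k + 3" by simp
  show ?case
    unfolding mean_ok_def n
  proof (intro conjI allI impI ballI)
    fix As :: "'a op list" assume "length As = k + 3" "set As \<subseteq> S"
    then show "mean (Suc k) As \<in> S" by (rule mean_limit_aux(1)[OF ok])
  next
    fix As Bs :: "'a op list" and \<delta>
    assume "length As = k + 3" "length Bs = k + 3" "set As \<subseteq> S" "set Bs \<subseteq> S"
      and "\<forall>i<k + 3. d (As ! i) (Bs ! i) \<le> \<delta>"
    then show "d (mean (Suc k) As) (mean (Suc k) Bs) \<le> \<delta>"
      by (intro mean_d_le[OF ok, where ?r0.0 = 0]) simp_all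
  next
    fix As Bs :: "'a op list" and j
    assume As: "length As = k + 3" and Bs: "length Bs = k + 3"
      and S: "set As \<subseteq> S" "set Bs \<subseteq> S" and j: "j < k + 3"
      and eq: "\<forall>i<k + 3. i \<noteq> j \<longrightarrow> As ! i = Bs ! i"
    have mem: "As ! i \<in> S" "Bs ! i \<in> S" if "i < k + 3" for i
      using that S nth_mem[of i As] nth_mem[of i Bs] by (auto simp: As Bs)
    have dj: "0 \<le> \<rho> * d (As ! j) (Bs ! j)" using \<rho>_bounds(1) d_nonneg[OF mem[OF j]] by simp
    show "d (mean (Suc k) As) (mean (Suc k) Bs) \<le> \<rho> * d (As ! j) (Bs ! j)"
    proof (rule mean_d_le[OF ok As S(1) Bs S(2), where ?r0.0 = 1])
      fix i assume i: "i < k + 3"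
      have nth: "iter k 1 As ! i = mean k (drop_nth i As)" "iter k 1 Bs ! i = mean k (drop_nth i Bs)"
        using nth_mean_step_iter[of i As 0 base t k] nth_mean_step_iter[of i Bs 0 base t k] i As Bs by simp_all
      have sub: "set (drop_nth i As) \<subseteq> S" "set (drop_nth i Bs) \<subseteq> S"
        by (rule subset_trans[OF set_drop_nth_subset S(1)], rule subset_trans[OF set_drop_nth_subset S(2)])
      have len: "length (drop_nth i As) = k + 2" "length (drop_nth i Bs) = k + 2"
        using i As Bs by (simp_all add: length_drop_nth)
      show "d (iter k 1 As ! i) (iter k 1 Bs ! i) \<le> \<rho> * d (As ! j) (Bs ! j)"
      proof (cases "i = j")
        case True
        have "drop_nth i As = drop_nth i Bs"
        proof (rule nth_equalityI)
          fix l assume "l < length (drop_nth i As)"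
          then show "drop_nth i As ! l = drop_nth i Bs ! l"
            using i As Bs eq True len by (simp add: nth_drop_nth)
        qed (simp add: len)
        moreover have "mean k (drop_nth i Bs) \<in> S" by (rule mean_okD(1)[OF ok len(2) sub(2)])
        ultimately show ?thesis using dj unfolding nth by (simp add: d_refl)
      next
        case False
        \<comment> \<open>The position of the changed operator once entry i is left out: indices
          beyond i move down by one.\<close>
        define l where "l = (if j < i then j else j - 1)"
        have l: "l < k + 2" "drop_nth i As ! l = As ! j" "drop_nth i Bs ! l = Bs ! j"
          using False i j As Bs by (auto simp: l_def nth_drop_nth)
        have "d (mean k (drop_nth i As)) (mean k (drop_nth i Bs))
            \<le> \<rho> * d (drop_nth i As ! l) (drop_nth i Bs ! l)"
        proof (rule mean_okD(3)[OF ok len sub l(1)])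
          fix q assume q: "q < k + 2" "q \<noteq> l"
          have "q \<noteq> j" if "q < i" using q that by (auto simp: l_def split: if_splits)
          moreover have "Suc q \<noteq> j" if "\<not> q < i" using q that by (auto simp: l_def split: if_splits)
          ultimately show "drop_nth i As ! q = drop_nth i Bs ! q"
            using q i As Bs eq by (simp add: nth_drop_nth)
        qed
        then show ?thesis unfolding nth l .
      qed
    qed
  next
    fix A assume A: "A \<in> S"
    have it: "iter k r (replicate (k + 3) A) = replicate (k + 3) A" for r
      by (induction r) (simp_all add: mean_step_replicate[OF ok A] del: replicate_Suc)
    show "mean (Suc k) (replicate (k + 3) A) = A"
      by (rule mean_eq_limit[OF ok _ _ A]) (use A in \<open>simp_all add: it\<close>)
  qed
qed

lemma mean_in_interval: "length As = k + 2 \<Longrightarrow> set As \<subseteq> S \<Longrightarrow> mean k As \<in> S"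
  by (rule mean_okD(1)[OF mean_ok])

lemma mean_limit:
  assumes "length As = k + 3" "set As \<subseteq> S" "i < k + 3"
  shows "(\<lambda>r. iter k r As ! i) \<longlonglongrightarrow> mean (Suc k) As"
  by (rule mean_limit_aux(2)[OF mean_ok assms])

lemmas iter_subset = iter_in_S[OF mean_ok]

end

subsection \<open>The Kantorovich-type inequality\<close>

lemma scaleR_convex_same: "(1 - t) *\<^sub>R X + t *\<^sub>R X = X" for X :: "'b::real_vector"
  by (simp add: scaleR_add_left[symmetric])

lemma op_interval_convex:
  assumes A: "A \<in> op_interval m M" and B: "B \<in> op_interval m M" and t: "0 \<le> t" "t \<le> 1"
  shows "(1 - t) *\<^sub>R A + t *\<^sub>R B \<in> op_interval m M"
proof -
  have comb: "loewner ((1 - t) *\<^sub>R X + t *\<^sub>R Y) ((1 - t) *\<^sub>R X' + t *\<^sub>R Y')"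
    if "loewner X X'" "loewner Y Y'" for X X' Y Y' :: "'a op"
    using that t by (intro loewner_add loewner_scaleR) simp_all
  show ?thesis
    using comb[of "m *\<^sub>R id_blinfun" A "m *\<^sub>R id_blinfun" B]
      comb[of A "M *\<^sub>R id_blinfun" B "M *\<^sub>R id_blinfun"] A B
    unfolding scaleR_convex_same by (simp add: op_interval_def)
qed

lemma interval_mean_wam2:
  assumes "0 < m" "0 < t" "t < 1"
  shows "interval_mean m M t 1 wam2 (\<lambda>A B. norm (A - B))"
proof
  fix A B C A' B' :: "'a op"
  show "wam2 t A B \<in> op_interval m M" if "A \<in> op_interval m M" "B \<in> op_interval m M"
    unfolding wam2_def using that assms by (intro op_interval_convex) simp_all
  show "wam2 t A A = A" by (simp add: wam2_def scaleR_convex_same)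
  show "norm (A - B) = norm (B - A)" by (rule norm_minus_commute)
  show "norm (A - C) \<le> norm (A - B) + norm (B - C)"
    using norm_triangle_ineq[of "A - B" "B - C"] by simp
  have "wam2 t A B - wam2 t A' B' = (1 - t) *\<^sub>R (A - A') + t *\<^sub>R (B - B')"
    by (simp add: wam2_def algebra_simps)
  then show "norm (wam2 t A B - wam2 t A' B') \<le> (1 - t) * norm (A - A') + t * norm (B - B')"
    using norm_triangle_ineq[of "(1 - t) *\<^sub>R (A - A')" "t *\<^sub>R (B - B')"] assms by simp
qed (use assms in simp_all)

lemma opow_minus_one_interval:
  assumes A: "A \<in> op_interval m M" and m: "0 < m" "m \<le> M"
  shows "opow A (-1) \<in> op_interval (1 / M) (1 / m)"
  unfolding opow_def
  by (rule cfun_in_op_interval[OF A m(2) continuous_on_powr_Icc[OF m(1)]])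
    (use m in \<open>auto simp: powr_minus field_simps\<close>)

text \<open>At y = X^(1/2) x the form of X^(-1) is the squared norm of x, while the squared norm of
  y is the form of X at x; this reverses the inequality.\<close>

lemma loewner_of_inverse:
  assumes X: "posinv X" and c: "0 < c" and le: "loewner (opow X (-1)) (c *\<^sub>R id_blinfun)"
  shows "loewner ((1 / c) *\<^sub>R id_blinfun) X"
proof (rule loewnerI)
  fix x
  let ?y = "opow X (1/2) x"
  have "opow X (-1) ?y \<bullet> ?y = x \<bullet> x"
    by (simp add: self_adjointD[OF self_adjoint_opow[OF X], symmetric] opow_add_apply[OF X] opow_0[OF X])
  moreover have "opow X (-1) ?y \<bullet> ?y \<le> c * (norm ?y)\<^sup>2"
    using loewnerD[OF le, of ?y] by (simp add: blinfun.bilinear_simps dot_square_norm)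
  moreover have "(norm ?y)\<^sup>2 = X x \<bullet> x" using norm_opow_half[OF X, of 1 x] by (simp add: opow_1[OF X])
  ultimately show "((1 / c) *\<^sub>R id_blinfun) x \<bullet> x \<le> X x \<bullet> x"
    using c by (simp add: blinfun.bilinear_simps field_simps)
qed (use X in \<open>simp_all add: posinv_self_adjoint\<close>)

text \<open>The upper bound M comes from the arithmetic mean, the lower bound m from the
  corresponding estimate for the inverses.\<close>

lemma sharp_in_op_interval:
  assumes A: "A \<in> op_interval m M" and B: "B \<in> op_interval m M" and m: "0 < m" "m \<le> M"
    and t: "0 \<le> t" "t \<le> 1"
  shows "sharp t A B \<in> op_interval m M"
proof -
  note p = op_interval_posinv[OF A m(1)] op_interval_posinv[OF B m(1)]
  have "loewner (sharp t A B) (M *\<^sub>R id_blinfun)"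
    by (rule loewner_trans[OF sharp_le_arithmetic[OF p t]])
      (use op_interval_convex[OF A B t] in \<open>simp add: op_interval_def\<close>)
  moreover have "loewner (opow (sharp t A B) (-1)) ((1 / m) *\<^sub>R id_blinfun)"
    by (rule loewner_trans[OF sharp_inverse_le[OF p t]])
      (use op_interval_convex[OF opow_minus_one_interval[OF A m] opow_minus_one_interval[OF B m] t]
        in \<open>simp add: op_interval_def\<close>)
  then have "loewner (m *\<^sub>R id_blinfun) (sharp t A B)"
    using loewner_of_inverse[OF posinv_sharp[OF p], of "1 / m"] m by simp
  ultimately show ?thesis by (simp add: op_interval_def)
qed

text \<open>The arguments are replaced one at a time: the right one by monotonicity and homogeneity
  of degree t, the left one in the same way after \<open>sharp_flip\<close>, with degree 1 -
  t.\<close>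

lemma sharp_le_exp:
  assumes A: "posinv A" and B: "posinv B" and A': "posinv A'" and B': "posinv B'"
    and a: "loewner A (exp a *\<^sub>R A')" and b: "loewner B (exp b *\<^sub>R B')" and t: "0 \<le> t" "t \<le> 1"
  shows "loewner (sharp t A B) (exp ((1 - t) * a + t * b) *\<^sub>R sharp t A' B')"
proof -
  have "loewner (sharp t A B) (sharp t A (exp b *\<^sub>R B'))"
    by (intro sharp_mono_right A B posinv_scaleR B' b t) simp
  then have 1: "loewner (sharp t A B) (exp (t * b) *\<^sub>R sharp t A B')"
    by (simp add: sharp_scaleR_right[OF A B'] exp_powr_real mult.commute)
  have "loewner (sharp (1 - t) B' A) (sharp (1 - t) B' (exp a *\<^sub>R A'))"
    using t by (intro sharp_mono_right A B' posinv_scaleR A' a) simp_all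
  then have "loewner (sharp t A B') (exp ((1 - t) * a) *\<^sub>R sharp t A' B')"
    by (simp add: sharp_scaleR_right[OF B' A'] exp_powr_real mult.commute sharp_flip[OF A B']
        sharp_flip[OF A' B'])
  from loewner_scaleR[OF this, of "exp (t * b)"]
  have "loewner (exp (t * b) *\<^sub>R sharp t A B') (exp ((1 - t) * a + t * b) *\<^sub>R sharp t A' B')"
    by (simp add: exp_add mult.commute)
  then show ?thesis by (rule loewner_trans[OF 1])
qed

lemma thompson_sharp_le:
  assumes A: "posinv A" and B: "posinv B" and A': "posinv A'" and B': "posinv B'" and t: "0 \<le> t" "t \<le> 1"
  shows "thompson (sharp t A B) (sharp t A' B') \<le> (1 - t) * thompson A A' + t * thompson B B'"
proof (rule thompson_leI)
  show "0 \<le> (1 - t) * thompson A A' + t * thompson B B'"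
    using t thompson_nonneg[OF A A'] thompson_nonneg[OF B B'] by simp
  show "loewner (sharp t A B) (exp ((1 - t) * thompson A A' + t * thompson B B') *\<^sub>R sharp t A' B')"
    by (intro sharp_le_exp loewner_thompson A B A' B' t)
  have "loewner (sharp t A' B') (exp ((1 - t) * thompson A' A + t * thompson B' B) *\<^sub>R sharp t A B)"
    by (intro sharp_le_exp loewner_thompson A B A' B' t)
  then show "loewner (sharp t A' B') (exp ((1 - t) * thompson A A' + t * thompson B B') *\<^sub>R sharp t A B)"
    unfolding thompson_sym[of A' A] thompson_sym[of B' B] .
qed (intro posinv_sharp A B A' B')+

text \<open>The locale asks for one constant in both directions: M^2/m bounds the norm by the
  Thompson metric, and 1/m bounds the Thompson metric by the norm.\<close>

lemma interval_mean_sharp: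
  assumes m: "0 < m" "m \<le> M" and t: "0 < t" "t < 1"
  shows "interval_mean m M t (max (M\<^sup>2 / m) (1 / m)) sharp thompson"
proof
  fix A B C A' B' :: "'a op"
  note pos = op_interval_posinv[OF _ m(1)]
  show "0 < max (M\<^sup>2 / m) (1 / m)" using m by (simp add: less_max_iff_disj)
  show "thompson A B = thompson B A" by (rule thompson_sym)
  assume A: "A \<in> op_interval m M"
  show "sharp t A A = A" by (rule sharp_same[OF pos[OF A]])
  assume B: "B \<in> op_interval m M"
  show "sharp t A B \<in> op_interval m M" using t by (intro sharp_in_op_interval A B m) simp_all
  have nn: "0 \<le> thompson A B" by (rule thompson_nonneg[OF pos[OF A] pos[OF B]])
  show "norm (A - B) \<le> max (M\<^sup>2 / m) (1 / m) * thompson A B"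
    by (rule order_trans[OF norm_le_thompson[OF A B m]]) (intro mult_right_mono nn max.cobounded1)
  have "thompson A B \<le> (1 / m) * norm (A - B)" using thompson_le_norm[OF A B m(1)] by simp
  also have "\<dots> \<le> max (M\<^sup>2 / m) (1 / m) * norm (A - B)" by (intro mult_right_mono) simp_all
  finally show "thompson A B \<le> max (M\<^sup>2 / m) (1 / m) * norm (A - B)" .
  show "thompson A C \<le> thompson A B + thompson B C" if "C \<in> op_interval m M"
    by (rule thompson_triangle[OF pos[OF A] pos[OF B] pos[OF that]])
  show "thompson (sharp t A B) (sharp t A' B') \<le> (1 - t) * thompson A A' + t * thompson B B'"
    if "A' \<in> op_interval m M" "B' \<in> op_interval m M"
    by (rule thompson_sharp_le[OF pos[OF A] pos[OF B] pos[OF that(1)] pos[OF that(2)]]) (use t in simp_all)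
qed (use m t in simp_all)

text \<open>The resolvent identity A^(-1) - L^(-1) = A^(-1) (L - A) L^(-1), with both inverses of
  norm at most 1/m.\<close>

lemma tendsto_opow_minus_one:
  assumes A: "\<And>r. A r \<in> op_interval m M" and m: "0 < m" "m \<le> M" and L: "A \<longlonglongrightarrow> L"
  shows "(\<lambda>r. opow (A r) (-1)) \<longlonglongrightarrow> opow L (-1)"
proof -
  have LS: "L \<in> op_interval m M" by (rule op_interval_limit[OF A L])
  note pA = op_interval_posinv[OF A m(1)] and pL = op_interval_posinv[OF LS m(1)]
  have bd: "norm (opow B (-1)) \<le> 1 / m" if "B \<in> op_interval m M" for B :: "'a op"
    unfolding opow_def
    by (rule norm_cfun_le[OF that m(2) continuous_on_powr_Icc[OF m(1)]])
      (use m in \<open>auto simp: powr_minus field_simps\<close>)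
  have diff: "opow (A r) (-1) - opow L (-1) = opow (A r) (-1) o\<^sub>L (L - A r) o\<^sub>L opow L (-1)" for r
    by (rule blinfun_eqI)
      (simp add: blinfun.bilinear_simps opow_minus_one_simps[OF pA] opow_minus_one_simps[OF pL])
  have "norm (opow (A r) (-1) - opow L (-1)) \<le> (1 / m) * norm (L - A r) * (1 / m)" for r
  proof -
    have "norm (opow (A r) (-1) - opow L (-1))
        \<le> norm (opow (A r) (-1) o\<^sub>L (L - A r)) * norm (opow L (-1))"
      unfolding diff by (rule norm_blinfun_compose)
    also have "\<dots> \<le> (norm (opow (A r) (-1)) * norm (L - A r)) * norm (opow L (-1))"
      by (intro mult_right_mono norm_blinfun_compose) simp
    also have "\<dots> \<le> ((1 / m) * norm (L - A r)) * (1 / m)"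
      using m by (intro mult_mono bd A LS mult_nonneg_nonneg) simp_all
    finally show ?thesis .
  qed
  note le = this
  have "(\<lambda>r. (1 / m) * norm (L - A r) * (1 / m)) \<longlonglongrightarrow> (1 / m) * norm (L - L) * (1 / m)"
    by (intro tendsto_intros L)
  then have "(\<lambda>r. (1 / m) * norm (L - A r) * (1 / m)) \<longlonglongrightarrow> 0" by simp
  then have "(\<lambda>r. opow (A r) (-1) - opow L (-1)) \<longlonglongrightarrow> 0"
    by (rule Lim_null_comparison[rotated]) (intro always_eventually allI le)
  then show ?thesis by (simp add: Lim_null[symmetric])
qed

text \<open>A relation between two operators because the recursions are followed in parallel: X runs
  through arithmetic iterates and A through geometric ones.\<close>

definition kantorovich :: "real \<Rightarrow> real \<Rightarrow> 'a::{real_inner,complete_space} op \<Rightarrow> 'a op \<Rightarrow> bool" where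
  "kantorovich m M X A \<longleftrightarrow> loewner (X + (m * M) *\<^sub>R opow A (-1)) ((m + M) *\<^sub>R id_blinfun)"

lemma kantorovich_same:
  assumes A: "A \<in> op_interval m M" and m: "0 < m" "m \<le> M"
  shows "kantorovich m M A A"
proof -
  note c = continuous_on_powr_Icc[OF m(1)]
  have "loewner (cfun (\<lambda>x. x + (m * M) * x powr (-1)) A) (cfun (\<lambda>x. m + M) A)"
  proof (rule cfun_mono[OF A m(2)])
    fix x assume x: "x \<in> {m..M}"
    then have "x > 0" using m by simp
    have "(x - m) * (x - M) \<le> 0" using x by (simp add: mult_nonneg_nonpos)
    then have "x * x + m * M \<le> (m + M) * x" by (simp add: algebra_simps)
    then show "x + (m * M) * x powr (-1) \<le> m + M"
      using \<open>x > 0\<close> by (simp add: powr_minus field_simps)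
  qed (intro continuous_intros c continuous_on_mult_left | simp)+
  also have "cfun (\<lambda>x. x + (m * M) * x powr (-1)) A = A + (m * M) *\<^sub>R opow A (-1)"
    using cfun_add[OF A continuous_on_id continuous_on_mult_left[OF c], of "m * M" "-1"]
      cfun_mult_left[OF A c, of "m * M" "-1"]
    by (simp add: cfun_ident[OF A] opow_def)
  finally show ?thesis by (simp add: kantorovich_def cfun_const[OF A])
qed

lemma kantorovich_mean2:
  assumes A: "posinv A" and B: "posinv B" and "kantorovich m M X A" "kantorovich m M Y B"
    and t: "0 \<le> t" "t \<le> 1" and mM: "0 \<le> m * M"
  shows "kantorovich m M (wam2 t X Y) (sharp t A B)"
proof -
  let ?c = "(m + M) *\<^sub>R id_blinfun :: 'a op"
  have "loewner (wam2 t X Y + (m * M) *\<^sub>R opow (sharp t A B) (-1))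
      (wam2 t X Y + (m * M) *\<^sub>R ((1 - t) *\<^sub>R opow A (-1) + t *\<^sub>R opow B (-1)))"
    by (intro loewner_add loewner_refl loewner_scaleR sharp_inverse_le A B t mM)
  also have "wam2 t X Y + (m * M) *\<^sub>R ((1 - t) *\<^sub>R opow A (-1) + t *\<^sub>R opow B (-1))
      = (1 - t) *\<^sub>R (X + (m * M) *\<^sub>R opow A (-1)) + t *\<^sub>R (Y + (m * M) *\<^sub>R opow B (-1))"
    by (simp add: wam2_def scaleR_add_right mult.commute)
  finally have 1: "loewner (wam2 t X Y + (m * M) *\<^sub>R opow (sharp t A B) (-1)) \<dots>" .
  have "loewner \<dots> ((1 - t) *\<^sub>R ?c + t *\<^sub>R ?c)"
    using assms by (intro loewner_add loewner_scaleR) (simp_all add: kantorovich_def)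
  moreover have "(1 - t) *\<^sub>R ?c + t *\<^sub>R ?c = ?c" by (rule scaleR_convex_same)
  ultimately show ?thesis using loewner_trans[OF 1] by (simp add: kantorovich_def)
qed

lemma kantorovich_limit:
  assumes "\<And>r. kantorovich m M (X r) (A r)" "\<And>r. A r \<in> op_interval m M" "0 < m" "m \<le> M"
    and "X \<longlonglongrightarrow> L" "A \<longlonglongrightarrow> G"
  shows "kantorovich m M L G"
  unfolding kantorovich_def
  by (rule loewner_limit[OF assms(1)[unfolded kantorovich_def]
        tendsto_add[OF assms(5) tendsto_scaleR[OF tendsto_const tendsto_opow_minus_one[OF assms(2-4,6)]]]
        tendsto_const])

text \<open>Two lists related entry by entry are needed for the induction: even if both recursions
  start from one list, their iterates may differ after a single step.\<close>

lemma kantorovich_llrec: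
  assumes m: "0 < m" "m \<le> M" and t: "0 < t" "t < 1"
    and "length Xs = k + 2" "length As = k + 2" "set Xs \<subseteq> op_interval m M" "set As \<subseteq> op_interval m M"
    and "\<And>i. i < k + 2 \<Longrightarrow> kantorovich m M (Xs ! i) (As ! i)"
  shows "kantorovich m M (llrec wam2 t k Xs) (llrec sharp t k As)"
  using assms(5-)
proof (induction k arbitrary: Xs As)
  case 0
  have "As ! 0 \<in> set As" "As ! 1 \<in> set As" using 0 by simp_all
  then have "posinv (As ! 0)" "posinv (As ! 1)" 
    using op_interval_posinv[OF subsetD[OF 0(4)] m(1)] by simp_all
  then show ?case
    using 0(5)[of 0] 0(5)[of 1] m t by (simp add: kantorovich_mean2)
next
  case (Suc k)
  note IH = Suc.IH
  interpret am: interval_mean m M t 1 wam2 "\<lambda>A B :: 'a op. norm (A - B)"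
    by (rule interval_mean_wam2[OF m(1) t])
  interpret gm: interval_mean m M t "max (M\<^sup>2 / m) (1 / m)" sharp thompson
    by (rule interval_mean_sharp[OF m t])
  have lX: "length Xs = k + 3" and lA: "length As = k + 3" using Suc.prems by simp_all
  note sX = am.iter_subset[OF lX Suc.prems(3)] and sA = gm.iter_subset[OF lA Suc.prems(4)]
  have len: "length (am.iter k r Xs) = k + 3" "length (gm.iter k r As) = k + 3" for r
    by (simp_all add: length_mean_step_iter lX lA)
  \<comment> \<open>An inner induction along the iterates; each step uses the outer hypothesis on
    the lists with entry i left out.\<close>
  have iter: "kantorovich m M (am.iter k r Xs ! i) (gm.iter k r As ! i)" if "i < k + 3" for r i
    using that
  proof (induction r arbitrary: i)
    case 0
    then show ?case using Suc.prems(5)[of i] by simp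
  next
    case (Suc r)
    have "kantorovich m M (llrec wam2 t k (drop_nth i (am.iter k r Xs)))
        (llrec sharp t k (drop_nth i (gm.iter k r As)))"
    proof (rule IH)
      show "set (drop_nth i (am.iter k r Xs)) \<subseteq> op_interval m M"
        by (rule subset_trans[OF set_drop_nth_subset sX])
      show "set (drop_nth i (gm.iter k r As)) \<subseteq> op_interval m M"
        by (rule subset_trans[OF set_drop_nth_subset sA])
      fix j assume "j < k + 2"
      then show "kantorovich m M (drop_nth i (am.iter k r Xs) ! j) (drop_nth i (gm.iter k r As) ! j)"
        using Suc.IH[of j] Suc.IH[of "Suc j"] Suc.prems len by (simp add: nth_drop_nth)
    qed (use Suc.prems len in \<open>simp_all add: length_drop_nth\<close>)
    then show ?case
      using Suc.prems by (simp only: nth_mean_step_iter lX lA)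
  qed
  show ?case
  proof (rule kantorovich_limit[OF iter _ m])
    show "(\<lambda>r. am.iter k r Xs ! 0) \<longlonglongrightarrow> llrec wam2 t (Suc k) Xs"
      by (rule am.mean_limit[OF lX Suc.prems(3)]) simp
    show "(\<lambda>r. gm.iter k r As ! 0) \<longlonglongrightarrow> llrec sharp t (Suc k) As"
      by (rule gm.mean_limit[OF lA Suc.prems(4)]) simp
    show "gm.iter k r As ! 0 \<in> op_interval m M" for r
      using sA[of r] nth_mem[of 0 "gm.iter k r As"] len(2)[of r] by auto
  qed simp
qed

text \<open>Bhatia--Kittaneh: the rank-one minorants of \<open>Q\<close> at \<open>x\<close> and of \<open>P\<close> at \<open>y\<close>, tested on the
  bisector of \<open>Q x\<close> and \<open>P y\<close>, reduce the claim to two unit vectors with cosine \<open>k\<close>.\<close>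

lemma positive_op_inner_le:
  assumes P: "positive_op P" and Q: "positive_op Q" and le: "loewner (P + Q) (c *\<^sub>R id_blinfun)"
  shows "Q x \<bullet> P y \<le> c\<^sup>2 / 4 * (norm x * norm y)"
proof (cases "Q x \<bullet> P y \<le> 0")
  case True
  moreover have "0 \<le> c\<^sup>2 / 4 * (norm x * norm y)" by simp
  ultimately show ?thesis by linarith
next
  case False
  define a b where "a = Q x \<bullet> x" and "b = P y \<bullet> y"
  define \<mu> \<nu> where "\<mu> = norm (Q x)" and "\<nu> = norm (P y)"
  have uv: "\<mu> > 0" "\<nu> > 0" using False by (auto simp: \<mu>_def \<nu>_def)
  define k where "k = (Q x \<bullet> P y) / (\<mu> * \<nu>)"
  have k: "0 < k" "Q x \<bullet> P y = \<mu> * \<nu> * k" using False uv by (simp_all add: k_def)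
  have "\<mu>\<^sup>2 \<le> norm Q * a" "\<nu>\<^sup>2 \<le> norm P * b"
    unfolding \<mu>_def \<nu>_def a_def b_def by (intro norm_positive_op_apply P Q)+
  moreover have "0 \<le> a" "0 \<le> b" using P Q by (simp_all add: a_def b_def positive_op_def)
  ultimately have ab: "a > 0" "b > 0" using uv by (auto simp: order.strict_iff_order)
  have nx: "a \<le> \<mu> * norm x" "b \<le> \<nu> * norm y"
    unfolding \<mu>_def \<nu>_def a_def b_def by (rule norm_cauchy_schwarz)+
  define w where "w = (1 / \<mu>) *\<^sub>R Q x + (1 / \<nu>) *\<^sub>R P y"
  have Qw: "Q x \<bullet> w = \<mu> * (1 + k)"
    using uv k by (simp add: w_def inner_simps dot_square_norm \<mu>_def[symmetric] field_simps power2_eq_square)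
  have Pw: "P y \<bullet> w = \<nu> * (1 + k)"
    using uv k by (simp add: w_def inner_simps dot_square_norm \<nu>_def[symmetric] inner_commute[of "P y" "Q x"]
        field_simps power2_eq_square)
  have "(norm w)\<^sup>2 = (1 / \<mu>) * (Q x \<bullet> w) + (1 / \<nu>) * (P y \<bullet> w)"
    by (simp add: power2_norm_eq_inner w_def inner_simps inner_commute[of "P y" "Q x"])
  then have ww: "(norm w)\<^sup>2 = 2 * (1 + k)" unfolding Qw Pw using uv by simp
  have "(\<mu> * (1 + k))\<^sup>2 \<le> a * (Q w \<bullet> w)" "(\<nu> * (1 + k))\<^sup>2 \<le> b * (P w \<bullet> w)"
    using positive_op_Cauchy_Schwarz[OF Q, of x w] positive_op_Cauchy_Schwarz[OF P, of y w]
    unfolding Qw Pw a_def b_def by simp_all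
  \<comment> \<open>p and q are the coefficients of the rank-one minorants of P and Q along the unit
    vectors P y / \<nu> and Q x / \<mu>.\<close>
  moreover define p q where "p = \<nu>\<^sup>2 / b" and "q = \<mu>\<^sup>2 / a"
  ultimately have "q * (1 + k)\<^sup>2 \<le> Q w \<bullet> w" "p * (1 + k)\<^sup>2 \<le> P w \<bullet> w"
    using ab by (simp_all add: p_def q_def pos_divide_le_eq power_mult_distrib mult.commute)
  moreover have "P w \<bullet> w + Q w \<bullet> w \<le> c * (2 * (1 + k))"
    using loewnerD[OF le, of w] unfolding ww[symmetric]
    by (simp add: blinfun.bilinear_simps inner_simps dot_square_norm)
  ultimately have "p * (1 + k)\<^sup>2 + q * (1 + k)\<^sup>2 \<le> c * (2 * (1 + k))" by linarith
  then have "((p + q) * (1 + k)) * (1 + k) \<le> (2 * c) * (1 + k)"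
    by (simp add: power2_eq_square algebra_simps)
  then have pq: "(p + q) * (1 + k) \<le> 2 * c" using k(1) by simp
  have p0: "p > 0" "q > 0" using uv ab by (simp_all add: p_def q_def)
  have "((p + q) * (1 + k))\<^sup>2 \<le> (2 * c)\<^sup>2"
    using p0 k by (intro power_mono[OF pq]) simp
  \<comment> \<open>Both factors are instances of 4 u v \<le> (u + v)^2, for p and q and for 1 and
    k. Together with the previous bound this gives 16 p q k \<le> 4 c^2.\<close>
  moreover have "(4 * (p * q)) * (4 * k) \<le> (p + q)\<^sup>2 * (1 + k)\<^sup>2"
  proof (rule mult_mono)
    show "4 * (p * q) \<le> (p + q)\<^sup>2" using sum_squares_bound[of p q] by (simp add: power2_sum)
    show "4 * k \<le> (1 + k)\<^sup>2" using sum_squares_bound[of 1 k] by (simp add: power2_sum)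
  qed (use k in simp_all)
  ultimately have c2: "4 * (p * q * k) \<le> c\<^sup>2" by (simp add: power_mult_distrib)
  \<comment> \<open>From a \<le> \<mu> norm x after multiplication by \<mu> / a, and likewise for b,
    \<nu> and y.\<close>
  have "\<mu> \<le> q * norm x" "\<nu> \<le> p * norm y"
    using nx ab uv by (simp_all add: p_def q_def power2_eq_square field_simps)
  then have "\<mu> * \<nu> \<le> (q * norm x) * (p * norm y)"
    using uv p0 by (intro mult_mono) simp_all
  then have "\<mu> * \<nu> * k \<le> (q * norm x) * (p * norm y) * k" using k(1) by (intro mult_right_mono) simp_all
  also have "\<dots> = (p * q * k) * (norm x * norm y)" by (simp add: algebra_simps)
  also have "\<dots> \<le> c\<^sup>2 / 4 * (norm x * norm y)" using c2 by (intro mult_right_mono) simp_all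
  finally show ?thesis unfolding k(2) .
qed

text \<open>For y = P Q x the left side of the bilinear bound is the squared norm of P Q x.\<close>

lemma norm_compose_positive_le:
  assumes P: "positive_op P" and Q: "positive_op Q" and le: "loewner (P + Q) (c *\<^sub>R id_blinfun)"
  shows "norm (P o\<^sub>L Q) \<le> c\<^sup>2 / 4"
proof (rule norm_blinfun_bound)
  fix x
  let ?y = "P (Q x)"
  show "norm ((P o\<^sub>L Q) x) \<le> c\<^sup>2 / 4 * norm x"
  proof (cases "?y = 0")
    case False
    have "P (Q x) \<bullet> ?y = Q x \<bullet> P ?y" using P by (simp add: positive_op_def self_adjoint_def)
    then have "norm ?y * norm ?y \<le> (c\<^sup>2 / 4 * norm x) * norm ?y"
      using positive_op_inner_le[OF assms, of x ?y]
      by (simp add: dot_square_norm power2_eq_square mult.assoc)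
    moreover have "0 < norm ?y" using False by simp
    ultimately show ?thesis by (simp add: mult_right_le_imp_le)
  qed simp
qed simp

section \<open>From the sum of powers to the comparison of p-th powers\<close>

lemma opow_le_scaleR:
  assumes X: "X \<in> op_interval m M" and m: "0 < m" "m \<le> M" and Mc: "M \<le> c" and s: "1 \<le> s"
  shows "loewner (opow X s) (c powr (s - 1) *\<^sub>R X)"
proof -
  have "loewner (opow X s) (cfun (\<lambda>x. c powr (s - 1) * x) X)"
    unfolding opow_def
  proof (rule cfun_mono[OF X m(2) continuous_on_powr_Icc[OF m(1)]])
    fix x assume x: "x \<in> {m..M}"
    have "x powr s = x powr (s - 1) * x powr 1" unfolding powr_add[symmetric] by simp
    also have "\<dots> \<le> c powr (s - 1) * x"
      using x m Mc s by (simp add: mult_right_mono powr_mono2)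
    finally show "x powr s \<le> c powr (s - 1) * x" .
  qed (intro continuous_intros)
  then show ?thesis
    using cfun_mult_left[OF X continuous_on_id, of "c powr (s - 1)"] by (simp add: cfun_ident[OF X])
qed

text \<open>H = mM G^(-1) lies between m and M again, since mM/x maps [m,M] to itself. X and H thus
  have the same linear majorant for their s-th powers, with slope c^(s-1) for c = m + M, and the
  bound X + H \<le> c is multiplied by that slope.\<close>

lemma opow_sum_le:
  assumes X: "X \<in> op_interval m M" and G: "G \<in> op_interval m M" and m: "0 < m" "m \<le> M"
    and kant: "kantorovich m M X G" and s: "1 \<le> s"
  shows "loewner (opow X s + (m * M) powr s *\<^sub>R opow G (- s)) ((m + M) powr s *\<^sub>R id_blinfun)"
proof -
  let ?c = "m + M"
  note pG = op_interval_posinv[OF G m(1)]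
  let ?H = "(m * M) *\<^sub>R opow G (-1)"
  have "?H \<in> op_interval (m * M * (1 / M)) (m * M * (1 / m))"
    using m by (intro op_interval_scaleR opow_minus_one_interval G) simp_all
  then have H: "?H \<in> op_interval m M" using m by simp
  have eq: "(m * M) powr s *\<^sub>R opow G (- s) = opow ?H s"
    using opow_scaleR[OF posinv_opow[OF pG], of "m * M" "-1" s] m by (simp add: opow_opow[OF pG])
  have "loewner (opow X s + opow ?H s) (?c powr (s - 1) *\<^sub>R X + ?c powr (s - 1) *\<^sub>R ?H)"
    using m s by (intro loewner_add opow_le_scaleR[OF X] opow_le_scaleR[OF H]) simp_all
  then have 1: "loewner (opow X s + opow ?H s) (?c powr (s - 1) *\<^sub>R (X + ?H))"
    by (simp only: scaleR_add_right)
  have "loewner (?c powr (s - 1) *\<^sub>R (X + ?H)) (?c powr (s - 1) *\<^sub>R (?c *\<^sub>R id_blinfun))"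
    using kant by (intro loewner_scaleR) (simp_all add: kantorovich_def)
  moreover have "?c powr (s - 1) * ?c = ?c powr s"
    using powr_add[of ?c "s - 1" 1] m by simp
  ultimately show ?thesis using loewner_trans[OF 1] by (simp add: eq)
qed

text \<open>A bound \<beta> on the norm of X^s G^(-s) means norm (X^s x) \<le> \<beta> norm (G^s x);
  its square is X^p \<le> \<beta>^2 G^p because p = 2 s.\<close>

lemma opow_le_opow_of_kantorovich:
  assumes X: "X \<in> op_interval m M" and G: "G \<in> op_interval m M" and m: "0 < m" "m \<le> M"
    and kant: "kantorovich m M X G" and p: "2 \<le> p"
  shows "loewner (opow X p) (((m + M) powr (2 * p) / (16 * m powr p * M powr p)) *\<^sub>R opow G p)"
proof -
  note pX = op_interval_posinv[OF X m(1)] and pG = op_interval_posinv[OF G m(1)]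
  define s where "s = p / 2"
  define \<alpha> where "\<alpha> = (m * M) powr s"
  have \<alpha>: "\<alpha> > 0" using m by (simp add: \<alpha>_def)
  have "norm (opow X s o\<^sub>L (\<alpha> *\<^sub>R opow G (- s))) \<le> ((m + M) powr s)\<^sup>2 / 4"
  proof (rule norm_compose_positive_le)
    show "loewner (opow X s + \<alpha> *\<^sub>R opow G (- s)) ((m + M) powr s *\<^sub>R id_blinfun)"
      unfolding \<alpha>_def by (rule opow_sum_le[OF X G m kant]) (use p in \<open>simp add: s_def\<close>)
    show "positive_op (opow X s)" "positive_op (\<alpha> *\<^sub>R opow G (- s))"
      using posinv_opow[OF pX] posinv_scaleR[OF posinv_opow[OF pG] \<alpha>] by (simp_all add: posinv_def)
  qed
  then have n: "\<alpha> * norm (opow X s o\<^sub>L opow G (- s)) \<le> ((m + M) powr s)\<^sup>2 / 4"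
    using \<alpha> by (simp add: compose_bilinear_simps)
  have sq: "(y powr s)\<^sup>2 = y powr p" if "0 < y" for y :: real
    using that by (simp add: s_def power2_eq_square powr_add[symmetric])
  \<comment> \<open>The bound (m + M)^p / 4 for the product with \<alpha> G^(-s), divided by
    \<alpha> = (mM)^s.\<close>
  define \<beta> where "\<beta> = (m + M) powr p / 4 / \<alpha>"
  have \<beta>: "norm (opow X s o\<^sub>L opow G (- s)) \<le> \<beta>"
    using n \<alpha> m by (simp add: \<beta>_def sq pos_le_divide_eq mult.commute)
  have \<beta>2: "\<beta>\<^sup>2 = (m + M) powr (2 * p) / (16 * m powr p * M powr p)"
  proof -
    have "\<alpha>\<^sup>2 = m powr p * M powr p" using m sq[of "m * M"] by (simp add: \<alpha>_def powr_mult)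
    moreover have "((m + M) powr p)\<^sup>2 = (m + M) powr (2 * p)"
      by (simp add: power2_eq_square powr_add[symmetric])
    ultimately show ?thesis by (simp add: \<beta>_def power_divide mult.assoc)
  qed
  show ?thesis
    unfolding \<beta>2[symmetric]
  proof (rule loewnerI)
    fix x
    let ?z = "opow G s x"
    have "norm (opow X s x) = norm ((opow X s o\<^sub>L opow G (- s)) ?z)"
      by (simp add: opow_apply_inverse[OF pG])
    also have "\<dots> \<le> norm (opow X s o\<^sub>L opow G (- s)) * norm ?z" by (rule norm_blinfun)
    also have "\<dots> \<le> \<beta> * norm ?z" using \<beta> by (rule mult_right_mono) simp
    finally have "(norm (opow X s x))\<^sup>2 \<le> (\<beta> * norm ?z)\<^sup>2" by (rule power_mono) simp
    then show "opow X p x \<bullet> x \<le> (\<beta>\<^sup>2 *\<^sub>R opow G p) x \<bullet> x"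
      using norm_opow_half[OF pX, of p x] norm_opow_half[OF pG, of p x]
      by (simp add: s_def power_mult_distrib blinfun.bilinear_simps)
  qed (simp_all add: self_adjoint_opow pX pG)
qed

theorem theorem4p1:
  fixes As :: "('a::{real_inner,complete_space} \<Rightarrow>\<^sub>L 'a) list"
    and t m M p :: real
  assumes "length As \<ge> 2"
    and "0 < t" and "t < 1"
    and "0 < m" and "m < M"
    and "\<forall>A\<in>set As. posinv A \<and> loewner (m *\<^sub>R id_blinfun) A \<and> loewner A (M *\<^sub>R id_blinfun)"
    and "p \<ge> 2"
  shows "loewner (opow (AM t As) p)
           (((m + M) powr (2 * p) / (16 * m powr p * M powr p)) *\<^sub>R opow (GM t As) p)"
proof -
  have m: "0 < m" "m \<le> M" using assms by simp_all
  interpret am: interval_mean m M t 1 wam2 "\<lambda>A B :: 'a op. norm (A - B)"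
    by (rule interval_mean_wam2) fact+
  interpret gm: interval_mean m M t "max (M\<^sup>2 / m) (1 / m)" sharp "thompson :: 'a op \<Rightarrow> _"
    by (rule interval_mean_sharp[OF m]) fact+
  define k where "k = length As - 2"
  have len: "length As = k + 2" using assms(1) by (simp add: k_def)
  have sub: "set As \<subseteq> op_interval m M" using assms(6) by (auto simp: op_interval_def)
  have nth: "As ! i \<in> op_interval m M" if "i < k + 2" for i
    using sub nth_mem[of i As] that len by auto
  \<comment> \<open>Both recursions start from the same list, so the entrywise relation required is
    that of each operator with itself.\<close>
  have "kantorovich m M (llrec wam2 t k As) (llrec sharp t k As)"
    by (rule kantorovich_llrec[OF m assms(2,3) len len sub sub]) (intro kantorovich_same nth m)
  then show ?thesis
    unfolding AM_def GM_def k_def[symmetric]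
    by (intro opow_le_opow_of_kantorovich am.mean_in_interval gm.mean_in_interval len sub m assms(7))
qed

end
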